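(* Let $n\ge 1$ and let $\underline{\zeta}:Z(\mathbb H)\to Z(\mathcal T_n)$ be Vogan's map projected onto the algebra $\mathcal T_n\cong\mathbb C[\tilde S_n]/\langle z+1\rangle$. Then $\underline\zeta$ is surjective onto the even part $Z(\mathcal T_n)_{\mathrm{even}}$ of the centre of $\mathcal T_n$. Also $\underline\zeta$ kills all odd polynomials in $Z(\mathbb H)=S(V)^{S_n}$, i.e. $\underline\zeta(f)=0$ for every symmetric polynomial $f$ that is a sum of homogeneous polynomials of odd degree.
   Context: $V=\mathrm{span}_{\mathbb C}\{\xi_1,\dots,\xi_n\}$ with bilinear form $(\xi_i,\xi_j)=\delta_{ij}$, on which $S_n$ acts by permutations; simple roots $\alpha_i=\xi_i-\xi_{i+1}$. **Graded Hecke algebra.** $\mathbb H$ is the associative unital $\mathbb C$-algebra generated by $S(V)$ and $\mathbb C[S_n]$ (both embedded as subalgebras, with $\mathbb H\cong S(V)\otimes\mathbb C[S_n]$ as a vector space) subject to $\xi\cdot s_\alpha-s_\alpha\cdot s_\alpha(\xi)=(\alpha,\xi)$ for all $\xi\in V$ and simple roots $\alpha$. Its centre is $Z(\mathbb H)=S(V)^{S_n}$. Let $w_0$ be the longest element of $S_n$ and $\delta$ the automorphism with $\delta(\xi)=-w_0(\xi)$ for $\xi\in V$. Let $*$ be the linear anti-automorphism of $\mathbb H$ with $w^*=w^{-1}$ for $w\in S_n$ and $\xi^*=w_0\,\delta(\xi)\,w_0$ for $\xi\in V$, and put $\tilde\xi=\frac12(\xi-\xi^* )\in\mathbb H$. **Clifford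 algebra and Dirac element.** $C(V)$ is the Clifford algebra generated by $V$ with $\xi\xi'+\xi'\xi=2(\xi,\xi')$. The Dirac element is $\mathcal D=\sum_{i=1}^n\tilde\xi_i\otimes\xi_i\in\mathbb H\otimes C(V)$. **$\mathcal T_n$.** $\mathcal T_n$ is the unital associative $\mathbb C$-algebra generated by $\tau_1,\dots,\tau_{n-1}$ with $\tau_i^2=1$, $(\tau_i\tau_{j})^{2}=-1$ if $|i-j|>1$, and $(\tau_i\tau_{i+1})^3=1$; it is $\mathbb Z/2$-graded with all $\tau_i$ odd. It is $\mathbb C[\tilde S_n]/\langle z+1\rangle$ for the corresponding double cover $\tilde S_n$ of $S_n$. $Z(\mathcal T_n)_{\mathrm{even}}$ is the set of even elements in the centre of the algebra $\mathcal T_n$. The diagonal embedding $\rho:\mathcal T_n\to\mathbb H\otimes C(V)$ is the algebra homomorphism $\rho(\tau_i)=s_i\otimes\alpha_i/\sqrt2$. **Vogan's map.** It is known (Barbasch–Ciubotaru–Trapa) that there is an algebra homomorphism $\underline\zeta:Z(\mathbb H)\to Z(\mathcal T_n)$ such that, for $f\in Z(\mathbb H)$, $\underline\zeta(f)$ is the unique element of $Z(\mathcal T_n)$ with $f\otimes1=\rho(\underline\zeta(f))+\mathcal Da+a\mathcal D$ for some $a\in\mathbb H\otimes C(V)$. *)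

theory Defs
  imports Complex_Main "HOL-Library.Poly_Mapping" "HOL-Algebra.QuotRing" "HOL-Algebra.Module"
    "HOL-Combinatorics.Permutations"
begin

section \<open>Associative complex algebras by generators and relations\<close>

text \<open>
  Words over \<open>'a\<close> form a (non-commutative) monoid, so that finitely supported functions from words
  to \<open>complex\<close> with the convolution product of \<open>Poly_Mapping\<close> are the free unital associative
  algebra on \<open>'a\<close>. The datatype wrapper avoids an additive monoid instance for \<open>list\<close> itself.
\<close>

datatype 'a word = Word (letters: "'a list")

instantiation word :: (type) monoid_add
begin

definition zero_word :: "'a word" where
  "zero_word = Word []"

definition plus_word :: "'a word \<Rightarrow> 'a word \<Rightarrow> 'a word" where
  "plus_word u v = Word (letters u @ letters v)"

instance
  by standard (simp_all add: zero_word_def plus_word_def)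

end

type_synonym 'a free = "'a word \<Rightarrow>\<^sub>0 complex"

definition gen :: "'a \<Rightarrow> 'a free" where
  "gen x = Poly_Mapping.single (Word [x]) 1"

definition scal :: "complex \<Rightarrow> 'a free" where
  "scal c = Poly_Mapping.single 0 c"

text \<open>
  A complex algebra is a record of type \<open>(complex, _) module\<close>: a ring record together with a scalar
  multiplication.
\<close>

definition free_alg :: "'a set \<Rightarrow> (complex, 'a free) module" where
  "free_alg X =
    \<lparr>carrier = {p. \<forall>w\<in>Poly_Mapping.keys p. set (letters w) \<subseteq> X},
     monoid.mult = (*), one = 1, zero = 0, add = (+), smult = (\<lambda>c p. scal c * p)\<rparr>"

text \<open>The class of \<open>p\<close> modulo the two-sided ideal generated by the relators \<open>R\<close>.\<close>

definition cls :: "'a set \<Rightarrow> 'a free set \<Rightarrow> 'a free \<Rightarrow> 'a free set" where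
  "cls X R p = genideal (free_alg X) R +>\<^bsub>free_alg X\<^esub> p"

definition presented_alg :: "'a set \<Rightarrow> 'a free set \<Rightarrow> (complex, 'a free set) module" where
  "presented_alg X R =
    (let Q = free_alg X Quot genideal (free_alg X) R
     in ring.extend Q (module.fields (\<lambda>c A. cls X R (scal c) \<otimes>\<^bsub>Q\<^esub> A)))"

definition alg_hom :: "(complex, 'a) module \<Rightarrow> (complex, 'b) module \<Rightarrow> ('a \<Rightarrow> 'b) set" where
  "alg_hom A B = {h \<in> ring_hom A B. \<forall>c. \<forall>x\<in>carrier A. h (c \<odot>\<^bsub>A\<^esub> x) = c \<odot>\<^bsub>B\<^esub> h x}"

definition centre :: "(complex, 'a) module \<Rightarrow> 'a set" where
  "centre A = {z \<in> carrier A. \<forall>x\<in>carrier A. x \<otimes>\<^bsub>A\<^esub> z = z \<otimes>\<^bsub>A\<^esub> x}"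

definition centre_alg :: "(complex, 'a) module \<Rightarrow> (complex, 'a) module" where
  "centre_alg A = A\<lparr>carrier := centre A\<rparr>"

text \<open>
  The (ungraded) tensor product over \<open>complex\<close>: generated by the elementary tensors, subject to
  bilinearity, componentwise multiplication and unit.
\<close>

definition tensor_rels :: "(complex, 'a) module \<Rightarrow> (complex, 'b) module \<Rightarrow> ('a \<times> 'b) free set" where
  "tensor_rels A B =
    {gen (a \<oplus>\<^bsub>A\<^esub> a', b) - gen (a, b) - gen (a', b) | a a' b.
        a \<in> carrier A \<and> a' \<in> carrier A \<and> b \<in> carrier B} \<union>
    {gen (a, b \<oplus>\<^bsub>B\<^esub> b') - gen (a, b) - gen (a, b') | a b b'.
        a \<in> carrier A \<and> b \<in> carrier B \<and> b' \<in> carrier B} \<union>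
    {gen (c \<odot>\<^bsub>A\<^esub> a, b) - scal c * gen (a, b) | c a b. a \<in> carrier A \<and> b \<in> carrier B} \<union>
    {gen (a, c \<odot>\<^bsub>B\<^esub> b) - scal c * gen (a, b) | c a b. a \<in> carrier A \<and> b \<in> carrier B} \<union>
    {gen (a, b) * gen (a', b') - gen (a \<otimes>\<^bsub>A\<^esub> a', b \<otimes>\<^bsub>B\<^esub> b') | a a' b b'.
        a \<in> carrier A \<and> a' \<in> carrier A \<and> b \<in> carrier B \<and> b' \<in> carrier B} \<union>
    {gen (\<one>\<^bsub>A\<^esub>, \<one>\<^bsub>B\<^esub>) - 1}"

definition tensor_alg ::
  "(complex, 'a) module \<Rightarrow> (complex, 'b) module \<Rightarrow> (complex, ('a \<times> 'b) free set) module" where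
  "tensor_alg A B = presented_alg (carrier A \<times> carrier B) (tensor_rels A B)"

definition tens ::
  "(complex, 'a) module \<Rightarrow> (complex, 'b) module \<Rightarrow> 'a \<Rightarrow> 'b \<Rightarrow> ('a \<times> 'b) free set" where
  "tens A B a b = cls (carrier A \<times> carrier B) (tensor_rels A B) (gen (a, b))"


section \<open>The space \<open>V\<close> and the action of the symmetric group\<close>

text \<open>A vector is its coordinate function with respect to \<open>\<xi>\<^sub>1, \<dots>, \<xi>\<^sub>n\<close>, zero outside \<open>{1..n}\<close>.\<close>

type_synonym vect = "nat \<Rightarrow> complex"

definition V :: "nat \<Rightarrow> vect set" where
  "V n = {v. \<forall>i. i \<notin> {1..n} \<longrightarrow> v i = 0}"

definition bilin :: "nat \<Rightarrow> vect \<Rightarrow> vect \<Rightarrow> complex" where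
  "bilin n u v = (\<Sum>i=1..n. u i * v i)"

definition xi :: "nat \<Rightarrow> vect" where
  "xi i = (\<lambda>j. if j = i then 1 else 0)"

definition simple_root :: "nat \<Rightarrow> vect" where
  "simple_root i = (\<lambda>j. xi i j - xi (Suc i) j)"

text \<open>The linear action with \<open>act w (xi i) = xi (w i)\<close>.\<close>

definition act :: "(nat \<Rightarrow> nat) \<Rightarrow> vect \<Rightarrow> vect" where
  "act w v = v \<circ> inv_into UNIV w"

definition simple_refl :: "nat \<Rightarrow> nat \<Rightarrow> nat" where
  "simple_refl i = transpose i (Suc i)"

text \<open>The longest element of the symmetric group is the order-reversing permutation.\<close>

definition w0 :: "nat \<Rightarrow> nat \<Rightarrow> nat" where
  "w0 n i = (if i \<in> {1..n} then Suc n - i else i)"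

definition lin :: "nat \<Rightarrow> (nat \<Rightarrow> 'a) \<Rightarrow> vect \<Rightarrow> 'a free" where
  "lin n g v = (\<Sum>i=1..n. scal (v i) * gen (g i))"


section \<open>The graded Hecke algebra\<close>

datatype hecke_gen = Xi nat | Perm "nat \<Rightarrow> nat"

definition hecke_gens :: "nat \<Rightarrow> hecke_gen set" where
  "hecke_gens n = Xi ` {1..n} \<union> Perm ` {w. w permutes {1..n}}"

text \<open>
  In order: the relations of \<open>S(V)\<close>, those of the group algebra, and the cross relations.
\<close>

definition hecke_rels :: "nat \<Rightarrow> hecke_gen free set" where
  "hecke_rels n =
    {lin n Xi u * lin n Xi v - lin n Xi v * lin n Xi u | u v. u \<in> V n \<and> v \<in> V n} \<union>
    {gen (Perm v) * gen (Perm w) - gen (Perm (v \<circ> w)) | v w.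
        v permutes {1..n} \<and> w permutes {1..n}} \<union>
    {gen (Perm id) - 1} \<union>
    {lin n Xi v * gen (Perm (simple_refl i))
        - gen (Perm (simple_refl i)) * lin n Xi (act (simple_refl i) v)
        - scal (bilin n (simple_root i) v) | v i. v \<in> V n \<and> i \<in> {1..<n}}"

definition hecke :: "nat \<Rightarrow> (complex, hecke_gen free set) module" where
  "hecke n = presented_alg (hecke_gens n) (hecke_rels n)"

definition hecke_vec :: "nat \<Rightarrow> vect \<Rightarrow> hecke_gen free set" where
  "hecke_vec n v = cls (hecke_gens n) (hecke_rels n) (lin n Xi v)"

definition hecke_perm :: "nat \<Rightarrow> (nat \<Rightarrow> nat) \<Rightarrow> hecke_gen free set" where
  "hecke_perm n w = cls (hecke_gens n) (hecke_rels n) (gen (Perm w))"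

text \<open>
  The values of the automorphism \<open>\<delta>\<close> (inside \<open>V\<close>) and of the anti-automorphism \<open>*\<close> at vectors; the
  Dirac element involves \<open>\<delta>\<close> and \<open>*\<close> only through these.
\<close>

definition delta_vec :: "nat \<Rightarrow> vect \<Rightarrow> vect" where
  "delta_vec n v = (\<lambda>j. - act (w0 n) v j)"

definition star_vec :: "nat \<Rightarrow> vect \<Rightarrow> hecke_gen free set" where
  "star_vec n v =
    hecke_perm n (w0 n) \<otimes>\<^bsub>hecke n\<^esub> hecke_vec n (delta_vec n v) \<otimes>\<^bsub>hecke n\<^esub> hecke_perm n (w0 n)"

definition tilde_vec :: "nat \<Rightarrow> vect \<Rightarrow> hecke_gen free set" where
  "tilde_vec n v = (1 / 2) \<odot>\<^bsub>hecke n\<^esub> (hecke_vec n v \<ominus>\<^bsub>hecke n\<^esub> star_vec n v)"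

text \<open>
  Polynomials in \<open>\<xi>\<^sub>1, \<dots>, \<xi>\<^sub>n\<close> are finitely supported functions from exponent vectors to \<open>complex\<close>;
  \<open>hecke_poly n\<close> is the embedding of \<open>S(V)\<close> into the Hecke algebra.
\<close>

type_synonym mpoly = "(nat \<Rightarrow>\<^sub>0 nat) \<Rightarrow>\<^sub>0 complex"

definition polys :: "nat \<Rightarrow> mpoly set" where
  "polys n = {p. \<forall>m\<in>Poly_Mapping.keys p. Poly_Mapping.keys m \<subseteq> {1..n}}"

definition symmetric_poly :: "nat \<Rightarrow> mpoly \<Rightarrow> bool" where
  "symmetric_poly n p \<longleftrightarrow>
    (\<forall>w m. w permutes {1..n} \<longrightarrow>
      Poly_Mapping.lookup p (Poly_Mapping.map_key w m) = Poly_Mapping.lookup p m)"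

definition odd_poly :: "nat \<Rightarrow> mpoly \<Rightarrow> bool" where
  "odd_poly n p \<longleftrightarrow> (\<forall>m\<in>Poly_Mapping.keys p. odd (\<Sum>i=1..n. Poly_Mapping.lookup m i))"

definition hecke_poly :: "nat \<Rightarrow> mpoly \<Rightarrow> hecke_gen free set" where
  "hecke_poly n p = cls (hecke_gens n) (hecke_rels n)
    (\<Sum>m\<in>Poly_Mapping.keys p. scal (Poly_Mapping.lookup p m) *
        prod_list (map (\<lambda>i. gen (Xi i) ^ Poly_Mapping.lookup m i) [1..<Suc n]))"


section \<open>The Clifford algebra and the Dirac element\<close>

definition cliff_rels :: "nat \<Rightarrow> nat free set" where
  "cliff_rels n =
    {lin n id u * lin n id v + lin n id v * lin n id u - scal (2 * bilin n u v) | u v.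
        u \<in> V n \<and> v \<in> V n}"

definition cliff :: "nat \<Rightarrow> (complex, nat free set) module" where
  "cliff n = presented_alg {1..n} (cliff_rels n)"

definition cliff_vec :: "nat \<Rightarrow> vect \<Rightarrow> nat free set" where
  "cliff_vec n v = cls {1..n} (cliff_rels n) (lin n id v)"

type_synonym hecke_cliff = "(hecke_gen free set \<times> nat free set) free set"

definition HC :: "nat \<Rightarrow> (complex, hecke_cliff) module" where
  "HC n = tensor_alg (hecke n) (cliff n)"

definition tensHC :: "nat \<Rightarrow> hecke_gen free set \<Rightarrow> nat free set \<Rightarrow> hecke_cliff" where
  "tensHC n = tens (hecke n) (cliff n)"

definition dirac :: "nat \<Rightarrow> hecke_cliff" where
  "dirac n = (\<Oplus>\<^bsub>HC n\<^esub>i\<in>{1..n}. tensHC n (tilde_vec n (xi i)) (cliff_vec n (xi i)))"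


section \<open>The twisted group algebra of the symmetric group and Vogan's map\<close>

definition T_rels :: "nat \<Rightarrow> nat free set" where
  "T_rels n =
    {gen i ^ 2 - 1 | i. i \<in> {1..<n}} \<union>
    {(gen i * gen j) ^ 2 + 1 | i j. i \<in> {1..<n} \<and> j \<in> {1..<n} \<and> \<bar>int i - int j\<bar> > 1} \<union>
    {(gen i * gen (Suc i)) ^ 3 - 1 | i. i \<in> {1..<n} \<and> Suc i \<in> {1..<n}}"

definition T_alg :: "nat \<Rightarrow> (complex, nat free set) module" where
  "T_alg n = presented_alg {1..<n} (T_rels n)"

definition tau :: "nat \<Rightarrow> nat \<Rightarrow> nat free set" where
  "tau n i = cls {1..<n} (T_rels n) (gen i)"

text \<open>The span of the products of an even number of generators.\<close>

definition T_even :: "nat \<Rightarrow> nat free set set" where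
  "T_even n = cls {1..<n} (T_rels n) `
    {p \<in> carrier (free_alg {1..<n}). \<forall>w\<in>Poly_Mapping.keys p. even (length (letters w))}"

text \<open>An algebra homomorphism on \<open>T_alg n\<close> is determined by its values at the generators.\<close>

definition diagonal_embedding :: "nat \<Rightarrow> (nat free set \<Rightarrow> hecke_cliff) \<Rightarrow> bool" where
  "diagonal_embedding n \<rho> \<longleftrightarrow>
    \<rho> \<in> alg_hom (T_alg n) (HC n) \<and>
    (\<forall>i\<in>{1..<n}. \<rho> (tau n i) =
      tensHC n (hecke_perm n (simple_refl i))
        (complex_of_real (1 / sqrt 2) \<odot>\<^bsub>cliff n\<^esub> cliff_vec n (simple_root i)))"

definition vogan_rel ::
  "nat \<Rightarrow> (nat free set \<Rightarrow> hecke_cliff) \<Rightarrow> hecke_gen free set \<Rightarrow> nat free set \<Rightarrow> bool" where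
  "vogan_rel n \<rho> f z \<longleftrightarrow>
    (\<exists>a\<in>carrier (HC n). tensHC n f \<one>\<^bsub>cliff n\<^esub> =
      \<rho> z \<oplus>\<^bsub>HC n\<^esub> dirac n \<otimes>\<^bsub>HC n\<^esub> a \<oplus>\<^bsub>HC n\<^esub> a \<otimes>\<^bsub>HC n\<^esub> dirac n)"

definition vogan_map ::
  "nat \<Rightarrow> (nat free set \<Rightarrow> hecke_cliff) \<Rightarrow> (hecke_gen free set \<Rightarrow> nat free set) \<Rightarrow> bool" where
  "vogan_map n \<rho> \<zeta> \<longleftrightarrow>
    \<zeta> \<in> alg_hom (centre_alg (hecke n)) (centre_alg (T_alg n)) \<and>
    (\<forall>f\<in>centre (hecke n). vogan_rel n \<rho> f (\<zeta> f) \<and>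
      (\<forall>z\<in>centre (T_alg n). vogan_rel n \<rho> f z \<longrightarrow> z = \<zeta> f))"

end

(*
Both properties of the image (even, and zero on odd polynomials) come from the uniqueness in Vogan's
map: the parity automorphism of H (x) C(V), and the automorphism xi -> -xi, w -> sgn(w) w of H, both
change the sign of the Dirac element D and act on rho(T_n) through the parity of T_n.

Surjectivity is a dimension count. Averaging over conjugates by lifts of permutations projects the
even part of T_n onto the even part of its centre; a lift of an even permutation averages to 0 if the
permutation has a cycle of even length (the lift is then, up to conjugacy and sign, a product of two
anticommuting odd factors), and otherwise the average depends up to sign only on the
cycle type. Hence the even centre is spanned by one vector for each partition of n into odd parts.
Conversely each partition of n into distinct parts gives a finite-dimensional H (x) C(V)-module on
which the symmetric polynomials act by scalars and which carries an operator N with nonzero trace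
anticommuting with D. If f acts by chi and f (x) 1 = D a + a D, then chi tr(N) = tr((D a + a D) N) = 0.
So these central characters factor through Vogan's map, and since they are separated by power sums,
the image has dimension at least the number of partitions into distinct parts, which by Euler is at
least the number of partitions into odd parts.
*)

theory Submission
  imports Defs "HOL-Computational_Algebra.Polynomial" "HOL-Combinatorics.Cycles" "HOL-Library.Multiset"
    "HOL-Library.Nat_Bijection"
begin

text \<open>The delicate point is an operator that anticommutes with D and is visibly not traceless.
  For a set \<Lambda> of distinct parts, the module consists of functions on the rearrangements of a
  word in which each part a occurs a times, tensored with the spin module; it models a module
  induced from a one-dimensional module of a parabolic subalgebra. Vectors act by transpositions
  weighted with half the difference between the order of positions and the order of labels.
  Conjugation by w0 reverses positions but not labels, so D compares labels only. Hence D has a sign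
  rule against the images of the \<tau>_i, the sums of Clifford generators over all positions of one
  label, and the volume element. Apart from the volume element, N has one such factor per position,
  chosen so that the permutations form a full cycle on each block of equal labels. Because distinct
  blocks have distinct sizes, only one word is fixed, and the trace reduces to one top-degree
  Clifford coefficient. On the T_n side the signs of lifts must be controlled, which requires
  knowing when two words in the generators give the same permutation; this is why the Coxeter
  presentation of S_n is derived.\<close>

declare One_nat_def [simp del]

section \<open>Free and presented algebras\<close>

definition mon :: "'a list \<Rightarrow> 'a free" where
  "mon xs = Poly_Mapping.single (Word xs) 1"

lemma mon_Nil [simp]: "mon [] = 1"
  by (simp add: mon_def zero_word_def[symmetric])

lemma mon_append: "mon (xs @ ys) = mon xs * mon ys"
  by (simp add: mon_def mult_single plus_word_def)

lemma mon_Cons: "mon (x # xs) = gen x * mon xs"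
  using mon_append[of "[x]" xs] by (simp add: mon_def gen_def)

lemma gen_mon: "gen x = mon [x]"
  by (simp add: mon_def gen_def)

lemma scal_0 [simp]: "scal 0 = 0" and scal_1 [simp]: "scal 1 = 1"
  by (simp_all add: scal_def)

lemma scal_add: "scal (a + b) = scal a + scal b"
  by (simp add: scal_def single_add)

lemma scal_mult: "scal (a * b) = scal a * scal b"
  by (simp add: scal_def mult_single)

lemma scal_minus: "scal (- a) = - scal a"
  by (simp add: scal_def single_uminus)

lemma scal_mon: "scal c * mon xs = Poly_Mapping.single (Word xs) c"
  by (simp add: scal_def mon_def mult_single)

lemma mon_scal: "mon xs * scal c = Poly_Mapping.single (Word xs) c"
  by (simp add: scal_def mon_def mult_single)

lemma free_expand: "p = (\<Sum>w\<in>Poly_Mapping.keys p. scal (Poly_Mapping.lookup p w) * mon (letters w))"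
proof (rule poly_mapping_eqI)
  fix k
  have "Poly_Mapping.lookup (\<Sum>w\<in>Poly_Mapping.keys p. Poly_Mapping.single w (Poly_Mapping.lookup p w)) k
      = (\<Sum>w\<in>Poly_Mapping.keys p. if w = k then Poly_Mapping.lookup p w else 0)"
    by (simp add: lookup_sum lookup_single when_def)
  also have "\<dots> = Poly_Mapping.lookup p k"
    by (simp add: sum.delta in_keys_iff)
  finally show "Poly_Mapping.lookup p k = Poly_Mapping.lookup
      (\<Sum>w\<in>Poly_Mapping.keys p. scal (Poly_Mapping.lookup p w) * mon (letters w)) k"
    by (simp add: scal_mon)
qed

lemma scal_central: "scal c * p = p * scal c"
  by (subst (1 2) free_expand[of p])
    (simp add: sum_distrib_left sum_distrib_right mult.assoc mon_scal scal_mon,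
      simp add: scal_def mult_single mult.commute)

definition fcar :: "'a set \<Rightarrow> 'a free set" where
  "fcar X = {p. \<forall>w\<in>Poly_Mapping.keys p. set (letters w) \<subseteq> X}"

lemma free_alg_simps [simp]:
  "carrier (free_alg X) = fcar X" "monoid.mult (free_alg X) = (*)" "one (free_alg X) = 1"
  "zero (free_alg X) = 0" "add (free_alg X) = (+)" "module.smult (free_alg X) = (\<lambda>c p. scal c * p)"
  by (auto simp: free_alg_def fcar_def)

lemma fcar_0 [simp]: "0 \<in> fcar X" and fcar_1 [simp]: "1 \<in> fcar X"
  by (auto simp: fcar_def zero_word_def)

lemma fcar_scal [simp]: "scal c \<in> fcar X"
  by (auto simp: fcar_def scal_def zero_word_def)

lemma fcar_mon: "set xs \<subseteq> X \<Longrightarrow> mon xs \<in> fcar X"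
  by (auto simp: fcar_def mon_def)

lemma fcar_gen: "x \<in> X \<Longrightarrow> gen x \<in> fcar X"
  by (simp add: gen_mon fcar_mon)

lemma fcar_add [simp]: "p \<in> fcar X \<Longrightarrow> q \<in> fcar X \<Longrightarrow> p + q \<in> fcar X"
  using keys_add[of p q] by (auto simp: fcar_def)

lemma fcar_uminus [simp]: "p \<in> fcar X \<Longrightarrow> - p \<in> fcar X"
  by (auto simp: fcar_def)

lemma fcar_diff [simp]: "p \<in> fcar X \<Longrightarrow> q \<in> fcar X \<Longrightarrow> p - q \<in> fcar X"
  using fcar_add[of p X "- q"] by simp

lemma fcar_mult [simp]: "p \<in> fcar X \<Longrightarrow> q \<in> fcar X \<Longrightarrow> p * q \<in> fcar X"
  using keys_mult[of p q] by (fastforce simp: fcar_def plus_word_def)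

lemma fcar_power [simp]: "p \<in> fcar X \<Longrightarrow> p ^ k \<in> fcar X"
  by (induction k) auto

lemma fcar_sum: "(\<And>i. i \<in> I \<Longrightarrow> f i \<in> fcar X) \<Longrightarrow> sum f I \<in> fcar X"
  by (induction I rule: infinite_finite_induct) auto

lemma fcar_prod_list: "(\<And>x. x \<in> set xs \<Longrightarrow> x \<in> fcar X) \<Longrightarrow> prod_list xs \<in> fcar X"
  by (induction xs) auto

lemma fcar_induct [consumes 1, case_names zero add mon]:
  assumes "p \<in> fcar X" "P 0" "\<And>p q. P p \<Longrightarrow> P q \<Longrightarrow> P (p + q)"
    "\<And>c xs. set xs \<subseteq> X \<Longrightarrow> P (scal c * mon xs)"
  shows "P p"
proof -
  have "P (\<Sum>w\<in>S. scal (Poly_Mapping.lookup p w) * mon (letters w))"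
    if "finite S" "S \<subseteq> Poly_Mapping.keys p" for S
    using that assms(1) by (induction S rule: finite_induct) (auto simp: fcar_def intro!: assms(2-4))
  from this[of "Poly_Mapping.keys p"] show ?thesis by (metis finite_keys free_expand order_refl)
qed

lemma free_induct [case_names zero add mon]:
  assumes "P 0" "\<And>p q. P p \<Longrightarrow> P q \<Longrightarrow> P (p + q)" "\<And>c xs. P (scal c * mon xs)"
  shows "P p"
  by (rule fcar_induct[of p UNIV]) (auto intro: assms simp: fcar_def)

section \<open>Evaluation homomorphisms out of the free algebra\<close>

definition feval :: "(complex \<Rightarrow> 'r::ring_1) \<Rightarrow> ('a \<Rightarrow> 'r) \<Rightarrow> 'a free \<Rightarrow> 'r" where
  "feval \<sigma> g p = (\<Sum>w\<in>Poly_Mapping.keys p. \<sigma> (Poly_Mapping.lookup p w) * prod_list (map g (letters w)))"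

text \<open>The target is a type-class ring with a central copy of the scalars. The instance
  \<open>scal\<close> yields homomorphisms between free algebras, the instance \<open>osc\<close>
  yields representations by operators.\<close>

locale scalars =
  fixes \<sigma> :: "complex \<Rightarrow> 'r::ring_1"
  assumes add: "\<sigma> (a + b) = \<sigma> a + \<sigma> b"
    and mult: "\<sigma> (a * b) = \<sigma> a * \<sigma> b"
    and one: "\<sigma> 1 = 1"
    and central: "\<sigma> a * x = x * \<sigma> a"
begin

lemma zero: "\<sigma> 0 = 0"
  using add[of 0 0] by simp

lemma feval_superset:
  assumes "finite S" "Poly_Mapping.keys p \<subseteq> S"
  shows "feval \<sigma> g p = (\<Sum>w\<in>S. \<sigma> (Poly_Mapping.lookup p w) * prod_list (map g (letters w)))"
  unfolding feval_def using assms
  by (intro sum.mono_neutral_left) (auto simp: in_keys_iff zero)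

lemma feval_add: "feval \<sigma> g (p + q) = feval \<sigma> g p + feval \<sigma> g q"
proof -
  let ?S = "Poly_Mapping.keys p \<union> Poly_Mapping.keys q"
  have "Poly_Mapping.keys (p + q) \<subseteq> ?S" by (rule keys_add)
  then show ?thesis
    by (simp add: feval_superset[of ?S] lookup_add add distrib_right sum.distrib)
qed

lemma feval_0 [simp]: "feval \<sigma> g 0 = 0"
  by (simp add: feval_def)

lemma feval_minus: "feval \<sigma> g (- p) = - feval \<sigma> g p"
  using feval_add[of g p "- p"] by (simp add: add_eq_0_iff)

lemma feval_diff: "feval \<sigma> g (p - q) = feval \<sigma> g p - feval \<sigma> g q"
  using feval_add[of g p "- q"] by (simp add: feval_minus)

lemma feval_sum: "feval \<sigma> g (sum f I) = (\<Sum>i\<in>I. feval \<sigma> g (f i))"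
  by (induction I rule: infinite_finite_induct) (auto simp: feval_add)

lemma feval_scal_mon: "feval \<sigma> g (scal c * mon xs) = \<sigma> c * prod_list (map g xs)"
  by (simp add: scal_mon feval_def zero)

lemma feval_mon: "feval \<sigma> g (mon xs) = prod_list (map g xs)"
  using feval_scal_mon[of g 1 xs] by (simp add: one)

lemma feval_gen: "feval \<sigma> g (gen x) = g x"
  by (simp add: gen_mon feval_mon)

lemma feval_scal: "feval \<sigma> g (scal c) = \<sigma> c"
  using feval_scal_mon[of g c "[]"] by simp

lemma feval_1 [simp]: "feval \<sigma> g 1 = 1"
  using feval_mon[of g "[]"] by simp

lemma feval_mult: "feval \<sigma> g (p * q) = feval \<sigma> g p * feval \<sigma> g q"
proof (induction p rule: free_induct)
  case (mon c xs)
  show ?case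
  proof (induction q rule: free_induct)
    case (mon d ys)
    have "scal c * mon xs * (scal d * mon ys) = scal (c * d) * mon (xs @ ys)"
      by (simp add: scal_mon mult_single plus_word_def)
    moreover have "x * (\<sigma> d * y) = \<sigma> d * (x * y)" for x y
      by (metis central mult.assoc)
    ultimately show ?case
      by (simp add: feval_scal_mon mult mult.assoc)
  qed (simp_all add: feval_add distrib_left)
qed (simp_all add: feval_add distrib_right)

lemma feval_power: "feval \<sigma> g (p ^ k) = feval \<sigma> g p ^ k"
  by (induction k) (auto simp: feval_mult)

end

interpretation scal: scalars "scal :: complex \<Rightarrow> 'a free"
  by standard (rule scal_add scal_mult scal_1 scal_central)+

lemma fcar_feval:
  assumes "p \<in> fcar X" "\<And>x. x \<in> X \<Longrightarrow> g x \<in> fcar Y"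
  shows "feval scal g p \<in> fcar Y"
  using assms(1)
proof (induction p rule: fcar_induct)
  case (mon c xs)
  then have "prod_list (map g xs) \<in> fcar Y"
    by (intro fcar_prod_list) (auto intro: assms(2))
  then show ?case
    unfolding scal.feval_scal_mon by (intro fcar_mult fcar_scal)
qed (auto simp: scal.feval_add)

lemma ring_free_alg: "ring (free_alg X)"
proof (rule ringI)
  show "abelian_group (free_alg X)"
  proof (rule abelian_groupI)
    show "\<exists>y\<in>carrier (free_alg X). y \<oplus>\<^bsub>free_alg X\<^esub> x = \<zero>\<^bsub>free_alg X\<^esub>"
      if "x \<in> carrier (free_alg X)" for x
      using that by (intro bexI[of _ "- x"]) auto
  qed (auto simp: algebra_simps)
  show "Group.monoid (free_alg X)"
    by (rule Group.monoidI) (auto simp: mult.assoc)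
qed (auto simp: algebra_simps)

section \<open>Quotients by relators, calculated on representatives\<close>

locale presentation =
  fixes X :: "'a set" and R :: "'a free set"
  assumes R_carrier: "R \<subseteq> fcar X"
begin

definition J where "J = genideal (free_alg X) R"

abbreviation A where "A \<equiv> presented_alg X R"

lemma ideal_J: "ideal J (free_alg X)"
  unfolding J_def using R_carrier by (intro ring.genideal_ideal ring_free_alg) auto

lemma R_J: "r \<in> R \<Longrightarrow> r \<in> J"
  unfolding J_def using ring.genideal_self[OF ring_free_alg, of R X] R_carrier by auto

lemma J_0 [simp]: "0 \<in> J"
  using additive_subgroup.zero_closed[OF ideal.axioms(1)[OF ideal_J]] by simp

lemma J_add: "p \<in> J \<Longrightarrow> q \<in> J \<Longrightarrow> p + q \<in> J"
  using additive_subgroup.a_closed[OF ideal.axioms(1)[OF ideal_J]] by simp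

lemma J_mult_left: "p \<in> J \<Longrightarrow> q \<in> fcar X \<Longrightarrow> q * p \<in> J"
  using ideal.I_l_closed[OF ideal_J] by simp

lemma J_mult_right: "p \<in> J \<Longrightarrow> q \<in> fcar X \<Longrightarrow> p * q \<in> J"
  using ideal.I_r_closed[OF ideal_J] by simp

lemma J_minus: "p \<in> J \<Longrightarrow> - p \<in> J"
  using J_mult_left[of p "scal (- 1)"] by (simp add: scal_minus)

lemma J_diff: "p \<in> J \<Longrightarrow> q \<in> J \<Longrightarrow> p - q \<in> J"
  using J_add[of p "- q"] J_minus by simp

text \<open>The tool for descending maps to the quotient: with \<open>K\<close> the kernel of an
  evaluation, or the preimage of another ideal, everything is checked on the relators alone.\<close>

lemma J_minimal:
  assumes "\<And>r. r \<in> R \<Longrightarrow> r \<in> K" "K \<subseteq> fcar X" "0 \<in> K"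
    "\<And>p q. p \<in> K \<Longrightarrow> q \<in> K \<Longrightarrow> p + q \<in> K"
    "\<And>p. p \<in> K \<Longrightarrow> - p \<in> K"
    "\<And>p q. p \<in> K \<Longrightarrow> q \<in> fcar X \<Longrightarrow> q * p \<in> K"
    "\<And>p q. p \<in> K \<Longrightarrow> q \<in> fcar X \<Longrightarrow> p * q \<in> K"
  shows "J \<subseteq> K"
proof -
  interpret F: ring "free_alg X" by (rule ring_free_alg)
  have inv: "\<ominus>\<^bsub>free_alg X\<^esub> p = - p" if "p \<in> fcar X" for p
    using that by (intro F.minus_equality) auto
  have "subgroup K (add_monoid (free_alg X))"
    using assms inv by unfold_locales (auto simp: a_inv_def)
  then have "ideal K (free_alg X)"
    using assms by (intro idealI ring_free_alg) auto
  then show ?thesis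
    unfolding J_def genideal_def using assms(1) by auto
qed

text \<open>Calculations run on representatives, where sums are type-class sums and need no carrier
  conditions; \<open>cl_eq_iff\<close> carries the result over to cosets.\<close>

definition eqv :: "'a free \<Rightarrow> 'a free \<Rightarrow> bool" (infix "\<doteq>" 50) where
  "p \<doteq> q \<longleftrightarrow> p - q \<in> J"

lemma eqv_refl [simp]: "p \<doteq> p"
  by (simp add: eqv_def)

lemma eqv_sym: "p \<doteq> q \<Longrightarrow> q \<doteq> p"
  using J_minus[of "p - q"] by (simp add: eqv_def)

lemma eqv_trans [trans]: "p \<doteq> q \<Longrightarrow> q \<doteq> r \<Longrightarrow> p \<doteq> r"
  using J_add[of "p - q" "q - r"] by (simp add: eqv_def)

lemma eqv_rel: "p - q \<in> R \<Longrightarrow> p \<doteq> q"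
  by (simp add: eqv_def R_J)

lemma eqv_add: "p \<doteq> p' \<Longrightarrow> q \<doteq> q' \<Longrightarrow> p + q \<doteq> p' + q'"
  using J_add[of "p - p'" "q - q'"] by (simp add: eqv_def algebra_simps)

lemma eqv_diff: "p \<doteq> p' \<Longrightarrow> q \<doteq> q' \<Longrightarrow> p - q \<doteq> p' - q'"
  using J_diff[of "p - p'" "q - q'"] by (simp add: eqv_def algebra_simps)

lemma eqv_minus: "p \<doteq> p' \<Longrightarrow> - p \<doteq> - p'"
  using eqv_diff[of 0 0 p p'] by simp

lemma eqv_sum: "(\<And>i. i \<in> I \<Longrightarrow> f i \<doteq> g i) \<Longrightarrow> sum f I \<doteq> sum g I"
  by (induction I rule: infinite_finite_induct) (auto intro: eqv_add)

lemma eqv_mult_left: "p \<doteq> q \<Longrightarrow> r \<in> fcar X \<Longrightarrow> r * p \<doteq> r * q"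
  using J_mult_left[of "p - q" r] by (simp add: eqv_def algebra_simps)

lemma eqv_mult_right: "p \<doteq> q \<Longrightarrow> r \<in> fcar X \<Longrightarrow> p * r \<doteq> q * r"
  using J_mult_right[of "p - q" r] by (simp add: eqv_def algebra_simps)

definition cl where "cl = cls X R"

lemma cl_def': "cl p = J +>\<^bsub>free_alg X\<^esub> p"
  by (simp add: cl_def cls_def J_def)

lemma cl_eq_iff: "p \<in> fcar X \<Longrightarrow> q \<in> fcar X \<Longrightarrow> cl p = cl q \<longleftrightarrow> p \<doteq> q"
proof -
  assume p: "p \<in> fcar X" and q: "q \<in> fcar X"
  interpret F: ring "free_alg X" by (rule ring_free_alg)
  have minus: "p \<ominus>\<^bsub>free_alg X\<^esub> q = p - q"
  proof -
    have "\<ominus>\<^bsub>free_alg X\<^esub> q = - q" using q by (intro F.minus_equality) auto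
    then show ?thesis by (simp add: a_minus_def)
  qed
  show ?thesis
    using F.quotient_eq_iff_same_a_r_cos[OF ideal_J, of p q] p q by (simp add: minus eqv_def cl_def')
qed

lemma presented_simps:
  "carrier A = carrier (free_alg X Quot J)" "monoid.mult A = monoid.mult (free_alg X Quot J)"
  "one A = one (free_alg X Quot J)" "zero A = zero (free_alg X Quot J)" "add A = add (free_alg X Quot J)"
  "module.smult A = (\<lambda>c B. cl (scal c) \<otimes>\<^bsub>free_alg X Quot J\<^esub> B)"
  unfolding presented_alg_def J_def[symmetric]
  by (simp_all add: Let_def ring.defs module.defs cl_def)

lemma carrier_A: "carrier A = cl ` fcar X"
  by (auto simp: presented_simps FactRing_def A_RCOSETS_def' cl_def')

lemma cl_carrier [simp]: "p \<in> fcar X \<Longrightarrow> cl p \<in> carrier A"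
  by (auto simp: carrier_A)

lemma mult_cl: "p \<in> fcar X \<Longrightarrow> q \<in> fcar X \<Longrightarrow> cl p \<otimes>\<^bsub>A\<^esub> cl q = cl (p * q)"
  by (simp add: presented_simps FactRing_def cl_def' ideal.rcoset_mult_add[OF ideal_J])

lemma add_cl: "p \<in> fcar X \<Longrightarrow> q \<in> fcar X \<Longrightarrow> cl p \<oplus>\<^bsub>A\<^esub> cl q = cl (p + q)"
  by (simp add: presented_simps FactRing_def cl_def' abelian_subgroup.a_rcos_sum[OF abelian_subgroupI3[OF ideal.axioms(1)[OF ideal_J] ring.is_abelian_group[OF ring_free_alg]]])

lemma one_cl: "one A = cl 1"
  by (simp add: presented_simps FactRing_def cl_def')

lemma zero_cl: "zero A = cl 0"
proof -
  have "J +>\<^bsub>free_alg X\<^esub> 0 = J" using ring.a_rcos_zero[OF ring_free_alg ideal_J J_0] by simp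
  then show ?thesis by (simp add: presented_simps FactRing_def cl_def')
qed

lemma smult_cl: "p \<in> fcar X \<Longrightarrow> c \<odot>\<^bsub>A\<^esub> cl p = cl (scal c * p)"
  using mult_cl[of "scal c" p] by (simp add: presented_simps)

lemma carrier_cases:
  assumes "x \<in> carrier A" obtains p where "p \<in> fcar X" "x = cl p"
  using assms by (auto simp: carrier_A)

lemma ring_A: "ring A"
proof (rule ringI)
  show "abelian_group A"
  proof (rule abelian_groupI)
    fix x assume "x \<in> carrier A"
    then obtain p where "p \<in> fcar X" "x = cl p" by (rule carrier_cases)
    then show "\<exists>y\<in>carrier A. y \<oplus>\<^bsub>A\<^esub> x = \<zero>\<^bsub>A\<^esub>"
      by (intro bexI[of _ "cl (- p)"]) (auto simp: add_cl zero_cl)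
  qed (auto elim!: carrier_cases simp: add_cl zero_cl algebra_simps)
  show "Group.monoid A"
    by (rule Group.monoidI) (auto elim!: carrier_cases simp: mult_cl one_cl mult.assoc)
qed (auto elim!: carrier_cases simp: add_cl mult_cl algebra_simps)

lemma a_inv_cl: "p \<in> fcar X \<Longrightarrow> \<ominus>\<^bsub>A\<^esub> cl p = cl (- p)"
proof -
  interpret A: ring A by (rule ring_A)
  show "p \<in> fcar X \<Longrightarrow> \<ominus>\<^bsub>A\<^esub> cl p = cl (- p)"
    by (rule A.minus_equality) (auto simp: add_cl zero_cl)
qed

lemma a_minus_cl: "p \<in> fcar X \<Longrightarrow> q \<in> fcar X \<Longrightarrow> cl p \<ominus>\<^bsub>A\<^esub> cl q = cl (p - q)"
  by (simp add: a_minus_def a_inv_cl add_cl)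

lemma finsum_cl:
  assumes "finite I" "\<And>i. i \<in> I \<Longrightarrow> f i \<in> fcar X"
  shows "(\<Oplus>\<^bsub>A\<^esub>i\<in>I. cl (f i)) = cl (\<Sum>i\<in>I. f i)"
  using assms
proof (induction I rule: finite_induct)
  interpret A: ring A by (rule ring_A)
  {
    case empty
    show ?case by (simp add: zero_cl)
  next
  case (insert i I)
  then have "(\<Oplus>\<^bsub>A\<^esub>i\<in>insert i I. cl (f i)) = cl (f i) \<oplus>\<^bsub>A\<^esub> (\<Oplus>\<^bsub>A\<^esub>i\<in>I. cl (f i))"
    by (intro A.finsum_insert) auto
  with insert show ?case by (simp add: add_cl fcar_sum)
  }
qed

lemma feval_cong:
  fixes \<sigma> :: "complex \<Rightarrow> 'r::ring_1"
  assumes "scalars \<sigma>" "\<And>r. r \<in> R \<Longrightarrow> feval \<sigma> g r = 0" "p \<doteq> q"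
  shows "feval \<sigma> g p = feval \<sigma> g q"
proof -
  interpret scalars \<sigma> by fact
  have "J \<subseteq> {p \<in> fcar X. feval \<sigma> g p = 0}"
    using R_carrier assms(2)
    by (intro J_minimal) (auto simp: feval_add feval_minus feval_mult)
  with assms(3) show ?thesis by (auto simp: eqv_def feval_diff)
qed

text \<open>Maps out of the quotient are defined on a chosen representative; \<open>rep_cl\<close>
  and a congruence lemma such as \<open>feval_cong\<close> make them independent of the
  choice.\<close>

definition rep where "rep x = (SOME p. p \<in> fcar X \<and> cl p = x)"

lemma rep: "x \<in> carrier A \<Longrightarrow> rep x \<in> fcar X \<and> cl (rep x) = x"
  unfolding rep_def by (rule someI_ex) (auto elim: carrier_cases)

lemma rep_cl: "p \<in> fcar X \<Longrightarrow> rep (cl p) \<doteq> p"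
  using rep[of "cl p"] by (simp add: cl_eq_iff[symmetric])

lemma presentation_hom:
  assumes "presentation Y S" "\<And>x. x \<in> X \<Longrightarrow> g x \<in> fcar Y"
    "\<And>r. r \<in> R \<Longrightarrow> feval scal g r \<in> presentation.J Y S" "p \<doteq> q"
  shows "presentation.eqv Y S (feval scal g p) (feval scal g q)"
proof -
  interpret Y: presentation Y S by fact
  have fe: "feval scal g q \<in> fcar Y" if "q \<in> fcar X" for q
    using that assms(2) by (rule fcar_feval)
  have "J \<subseteq> {p \<in> fcar X. feval scal g p \<in> Y.J}"
    using R_carrier assms(3) fe
    by (intro J_minimal)
      (auto simp: scal.feval_add scal.feval_minus scal.feval_mult
        intro: Y.J_add Y.J_minus Y.J_mult_left Y.J_mult_right)
  with assms(4) show ?thesis by (auto simp: eqv_def Y.eqv_def scal.feval_diff)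
qed

end

lemma alg_homI:
  assumes "\<And>x. x \<in> carrier A \<Longrightarrow> h x \<in> carrier B"
    "\<And>x y. x \<in> carrier A \<Longrightarrow> y \<in> carrier A \<Longrightarrow> h (x \<otimes>\<^bsub>A\<^esub> y) = h x \<otimes>\<^bsub>B\<^esub> h y"
    "\<And>x y. x \<in> carrier A \<Longrightarrow> y \<in> carrier A \<Longrightarrow> h (x \<oplus>\<^bsub>A\<^esub> y) = h x \<oplus>\<^bsub>B\<^esub> h y"
    "h \<one>\<^bsub>A\<^esub> = \<one>\<^bsub>B\<^esub>"
    "\<And>c x. x \<in> carrier A \<Longrightarrow> h (c \<odot>\<^bsub>A\<^esub> x) = c \<odot>\<^bsub>B\<^esub> h x"
  shows "h \<in> alg_hom A B"
  using assms by (auto simp: alg_hom_def intro!: ring_hom_memI)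

lemma
  assumes "h \<in> alg_hom A B"
  shows alg_hom_closed: "x \<in> carrier A \<Longrightarrow> h x \<in> carrier B"
    and alg_hom_mult: "x \<in> carrier A \<Longrightarrow> y \<in> carrier A \<Longrightarrow> h (x \<otimes>\<^bsub>A\<^esub> y) = h x \<otimes>\<^bsub>B\<^esub> h y"
    and alg_hom_add: "x \<in> carrier A \<Longrightarrow> y \<in> carrier A \<Longrightarrow> h (x \<oplus>\<^bsub>A\<^esub> y) = h x \<oplus>\<^bsub>B\<^esub> h y"
    and alg_hom_one: "h \<one>\<^bsub>A\<^esub> = \<one>\<^bsub>B\<^esub>"
    and alg_hom_smult: "x \<in> carrier A \<Longrightarrow> h (c \<odot>\<^bsub>A\<^esub> x) = c \<odot>\<^bsub>B\<^esub> h x"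
  using assms
  by (auto simp: alg_hom_def ring_hom_mult ring_hom_add ring_hom_one ring_hom_closed)

lemma alg_hom_id: "(\<lambda>x. x) \<in> alg_hom A A"
  by (rule alg_homI) auto

lemma alg_hom_compose:
  assumes "h \<in> alg_hom A B" "k \<in> alg_hom B C"
  shows "(\<lambda>x. k (h x)) \<in> alg_hom A C"
  using assms
  by (intro alg_homI)
    (simp_all add: alg_hom_closed[OF assms(1)] alg_hom_closed[OF assms(2)] alg_hom_mult[OF assms(1)]
      alg_hom_mult[OF assms(2)] alg_hom_add[OF assms(1)] alg_hom_add[OF assms(2)]
      alg_hom_one[OF assms(1)] alg_hom_one[OF assms(2)] alg_hom_smult[OF assms(1)] alg_hom_smult[OF assms(2)])

lemma alg_hom_zero:
  assumes "h \<in> alg_hom A B" "ring A" "ring B"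
  shows "h \<zero>\<^bsub>A\<^esub> = \<zero>\<^bsub>B\<^esub>"
proof -
  interpret A: ring A by fact
  interpret B: ring B by fact
  have "h \<zero>\<^bsub>A\<^esub> \<oplus>\<^bsub>B\<^esub> h \<zero>\<^bsub>A\<^esub> = h \<zero>\<^bsub>A\<^esub>"
    using alg_hom_add[OF assms(1), of "\<zero>\<^bsub>A\<^esub>" "\<zero>\<^bsub>A\<^esub>"] by simp
  then show ?thesis
    using alg_hom_closed[OF assms(1), of "\<zero>\<^bsub>A\<^esub>"] by (simp add: B.add.r_cancel_one)
qed

context presentation
begin

lemma alg_hom_eqI:
  assumes h: "h \<in> alg_hom A B" and k: "k \<in> alg_hom A B"
    and gen: "\<And>x. x \<in> X \<Longrightarrow> h (cl (gen x)) = k (cl (gen x))" and "y \<in> carrier A"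
  shows "h y = k y"
proof -
  have mon: "h (cl (mon xs)) = k (cl (mon xs))" if "set xs \<subseteq> X" for xs
    using that
  proof (induction xs)
    case Nil
    show ?case using alg_hom_one[OF h] alg_hom_one[OF k] by (simp add: one_cl)
  next
    case (Cons x xs)
    then have *: "cl (mon (x # xs)) = cl (gen x) \<otimes>\<^bsub>A\<^esub> cl (mon xs)"
      by (simp add: mult_cl fcar_gen fcar_mon mon_Cons)
    show ?case
      unfolding * using Cons gen
      by (simp add: alg_hom_mult[OF h] alg_hom_mult[OF k] fcar_gen fcar_mon)
  qed
  have "h (cl p) = k (cl p) \<and> p \<in> fcar X" if "p \<in> fcar X" for p
    using that
  proof (induction p rule: fcar_induct)
    case zero
    have *: "cl 0 = 0 \<odot>\<^bsub>A\<^esub> cl 1" by (simp add: smult_cl)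
    show ?case
      unfolding * using mon[of "[]"] by (simp add: alg_hom_smult[OF h] alg_hom_smult[OF k])
  next
    case (add p q)
    then show ?case
      by (simp add: add_cl[symmetric] alg_hom_add[OF h] alg_hom_add[OF k])
  next
    case (mon c xs)
    then show ?case
      using \<open>set xs \<subseteq> X \<Longrightarrow> h (cl (mon xs)) = k (cl (mon xs))\<close>
      by (simp add: smult_cl[symmetric] alg_hom_smult[OF h] alg_hom_smult[OF k] fcar_mon)
  qed
  with assms(4) show ?thesis by (auto elim: carrier_cases)
qed

definition endo where "endo g x = cl (feval scal g (rep x))"

definition endo_ok where
  "endo_ok g \<longleftrightarrow> (\<forall>x\<in>X. g x \<in> fcar X) \<and> (\<forall>r\<in>R. feval scal g r \<in> J)"

lemma endo_cl:
  assumes "endo_ok g" "p \<in> fcar X"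
  shows "endo g (cl p) = cl (feval scal g p)"
proof -
  have "feval scal g (rep (cl p)) \<doteq> feval scal g p"
    using assms
    by (intro presentation_hom[OF presentation_axioms] rep_cl) (auto simp: endo_ok_def)
  then show ?thesis
    unfolding endo_def using assms rep[of "cl p"]
    by (subst cl_eq_iff) (auto intro: fcar_feval simp: endo_ok_def)
qed

lemma endo_alg_hom:
  assumes "endo_ok g"
  shows "endo g \<in> alg_hom A A"
proof (rule alg_homI)
  have fe: "feval scal g p \<in> fcar X" if "p \<in> fcar X" for p
    using that assms by (auto intro: fcar_feval simp: endo_ok_def)
  note simps = endo_cl[OF assms] mult_cl add_cl one_cl smult_cl fe scal.feval_mult scal.feval_add
    scal.feval_scal
  show "endo g x \<in> carrier A" if "x \<in> carrier A" for x
    using that by (auto elim!: carrier_cases simp: simps)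
  show "endo g (x \<otimes>\<^bsub>A\<^esub> y) = endo g x \<otimes>\<^bsub>A\<^esub> endo g y" if "x \<in> carrier A" "y \<in> carrier A" for x y
    using that by (auto elim!: carrier_cases simp: simps)
  show "endo g (x \<oplus>\<^bsub>A\<^esub> y) = endo g x \<oplus>\<^bsub>A\<^esub> endo g y" if "x \<in> carrier A" "y \<in> carrier A" for x y
    using that by (auto elim!: carrier_cases simp: simps)
  show "endo g \<one>\<^bsub>A\<^esub> = \<one>\<^bsub>A\<^esub>"
    by (simp add: simps)
  show "endo g (c \<odot>\<^bsub>A\<^esub> x) = c \<odot>\<^bsub>A\<^esub> endo g x" if "x \<in> carrier A" for c x
    using that by (auto elim!: carrier_cases simp: simps)
qed

end

section \<open>The Hecke, Clifford and twisted group algebras as presentations, and the tensor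
  product\<close>

lemma feval_lin: "scalars \<sigma> \<Longrightarrow> feval \<sigma> g (lin n f v) = (\<Sum>i=1..n. \<sigma> (v i) * g (f i))"
  by (simp add: lin_def scalars.feval_sum scalars.feval_mult scalars.feval_scal scalars.feval_gen)

lemma fcar_lin: "(\<And>i. i \<in> {1..n} \<Longrightarrow> g i \<in> X) \<Longrightarrow> lin n g v \<in> fcar X"
  by (auto simp: lin_def intro!: fcar_sum fcar_mult fcar_gen)

lemma lin_xi: "i \<in> {1..n} \<Longrightarrow> lin n g (xi i) = gen (g i)"
proof -
  assume "i \<in> {1..n}"
  have "lin n g (xi i) = (\<Sum>j=1..n. if j = i then gen (g i) else 0)"
    unfolding lin_def by (intro sum.cong) (auto simp: xi_def)
  with \<open>i \<in> {1..n}\<close> show ?thesis by (simp only: sum.delta finite_atLeastAtMost if_True)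
qed

lemma xi_V: "i \<in> {1..n} \<Longrightarrow> xi i \<in> V n"
  by (auto simp: V_def xi_def)

lemma simple_refl_permutes: "i \<in> {1..<n} \<Longrightarrow> simple_refl i permutes {1..n}"
  unfolding simple_refl_def by (intro permutes_swap_id) auto

lemma w0_permutes: "w0 n permutes {1..n}"
proof (rule bij_imp_permutes)
  have "w0 n ` {1..n} = {1..n}"
  proof
    show "{1..n} \<subseteq> w0 n ` {1..n}"
    proof
      fix i assume "i \<in> {1..n}"
      then have "i = w0 n (Suc n - i)" "Suc n - i \<in> {1..n}" by (auto simp: w0_def)
      then show "i \<in> w0 n ` {1..n}" by blast
    qed
  qed (auto simp: w0_def)
  moreover have "inj_on (w0 n) {1..n}"
    by (auto simp: inj_on_def w0_def)
  ultimately show "bij_betw (w0 n) {1..n} {1..n}"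
    by (simp add: bij_betw_def)
qed (auto simp: w0_def)

lemma w0_w0: "w0 n \<circ> w0 n = id"
  by (auto simp: w0_def fun_eq_iff)

lemma hecke_rels_fcar: "hecke_rels n \<subseteq> fcar (hecke_gens n)"
proof -
  have lin: "lin n Xi v \<in> fcar (hecke_gens n)" for v
    by (rule fcar_lin) (auto simp: hecke_gens_def)
  have perm: "gen (Perm w) \<in> fcar (hecke_gens n)" if "w permutes {1..n}" for w
    using that by (intro fcar_gen) (auto simp: hecke_gens_def)
  show ?thesis
    unfolding hecke_rels_def
    by (auto intro!: fcar_diff fcar_mult lin perm fcar_1 fcar_scal permutes_compose
        permutes_id simple_refl_permutes)
qed

text \<open>An opaque name, so that simplification does not take the generator set of the
  interpreted locale apart as an interval.\<close>

definition cliff_gens :: "nat \<Rightarrow> nat set" where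
  "cliff_gens n = {1..n}"

definition T_gens :: "nat \<Rightarrow> nat set" where
  "T_gens n = {1..<n}"

lemma cliff_rels_fcar: "cliff_rels n \<subseteq> fcar (cliff_gens n)"
  by (auto simp: cliff_rels_def cliff_gens_def intro!: fcar_diff fcar_add fcar_mult fcar_lin)

lemma T_rels_fcar: "T_rels n \<subseteq> fcar (T_gens n)"
  by (auto simp: T_rels_def T_gens_def intro!: fcar_diff fcar_add fcar_mult fcar_power fcar_gen)

interpretation H: presentation "hecke_gens n" "hecke_rels n" for n
  by (standard, rule hecke_rels_fcar)

interpretation C: presentation "cliff_gens n" "cliff_rels n" for n
  by (standard, rule cliff_rels_fcar)

interpretation T: presentation "T_gens n" "T_rels n" for n
  by (standard, rule T_rels_fcar)

lemma tensor_rels_fcar: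
  assumes "ring A" "ring B"
    and "\<And>c x. x \<in> carrier A \<Longrightarrow> c \<odot>\<^bsub>A\<^esub> x \<in> carrier A" "\<And>c x. x \<in> carrier B \<Longrightarrow> c \<odot>\<^bsub>B\<^esub> x \<in> carrier B"
  shows "tensor_rels A B \<subseteq> fcar (carrier A \<times> carrier B)"
proof -
  interpret A: ring A by fact
  interpret B: ring B by fact
  show ?thesis
    unfolding tensor_rels_def
    by (auto intro!: fcar_diff fcar_mult fcar_gen fcar_scal fcar_1 assms(3,4))
qed

lemma (in presentation) smult_closed: "x \<in> carrier A \<Longrightarrow> c \<odot>\<^bsub>A\<^esub> x \<in> carrier A"
  by (auto elim!: carrier_cases simp: smult_cl)

lemma cliff_eq: "cliff n = presented_alg (cliff_gens n) (cliff_rels n)"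
  by (simp add: cliff_def cliff_gens_def)

lemma T_alg_eq: "T_alg n = presented_alg (T_gens n) (T_rels n)"
  by (simp add: T_alg_def T_gens_def)

lemma ring_hecke: "ring (hecke n)" and ring_cliff: "ring (cliff n)" and ring_T_alg: "ring (T_alg n)"
  by (simp_all only: hecke_def cliff_eq T_alg_eq H.ring_A C.ring_A T.ring_A)

interpretation HC: presentation "carrier (hecke n) \<times> carrier (cliff n)" "tensor_rels (hecke n) (cliff n)" for n
  by standard
    (intro tensor_rels_fcar ring_hecke ring_cliff, simp_all add: hecke_def cliff_eq H.smult_closed C.smult_closed)

lemma HC_eq: "HC n = presented_alg (carrier (hecke n) \<times> carrier (cliff n)) (tensor_rels (hecke n) (cliff n))"
  by (simp add: HC_def tensor_alg_def)

lemma ring_HC: "ring (HC n)"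
  by (simp only: HC_eq HC.ring_A)

lemma tensHC_cl: "tensHC n x y = HC.cl n (gen (x, y))"
  by (simp add: tensHC_def tens_def HC.cl_def)

lemma tensHC_closed: "x \<in> carrier (hecke n) \<Longrightarrow> y \<in> carrier (cliff n) \<Longrightarrow> tensHC n x y \<in> carrier (HC n)"
  by (simp add: tensHC_cl HC_eq fcar_gen)

definition tensor_endo where
  "tensor_endo n \<phi> \<psi> = HC.endo n (\<lambda>(x, y). gen (\<phi> x, \<psi> y))"

text \<open>Every family of tensor relators is stable under homomorphisms in both components, so a
  relator is sent to a relator of the same family.\<close>

lemma tensor_endo_ok:
  assumes "\<phi> \<in> alg_hom (hecke n) (hecke n)" "\<psi> \<in> alg_hom (cliff n) (cliff n)"
  shows "HC.endo_ok n (\<lambda>(x, y). gen (\<phi> x, \<psi> y))"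
proof -
  note hom = alg_hom_closed[OF assms(1)] alg_hom_closed[OF assms(2)] alg_hom_mult[OF assms(1)]
      alg_hom_mult[OF assms(2)] alg_hom_add[OF assms(1)] alg_hom_add[OF assms(2)]
      alg_hom_one[OF assms(1)] alg_hom_one[OF assms(2)] alg_hom_smult[OF assms(1)] alg_hom_smult[OF assms(2)]
  have "feval scal (\<lambda>(x, y). gen (\<phi> x, \<psi> y)) r \<in> tensor_rels (hecke n) (cliff n)"
    if "r \<in> tensor_rels (hecke n) (cliff n)" for r
    using that unfolding tensor_rels_def
    by (elim UnE CollectE exE conjE singletonE; hypsubst;
        simp only: scal.feval_diff scal.feval_mult scal.feval_gen scal.feval_scal scal.feval_1 prod.case hom)
      (use hom in blast)+
  then show ?thesis
    unfolding HC.endo_ok_def by (auto intro!: HC.R_J fcar_gen hom)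
qed

lemma tensor_endo_alg_hom:
  assumes "\<phi> \<in> alg_hom (hecke n) (hecke n)" "\<psi> \<in> alg_hom (cliff n) (cliff n)"
  shows "tensor_endo n \<phi> \<psi> \<in> alg_hom (HC n) (HC n)"
  unfolding tensor_endo_def HC_eq by (rule HC.endo_alg_hom[OF tensor_endo_ok[OF assms]])

lemma tensor_endo_tensHC:
  assumes "\<phi> \<in> alg_hom (hecke n) (hecke n)" "\<psi> \<in> alg_hom (cliff n) (cliff n)"
    and "x \<in> carrier (hecke n)" "y \<in> carrier (cliff n)"
  shows "tensor_endo n \<phi> \<psi> (tensHC n x y) = tensHC n (\<phi> x) (\<psi> y)"
  using assms(3,4)
  by (simp add: tensor_endo_def tensHC_cl HC.endo_cl[OF tensor_endo_ok[OF assms(1,2)]] fcar_gen scal.feval_gen)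

lemmas hecke_ops = H.mult_cl[folded hecke_def] H.add_cl[folded hecke_def] H.one_cl[folded hecke_def]
  H.zero_cl[folded hecke_def] H.smult_cl[folded hecke_def] H.a_inv_cl[folded hecke_def]
  H.a_minus_cl[folded hecke_def]
lemmas cliff_ops = C.mult_cl[folded cliff_eq] C.add_cl[folded cliff_eq] C.one_cl[folded cliff_eq]
  C.zero_cl[folded cliff_eq] C.smult_cl[folded cliff_eq] C.a_inv_cl[folded cliff_eq]
  C.a_minus_cl[folded cliff_eq]
lemmas T_ops = T.mult_cl[folded T_alg_eq] T.add_cl[folded T_alg_eq] T.one_cl[folded T_alg_eq]
  T.zero_cl[folded T_alg_eq] T.smult_cl[folded T_alg_eq] T.a_inv_cl[folded T_alg_eq]
  T.a_minus_cl[folded T_alg_eq]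
lemmas HC_ops = HC.mult_cl[folded HC_eq] HC.add_cl[folded HC_eq] HC.one_cl[folded HC_eq]
  HC.zero_cl[folded HC_eq] HC.smult_cl[folded HC_eq] HC.a_inv_cl[folded HC_eq]
  HC.a_minus_cl[folded HC_eq]
lemmas hecke_cl_carrier [simp] = H.cl_carrier[folded hecke_def]
lemmas cliff_cl_carrier [simp] = C.cl_carrier[folded cliff_eq]
lemmas T_cl_carrier [simp] = T.cl_carrier[folded T_alg_eq]
lemmas HC_cl_carrier [simp] = HC.cl_carrier[folded HC_eq]
lemmas hecke_cases = H.carrier_cases[folded hecke_def]
lemmas cliff_cases = C.carrier_cases[folded cliff_eq]
lemmas T_cases = T.carrier_cases[folded T_alg_eq]
lemmas HC_cases = HC.carrier_cases[folded HC_eq]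

lemma fcar_lin_Xi [simp]: "lin n Xi v \<in> fcar (hecke_gens n)"
  by (rule fcar_lin) (auto simp: hecke_gens_def)

lemma fcar_gen_Perm [simp]: "w permutes {1..n} \<Longrightarrow> gen (Perm w) \<in> fcar (hecke_gens n)"
  by (intro fcar_gen) (auto simp: hecke_gens_def)

lemma fcar_gen_Xi [simp]: "i \<in> {1..n} \<Longrightarrow> gen (Xi i) \<in> fcar (hecke_gens n)"
  by (intro fcar_gen) (auto simp: hecke_gens_def)

lemma fcar_lin_cliff [simp]: "lin n id v \<in> fcar (cliff_gens n)"
  by (rule fcar_lin) (auto simp: cliff_gens_def)

lemma fcar_gen_T: "i \<in> {1..<n} \<Longrightarrow> gen i \<in> fcar (T_gens n)"
  by (intro fcar_gen) (auto simp: T_gens_def)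

lemma hecke_vec_cl: "hecke_vec n v = H.cl n (lin n Xi v)"
  by (simp add: hecke_vec_def H.cl_def)

lemma hecke_perm_cl: "hecke_perm n w = H.cl n (gen (Perm w))"
  by (simp add: hecke_perm_def H.cl_def)

lemma cliff_vec_cl: "cliff_vec n v = C.cl n (lin n id v)"
  by (simp only: cliff_vec_def cliff_gens_def[symmetric] C.cl_def)

lemma tau_cl: "tau n i = T.cl n (gen i)"
  by (simp only: tau_def T_gens_def[symmetric] T.cl_def)

definition tilde_free where
  "tilde_free n v = scal (1 / 2) * (lin n Xi v
     - gen (Perm (w0 n)) * lin n Xi (delta_vec n v) * gen (Perm (w0 n)))"

lemma tilde_free_fcar [simp]: "tilde_free n v \<in> fcar (hecke_gens n)"
  by (simp add: tilde_free_def w0_permutes)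

lemma tilde_vec_cl: "tilde_vec n v = H.cl n (tilde_free n v)"
  by (simp add: tilde_vec_def star_vec_def hecke_vec_cl hecke_perm_cl hecke_ops w0_permutes tilde_free_def)

lemma tilde_vec_closed [simp]: "tilde_vec n v \<in> carrier (hecke n)"
  by (simp add: tilde_vec_cl)

lemma cliff_vec_closed [simp]: "cliff_vec n v \<in> carrier (cliff n)"
  by (simp add: cliff_vec_cl)

definition dirac_free where
  "dirac_free n = (\<Sum>i=1..n. gen (tilde_vec n (xi i), cliff_vec n (xi i)))"

lemma dirac_free_fcar [simp]: "dirac_free n \<in> fcar (carrier (hecke n) \<times> carrier (cliff n))"
  unfolding dirac_free_def by (intro fcar_sum fcar_gen) simp

lemma dirac_cl: "dirac n = HC.cl n (dirac_free n)"
proof -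
  have "dirac n = (\<Oplus>\<^bsub>HC n\<^esub>i\<in>{1..n}. HC.cl n (gen (tilde_vec n (xi i), cliff_vec n (xi i))))"
    by (simp only: dirac_def tensHC_cl)
  also have "\<dots> = HC.cl n (dirac_free n)"
    unfolding dirac_free_def HC_eq by (rule HC.finsum_cl) (auto intro: fcar_gen)
  finally show ?thesis .
qed

lemma dirac_closed [simp]: "dirac n \<in> carrier (HC n)"
  by (simp add: dirac_cl)

text \<open>Negation is multiplication by the scalar -1, so this is the homogeneity relator at c =
  -1.\<close>

lemma HC_minus_left:
  assumes "x \<in> carrier (hecke n)" "y \<in> carrier (cliff n)"
  shows "HC.eqv n (gen (\<ominus>\<^bsub>hecke n\<^esub> x, y)) (- gen (x, y))"
proof -
  obtain p where p: "p \<in> fcar (hecke_gens n)" "x = H.cl n p" using assms(1) by (rule hecke_cases)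
  have "\<ominus>\<^bsub>hecke n\<^esub> x = (- 1) \<odot>\<^bsub>hecke n\<^esub> x"
    using p by (simp add: hecke_ops scal_minus)
  moreover have "gen ((- 1) \<odot>\<^bsub>hecke n\<^esub> x, y) - scal (- 1) * gen (x, y) \<in> tensor_rels (hecke n) (cliff n)"
    using assms unfolding tensor_rels_def by blast
  ultimately show ?thesis
    using HC.eqv_rel[of "gen (\<ominus>\<^bsub>hecke n\<^esub> x, y)" "scal (- 1) * gen (x, y)" n] by (simp add: scal_minus)
qed

lemma HC_minus_right:
  assumes "x \<in> carrier (hecke n)" "y \<in> carrier (cliff n)"
  shows "HC.eqv n (gen (x, \<ominus>\<^bsub>cliff n\<^esub> y)) (- gen (x, y))"
proof -
  obtain p where p: "p \<in> fcar (cliff_gens n)" "y = C.cl n p" using assms(2) by (rule cliff_cases)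
  have "\<ominus>\<^bsub>cliff n\<^esub> y = (- 1) \<odot>\<^bsub>cliff n\<^esub> y"
    using p by (simp add: cliff_ops scal_minus)
  moreover have "gen (x, (- 1) \<odot>\<^bsub>cliff n\<^esub> y) - scal (- 1) * gen (x, y) \<in> tensor_rels (hecke n) (cliff n)"
    using assms unfolding tensor_rels_def by blast
  ultimately show ?thesis
    using HC.eqv_rel[of "gen (x, \<ominus>\<^bsub>cliff n\<^esub> y)" "scal (- 1) * gen (x, y)" n] by (simp add: scal_minus)
qed

lemma tensHC_minus_left:
  assumes "x \<in> carrier (hecke n)" "y \<in> carrier (cliff n)"
  shows "tensHC n (\<ominus>\<^bsub>hecke n\<^esub> x) y = \<ominus>\<^bsub>HC n\<^esub> tensHC n x y"
proof -
  interpret H': ring "hecke n" by (rule ring_hecke)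
  show ?thesis
    using HC_minus_left[OF assms] assms
    by (simp add: tensHC_cl HC_ops fcar_gen HC.cl_eq_iff)
qed

lemma tensHC_minus_right:
  assumes "x \<in> carrier (hecke n)" "y \<in> carrier (cliff n)"
  shows "tensHC n x (\<ominus>\<^bsub>cliff n\<^esub> y) = \<ominus>\<^bsub>HC n\<^esub> tensHC n x y"
proof -
  interpret C': ring "cliff n" by (rule ring_cliff)
  show ?thesis
    using HC_minus_right[OF assms] assms
    by (simp add: tensHC_cl HC_ops fcar_gen HC.cl_eq_iff)
qed

lemma T_eqv_far:
  assumes "i \<in> {1..<n}" "j \<in> {1..<n}" "\<bar>int i - int j\<bar> > 1"
  shows "T.eqv n ((gen i * gen j) ^ 2) (- 1)"
  using assms by (intro T.eqv_rel) (auto simp: T_rels_def)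

section \<open>Sign automorphisms\<close>

definition hecke_sign :: "hecke_gen \<Rightarrow> hecke_gen free" where
  "hecke_sign y = (case y of Xi i \<Rightarrow> - gen (Xi i) | Perm w \<Rightarrow> scal (of_int (sign w)) * gen (Perm w))"

lemma sign_square: "(of_int (sign w) :: complex) * of_int (sign w) = 1"
  by (auto simp: sign_def)

lemma hecke_sign_lin: "feval scal hecke_sign (lin n Xi v) = - lin n Xi v"
  by (simp add: feval_lin[OF scal.scalars_axioms]) (simp add: hecke_sign_def lin_def sum_negf)

lemma hecke_sign_perm: "feval scal hecke_sign (gen (Perm w)) = scal (of_int (sign w)) * gen (Perm w)"
  by (simp add: scal.feval_gen hecke_sign_def)

lemma scal_mult_swap: "scal a * p * (scal b * q) = scal (a * b) * (p * q)"
proof -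
  have "scal a * p * (scal b * q) = scal a * (p * scal b) * q" by (simp only: mult.assoc)
  also have "p * scal b = scal b * p" by (rule scal_central[symmetric])
  finally show ?thesis by (simp only: scal_mult mult.assoc)
qed

lemma sign_simple_refl: "sign (simple_refl i) = - 1"
  by (simp add: simple_refl_def sign_swap_id)

text \<open>Each product in a cross relator contains one vector and one simple reflection, whose
  signs cancel, and the scalar term is untouched. Relators of S(V) have two vectors in every term,
  and the multiplication relators of the group only acquire a common sign factor.\<close>

lemma hecke_sign_ok: "H.endo_ok n hecke_sign"
proof -
  have gens: "hecke_sign y \<in> fcar (hecke_gens n)" if "y \<in> hecke_gens n" for y
    using that by (cases y) (auto simp: hecke_sign_def hecke_gens_def intro!: fcar_uminus fcar_mult fcar_scal fcar_gen)
  have perm: "feval scal hecke_sign (gen (Perm v) * gen (Perm w) - gen (Perm (v \<circ> w))) \<in> H.J n"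
    if "v permutes {1..n}" "w permutes {1..n}" for v w
  proof -
    have "sign (v \<circ> w) = sign v * sign w"
      using that by (intro sign_compose) (auto simp: permutation_permutes)
    then have "feval scal hecke_sign (gen (Perm v) * gen (Perm w) - gen (Perm (v \<circ> w)))
        = scal (of_int (sign v * sign w)) * (gen (Perm v) * gen (Perm w) - gen (Perm (v \<circ> w)))"
      by (simp only: scal.feval_diff scal.feval_mult hecke_sign_perm scal_mult_swap of_int_mult
          right_diff_distrib)
    moreover have "gen (Perm v) * gen (Perm w) - gen (Perm (v \<circ> w)) \<in> H.J n"
      using that by (intro H.R_J) (auto simp: hecke_rels_def)
    ultimately show ?thesis by (simp add: H.J_mult_left)
  qed
  have other: "feval scal hecke_sign r \<in> H.J n"
    if "r = lin n Xi u * lin n Xi v - lin n Xi v * lin n Xi u" "u \<in> V n" "v \<in> V n" for r u v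
  proof -
    have "feval scal hecke_sign r = r"
      by (simp add: that scal.feval_diff scal.feval_mult hecke_sign_lin)
    moreover have "r \<in> hecke_rels n" using that unfolding hecke_rels_def by blast
    ultimately show ?thesis using H.R_J by metis
  qed
  have cross: "feval scal hecke_sign r \<in> H.J n"
    if "r = lin n Xi v * gen (Perm (simple_refl i)) - gen (Perm (simple_refl i)) * lin n Xi (act (simple_refl i) v)
        - scal (bilin n (simple_root i) v)" "v \<in> V n" "i \<in> {1..<n}" for r v i
  proof -
    have "feval scal hecke_sign r = r"
      by (simp add: that scal.feval_diff scal.feval_mult hecke_sign_lin hecke_sign_perm sign_simple_refl
          scal_minus scal.feval_scal)
    moreover have "r \<in> hecke_rels n" using that unfolding hecke_rels_def by blast
    ultimately show ?thesis using H.R_J by metis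
  qed
  have unit: "feval scal hecke_sign (gen (Perm id) - 1) \<in> H.J n"
    by (simp add: scal.feval_diff hecke_sign_perm sign_id) (rule H.R_J, simp add: hecke_rels_def)
  show ?thesis
    unfolding H.endo_ok_def using gens perm other cross unit
    by (auto simp: hecke_rels_def)
qed

definition hecke_theta where "hecke_theta n = H.endo n hecke_sign"

lemma hecke_theta_hom: "hecke_theta n \<in> alg_hom (hecke n) (hecke n)"
  unfolding hecke_theta_def hecke_def by (rule H.endo_alg_hom[OF hecke_sign_ok])

lemma hecke_theta_cl: "p \<in> fcar (hecke_gens n) \<Longrightarrow> hecke_theta n (H.cl n p) = H.cl n (feval scal hecke_sign p)"
  unfolding hecke_theta_def by (rule H.endo_cl[OF hecke_sign_ok])

text \<open>The longest element occurs twice in the starred vector, so its sign squares to 1 and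
  only the sign of the vector survives.\<close>

lemma hecke_theta_tilde: "hecke_theta n (tilde_vec n v) = \<ominus>\<^bsub>hecke n\<^esub> tilde_vec n v"
proof -
  have "scal (of_int (sign (w0 n))) * gen (Perm (w0 n)) * lin n Xi u * (scal (of_int (sign (w0 n))) * gen (Perm (w0 n)))
     = gen (Perm (w0 n)) * lin n Xi u * gen (Perm (w0 n))" for u
    using scal_mult_swap[of "of_int (sign (w0 n))" "gen (Perm (w0 n)) * lin n Xi u" "of_int (sign (w0 n))" "gen (Perm (w0 n))"]
    by (simp add: sign_square mult.assoc)
  then have "feval scal hecke_sign (tilde_free n v) = - tilde_free n v"
    by (simp add: tilde_free_def scal.feval_diff scal.feval_mult scal.feval_scal hecke_sign_lin hecke_sign_perm
        algebra_simps)
  then show ?thesis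
    by (simp add: tilde_vec_cl hecke_theta_cl hecke_ops)
qed

definition cliff_eps where "cliff_eps n = C.endo n (\<lambda>i. - gen i)"

lemma cliff_eps_ok: "C.endo_ok n (\<lambda>i. - gen i)"
proof -
  have lin: "feval scal (\<lambda>i. - gen i) (lin n id v) = - lin n id v" for v
    by (simp add: feval_lin[OF scal.scalars_axioms]) (simp add: lin_def sum_negf)
  have "feval scal (\<lambda>i. - gen i) r = r" if "r \<in> cliff_rels n" for r
    using that by (auto simp: cliff_rels_def scal.feval_add scal.feval_diff scal.feval_mult scal.feval_scal lin)
  then show ?thesis
    by (auto simp: C.endo_ok_def fcar_gen intro: C.R_J)
qed

lemma cliff_eps_hom: "cliff_eps n \<in> alg_hom (cliff n) (cliff n)"
  unfolding cliff_eps_def cliff_eq by (rule C.endo_alg_hom[OF cliff_eps_ok])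

lemma cliff_eps_vec: "cliff_eps n (cliff_vec n v) = \<ominus>\<^bsub>cliff n\<^esub> cliff_vec n v"
proof -
  have "feval scal (\<lambda>i. - gen i) (lin n id v) = - lin n id v"
    by (simp add: feval_lin[OF scal.scalars_axioms]) (simp add: lin_def sum_negf)
  then show ?thesis
    by (simp add: cliff_eps_def cliff_vec_cl C.endo_cl[OF cliff_eps_ok] cliff_ops)
qed

definition T_eps where "T_eps n = T.endo n (\<lambda>i. - gen i)"

text \<open>All words in the relators of T_n have even length, so every relator is fixed.\<close>

lemma T_eps_ok: "T.endo_ok n (\<lambda>i. - gen i)"
proof -
  have "feval scal (\<lambda>i. - gen i) r = r" if "r \<in> T_rels n" for r
    using that by (auto simp: T_rels_def scal.feval_add scal.feval_diff scal.feval_mult scal.feval_power scal.feval_gen)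
  then show ?thesis
    by (auto simp: T.endo_ok_def fcar_gen intro: T.R_J)
qed

lemma T_eps_hom: "T_eps n \<in> alg_hom (T_alg n) (T_alg n)"
  unfolding T_eps_def T_alg_eq by (rule T.endo_alg_hom[OF T_eps_ok])

lemma T_eps_cl: "p \<in> fcar (T_gens n) \<Longrightarrow> T_eps n (T.cl n p) = T.cl n (feval scal (\<lambda>i. - gen i) p)"
  unfolding T_eps_def by (rule T.endo_cl[OF T_eps_ok])

lemma T_eps_tau: "i \<in> {1..<n} \<Longrightarrow> T_eps n (tau n i) = \<ominus>\<^bsub>T_alg n\<^esub> tau n i"
  by (simp add: tau_cl T_eps_cl fcar_gen_T scal.feval_gen T_ops)

lemma feval_neg_mon: "feval scal (\<lambda>i. - gen i) (mon xs) = (if even (length xs) then mon xs else - mon xs)"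
  by (induction xs) (auto simp: scal.feval_mult scal.feval_gen mon_Cons)

lemma T_eps_involution:
  assumes "x \<in> carrier (T_alg n)"
  shows "T_eps n (T_eps n x) = x"
proof -
  have "T_eps n (T_eps n x) = (\<lambda>x. x) x"
  proof (rule T.alg_hom_eqI[OF _ _ _ assms[unfolded T_alg_eq]])
    show "(\<lambda>x. T_eps n (T_eps n x)) \<in> alg_hom (T.A n) (T.A n)"
      using alg_hom_compose[OF T_eps_hom T_eps_hom] by (simp add: T_alg_eq)
  qed (auto simp: alg_hom_id T_eps_cl fcar_gen scal.feval_gen scal.feval_minus)
  then show ?thesis .
qed

lemma T_eps_centre:
  assumes "z \<in> centre (T_alg n)"
  shows "T_eps n z \<in> centre (T_alg n)"
  unfolding centre_def
proof (intro CollectI conjI ballI)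
  have z: "z \<in> carrier (T_alg n)" using assms by (simp add: centre_def)
  then show "T_eps n z \<in> carrier (T_alg n)" by (rule alg_hom_closed[OF T_eps_hom])
  fix x assume x: "x \<in> carrier (T_alg n)"
  then have x': "T_eps n x \<in> carrier (T_alg n)" by (rule alg_hom_closed[OF T_eps_hom])
  have "T_eps n (T_eps n x \<otimes>\<^bsub>T_alg n\<^esub> z) = T_eps n (z \<otimes>\<^bsub>T_alg n\<^esub> T_eps n x)"
    using assms x' by (simp add: centre_def)
  then show "x \<otimes>\<^bsub>T_alg n\<^esub> T_eps n z = T_eps n z \<otimes>\<^bsub>T_alg n\<^esub> x"
    using x x' z by (simp add: alg_hom_mult[OF T_eps_hom] T_eps_involution)
qed

lemma T_eps_fixed_even:
  assumes "x \<in> carrier (T_alg n)" "T_eps n x = x"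
  shows "x \<in> T_even n"
proof -
  obtain p where p: "p \<in> fcar (T_gens n)" "x = T.cl n p" using assms(1) by (rule T_cases)
  let ?q = "feval scal (\<lambda>i. - gen i) p"
  have q: "?q \<in> fcar (T_gens n)" using p(1) by (rule fcar_feval) (simp add: fcar_gen)
  \<comment> \<open>The symmetrised representative: odd words cancel in the sum of p and its twist,
    and since x is fixed by the twist, half of this sum still represents x.\<close>
  define e where "e = scal (1 / 2) * (p + ?q)"
  have "p \<in> fcar (T_gens n) \<and> (\<forall>w\<in>Poly_Mapping.keys (p + ?q). even (length (letters w)))"
    using p(1)
  proof (induction p rule: fcar_induct)
    case (add p q)
    have "p + q + feval scal (\<lambda>i. - gen i) (p + q)
        = (p + feval scal (\<lambda>i. - gen i) p) + (q + feval scal (\<lambda>i. - gen i) q)"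
      by (simp add: scal.feval_add)
    then have "Poly_Mapping.keys (p + q + feval scal (\<lambda>i. - gen i) (p + q))
        \<subseteq> Poly_Mapping.keys (p + feval scal (\<lambda>i. - gen i) p) \<union> Poly_Mapping.keys (q + feval scal (\<lambda>i. - gen i) q)"
      by (simp only: keys_add)
    with add show ?case by auto
  next
    case (mon c xs)
    have "scal c * mon xs + feval scal (\<lambda>i. - gen i) (scal c * mon xs)
       = (if even (length xs) then Poly_Mapping.single (Word xs) (2 * c) else 0)"
      unfolding scal.feval_mult scal.feval_scal feval_neg_mon
      by (simp add: scal_mon single_add[symmetric])
    with mon show ?case by (auto simp: fcar_mon)
  qed simp
  moreover have "Poly_Mapping.keys e \<subseteq> Poly_Mapping.keys (p + ?q)"
    using keys_mult[of "scal (1 / 2)" "p + ?q"] by (auto simp: e_def scal_def)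
  ultimately have even: "\<forall>w\<in>Poly_Mapping.keys e. even (length (letters w))" by auto
  have "T.eqv n ?q p"
    using assms(2) p q by (simp add: T_eps_cl T.cl_eq_iff)
  then have "T.eqv n e (scal (1 / 2) * (p + p))"
    unfolding e_def by (intro T.eqv_mult_left T.eqv_add) auto
  also have "scal (1 / 2) * (p + p) = p"
    by (simp add: distrib_left distrib_right[symmetric] scal_add[symmetric])
  finally have "x = T.cl n e"
    using p q by (simp add: T.cl_eq_iff e_def T.eqv_sym)
  moreover have "e \<in> fcar (T_gens n)" using p q by (simp add: e_def)
  ultimately show ?thesis
    using even unfolding T_even_def T.cl_def[of n] T_gens_def[symmetric] by auto
qed

section \<open>Twisting Vogan's relation by automorphisms that negate D\<close>

definition parity_aut where "parity_aut n = tensor_endo n (\<lambda>x. x) (cliff_eps n)"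

definition theta_aut where "theta_aut n = tensor_endo n (hecke_theta n) (\<lambda>y. y)"

lemma tensor_endo_dirac:
  assumes "\<phi> \<in> alg_hom (hecke n) (hecke n)" "\<psi> \<in> alg_hom (cliff n) (cliff n)"
    and "\<And>i. i \<in> {1..n} \<Longrightarrow> tensHC n (\<phi> (tilde_vec n (xi i))) (\<psi> (cliff_vec n (xi i)))
        = \<ominus>\<^bsub>HC n\<^esub> tensHC n (tilde_vec n (xi i)) (cliff_vec n (xi i))"
  shows "tensor_endo n \<phi> \<psi> (dirac n) = \<ominus>\<^bsub>HC n\<^esub> dirac n"
proof -
  have closed: "\<phi> (tilde_vec n v) \<in> carrier (hecke n)" "\<psi> (cliff_vec n v) \<in> carrier (cliff n)" for v
    using assms(1,2) by (auto intro: alg_hom_closed)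
  have eqv: "HC.eqv n (gen (\<phi> (tilde_vec n (xi i)), \<psi> (cliff_vec n (xi i))))
     (- gen (tilde_vec n (xi i), cliff_vec n (xi i)))" if "i \<in> {1..n}" for i
    using assms(3)[OF that] closed by (simp add: tensHC_cl HC_ops fcar_gen HC.cl_eq_iff)
  have "feval scal (\<lambda>(x, y). gen (\<phi> x, \<psi> y)) (dirac_free n)
     = (\<Sum>i=1..n. gen (\<phi> (tilde_vec n (xi i)), \<psi> (cliff_vec n (xi i))))"
    by (simp add: dirac_free_def scal.feval_sum scal.feval_gen)
  also have "HC.eqv n \<dots> (\<Sum>i=1..n. - gen (tilde_vec n (xi i), cliff_vec n (xi i)))"
    by (intro HC.eqv_sum eqv)
  also have "\<dots> = - dirac_free n"
    by (simp add: dirac_free_def sum_negf)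
  finally have *: "HC.eqv n (feval scal (\<lambda>(x, y). gen (\<phi> x, \<psi> y)) (dirac_free n)) (- dirac_free n)" .
  have "feval scal (\<lambda>(x, y). gen (\<phi> x, \<psi> y)) (dirac_free n) \<in> fcar (carrier (hecke n) \<times> carrier (cliff n))"
    by (rule fcar_feval[OF dirac_free_fcar])
      (auto intro!: fcar_gen alg_hom_closed[OF assms(1)] alg_hom_closed[OF assms(2)])
  with * show ?thesis
    by (simp add: tensor_endo_def dirac_cl HC.endo_cl[OF tensor_endo_ok[OF assms(1,2)]] HC_ops HC.cl_eq_iff)
qed

text \<open>Apply \<Psi> to the relation: the sign of D is absorbed by passing from a to - \<Psi> a.
  The maps \<Psi> o \<rho> and \<rho> o \<open>T_eps n\<close> are both homomorphisms on T_n, so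
  they are compared on generators.\<close>

lemma vogan_rel_twist:
  assumes rho: "diagonal_embedding n \<rho>" and rel: "vogan_rel n \<rho> f z"
    and f: "f \<in> carrier (hecke n)" and z: "z \<in> carrier (T_alg n)"
    and hom: "\<Psi> \<in> alg_hom (HC n) (HC n)"
    and dirac: "\<Psi> (dirac n) = \<ominus>\<^bsub>HC n\<^esub> dirac n"
    and tau: "\<And>i. i \<in> {1..<n} \<Longrightarrow> \<Psi> (\<rho> (tau n i)) = \<ominus>\<^bsub>HC n\<^esub> \<rho> (tau n i)"
  shows "\<exists>a\<in>carrier (HC n). \<Psi> (tensHC n f \<one>\<^bsub>cliff n\<^esub>) =
      \<rho> (T_eps n z) \<oplus>\<^bsub>HC n\<^esub> dirac n \<otimes>\<^bsub>HC n\<^esub> a \<oplus>\<^bsub>HC n\<^esub> a \<otimes>\<^bsub>HC n\<^esub> dirac n"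
proof -
  interpret HC': ring "HC n" by (rule ring_HC)
  have rho_hom: "\<rho> \<in> alg_hom (T_alg n) (HC n)" using rho by (simp add: diagonal_embedding_def)
  have comp: "\<Psi> (\<rho> z) = \<rho> (T_eps n z)"
  proof (rule T.alg_hom_eqI[OF _ _ _ z[unfolded T_alg_eq], where B = "HC n"])
    show "(\<lambda>x. \<Psi> (\<rho> x)) \<in> alg_hom (T.A n) (HC n)"
      using alg_hom_compose[OF rho_hom hom] by (simp add: T_alg_eq)
    show "(\<lambda>x. \<rho> (T_eps n x)) \<in> alg_hom (T.A n) (HC n)"
      using alg_hom_compose[OF T_eps_hom rho_hom] by (simp add: T_alg_eq)
    fix i assume i: "i \<in> T_gens n"
    then have i': "i \<in> {1..<n}" by (simp add: T_gens_def)
    have tc: "tau n i \<in> carrier (T_alg n)" using i by (simp add: tau_cl fcar_gen)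
    have "\<ominus>\<^bsub>T_alg n\<^esub> tau n i = (- 1) \<odot>\<^bsub>T_alg n\<^esub> tau n i"
      using i by (simp add: tau_cl T_ops fcar_gen scal_minus)
    moreover have "(- 1) \<odot>\<^bsub>HC n\<^esub> x = \<ominus>\<^bsub>HC n\<^esub> x" if "x \<in> carrier (HC n)" for x
      using that by (auto elim!: HC_cases simp: HC_ops scal_minus)
    ultimately have "\<rho> (T_eps n (tau n i)) = \<ominus>\<^bsub>HC n\<^esub> \<rho> (tau n i)"
      using T_eps_tau[OF i'] alg_hom_smult[OF rho_hom tc, of "-1"] alg_hom_closed[OF rho_hom tc] by simp
    with tau[OF i'] show "\<Psi> (\<rho> (T.cl n (gen i))) = \<rho> (T_eps n (T.cl n (gen i)))"
      by (simp add: tau_cl)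
  qed
  from rel obtain a where a: "a \<in> carrier (HC n)"
    and eq: "tensHC n f \<one>\<^bsub>cliff n\<^esub> = \<rho> z \<oplus>\<^bsub>HC n\<^esub> dirac n \<otimes>\<^bsub>HC n\<^esub> a \<oplus>\<^bsub>HC n\<^esub> a \<otimes>\<^bsub>HC n\<^esub> dirac n"
    unfolding vogan_rel_def by blast
  have rz: "\<rho> z \<in> carrier (HC n)" and pa: "\<Psi> a \<in> carrier (HC n)"
    using z a alg_hom_closed[OF rho_hom] alg_hom_closed[OF hom] by auto
  have "\<Psi> (tensHC n f \<one>\<^bsub>cliff n\<^esub>) = \<rho> (T_eps n z) \<oplus>\<^bsub>HC n\<^esub> (\<ominus>\<^bsub>HC n\<^esub> dirac n) \<otimes>\<^bsub>HC n\<^esub> \<Psi> a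
      \<oplus>\<^bsub>HC n\<^esub> \<Psi> a \<otimes>\<^bsub>HC n\<^esub> (\<ominus>\<^bsub>HC n\<^esub> dirac n)"
    unfolding eq comp[symmetric] dirac[symmetric] using a rz
    by (simp add: alg_hom_add[OF hom] alg_hom_mult[OF hom])
  also have "\<dots> = \<rho> (T_eps n z) \<oplus>\<^bsub>HC n\<^esub> dirac n \<otimes>\<^bsub>HC n\<^esub> (\<ominus>\<^bsub>HC n\<^esub> \<Psi> a)
      \<oplus>\<^bsub>HC n\<^esub> (\<ominus>\<^bsub>HC n\<^esub> \<Psi> a) \<otimes>\<^bsub>HC n\<^esub> dirac n"
    using pa by (simp add: HC'.l_minus HC'.r_minus)
  finally show ?thesis using pa by blast
qed

lemma parity_aut_hom: "parity_aut n \<in> alg_hom (HC n) (HC n)"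
  unfolding parity_aut_def by (rule tensor_endo_alg_hom[OF alg_hom_id cliff_eps_hom])

lemma theta_aut_hom: "theta_aut n \<in> alg_hom (HC n) (HC n)"
  unfolding theta_aut_def by (rule tensor_endo_alg_hom[OF hecke_theta_hom alg_hom_id])

lemma hecke_perm_closed: "w permutes {1..n} \<Longrightarrow> hecke_perm n w \<in> carrier (hecke n)"
  by (simp add: hecke_perm_cl)

lemma cliff_smult_closed: "y \<in> carrier (cliff n) \<Longrightarrow> c \<odot>\<^bsub>cliff n\<^esub> y \<in> carrier (cliff n)"
  by (auto elim!: cliff_cases simp: cliff_ops)

lemma parity_aut_dirac: "parity_aut n (dirac n) = \<ominus>\<^bsub>HC n\<^esub> dirac n"
  unfolding parity_aut_def
  by (rule tensor_endo_dirac[OF alg_hom_id cliff_eps_hom]) (simp add: cliff_eps_vec tensHC_minus_right)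

lemma theta_aut_dirac: "theta_aut n (dirac n) = \<ominus>\<^bsub>HC n\<^esub> dirac n"
  unfolding theta_aut_def
  by (rule tensor_endo_dirac[OF hecke_theta_hom alg_hom_id]) (simp add: hecke_theta_tilde tensHC_minus_left)

lemma parity_aut_tau:
  assumes "diagonal_embedding n \<rho>" "i \<in> {1..<n}"
  shows "parity_aut n (\<rho> (tau n i)) = \<ominus>\<^bsub>HC n\<^esub> \<rho> (tau n i)"
proof -
  let ?y = "complex_of_real (1 / sqrt 2) \<odot>\<^bsub>cliff n\<^esub> cliff_vec n (simple_root i)"
  have y: "?y \<in> carrier (cliff n)" by (intro cliff_smult_closed cliff_vec_closed)
  have x: "hecke_perm n (simple_refl i) \<in> carrier (hecke n)"
    by (rule hecke_perm_closed[OF simple_refl_permutes[OF assms(2)]])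
  have "cliff_eps n ?y = \<ominus>\<^bsub>cliff n\<^esub> ?y"
    by (simp only: alg_hom_smult[OF cliff_eps_hom cliff_vec_closed] cliff_eps_vec)
      (simp add: cliff_vec_cl cliff_ops)
  then show ?thesis
    using assms x y
    by (simp add: diagonal_embedding_def parity_aut_def tensor_endo_tensHC[OF alg_hom_id cliff_eps_hom]
        tensHC_minus_right)
qed

lemma theta_aut_tau:
  assumes "diagonal_embedding n \<rho>" "i \<in> {1..<n}"
  shows "theta_aut n (\<rho> (tau n i)) = \<ominus>\<^bsub>HC n\<^esub> \<rho> (tau n i)"
proof -
  let ?y = "complex_of_real (1 / sqrt 2) \<odot>\<^bsub>cliff n\<^esub> cliff_vec n (simple_root i)"
  have y: "?y \<in> carrier (cliff n)" by (intro cliff_smult_closed cliff_vec_closed)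
  have x: "hecke_perm n (simple_refl i) \<in> carrier (hecke n)"
    by (rule hecke_perm_closed[OF simple_refl_permutes[OF assms(2)]])
  have "hecke_theta n (hecke_perm n (simple_refl i)) = \<ominus>\<^bsub>hecke n\<^esub> hecke_perm n (simple_refl i)"
    by (simp add: hecke_perm_cl hecke_theta_cl simple_refl_permutes[OF assms(2)] hecke_sign_perm
        sign_simple_refl scal_minus hecke_ops)
  then show ?thesis
    using assms x y
    by (simp add: diagonal_embedding_def theta_aut_def tensor_endo_tensHC[OF hecke_theta_hom alg_hom_id]
        tensHC_minus_left)
qed

context
  fixes n \<rho> \<zeta>
  assumes rho: "diagonal_embedding n \<rho>" and zeta: "vogan_map n \<rho> \<zeta>"
begin

lemma zeta_hom: "\<zeta> \<in> alg_hom (centre_alg (hecke n)) (centre_alg (T_alg n))"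
  using zeta by (simp add: vogan_map_def)

lemma zeta_centre: "f \<in> centre (hecke n) \<Longrightarrow> \<zeta> f \<in> centre (T_alg n)"
  using alg_hom_closed[OF zeta_hom, of f] by (simp add: centre_alg_def)

lemma zeta_rel: "f \<in> centre (hecke n) \<Longrightarrow> vogan_rel n \<rho> f (\<zeta> f)"
  using zeta by (simp add: vogan_map_def)

lemma zeta_unique: "f \<in> centre (hecke n) \<Longrightarrow> z \<in> centre (T_alg n) \<Longrightarrow> vogan_rel n \<rho> f z \<Longrightarrow> \<zeta> f = z"
  using zeta by (auto simp: vogan_map_def)

text \<open>Parity fixes f (x) 1, so \<open>T_eps n (\<zeta> f)\<close> satisfies the relation that
  determines \<zeta> f.\<close>

lemma T_eps_zeta:
  assumes f: "f \<in> centre (hecke n)"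
  shows "T_eps n (\<zeta> f) = \<zeta> f"
proof -
  interpret C': ring "cliff n" by (rule ring_cliff)
  have fc: "f \<in> carrier (hecke n)" and zc: "\<zeta> f \<in> carrier (T_alg n)"
    using f zeta_centre[OF f] by (auto simp: centre_def)
  have "parity_aut n (tensHC n f \<one>\<^bsub>cliff n\<^esub>) = tensHC n f \<one>\<^bsub>cliff n\<^esub>"
    using fc by (simp add: parity_aut_def tensor_endo_tensHC[OF alg_hom_id cliff_eps_hom] alg_hom_one[OF cliff_eps_hom])
  with vogan_rel_twist[OF rho zeta_rel[OF f] fc zc parity_aut_hom parity_aut_dirac parity_aut_tau[OF rho]]
  have "vogan_rel n \<rho> f (T_eps n (\<zeta> f))" by (simp add: vogan_rel_def)
  then show ?thesis using zeta_unique[OF f T_eps_centre[OF zeta_centre[OF f]]] by simp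
qed

lemma zeta_even: "f \<in> centre (hecke n) \<Longrightarrow> \<zeta> f \<in> T_even n"
  by (rule T_eps_fixed_even[OF _ T_eps_zeta]) (use zeta_centre in \<open>auto simp: centre_def\<close>)

text \<open>Here the twist negates f (x) 1. Since \<open>T_eps\<close> fixes \<zeta> f, negating the
  twisted relation shows that - \<zeta> f also satisfies the relation of f, and uniqueness gives
  \<zeta> f = - \<zeta> f.\<close>

lemma zeta_theta_odd:
  assumes f: "f \<in> centre (hecke n)" and odd: "hecke_theta n f = \<ominus>\<^bsub>hecke n\<^esub> f"
  shows "\<zeta> f = \<zero>\<^bsub>T_alg n\<^esub>"
proof -
  interpret C': ring "cliff n" by (rule ring_cliff)
  interpret HC': ring "HC n" by (rule ring_HC)
  interpret T': ring "T_alg n" by (rule ring_T_alg)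
  have rho_hom: "\<rho> \<in> alg_hom (T_alg n) (HC n)" using rho by (simp add: diagonal_embedding_def)
  have fc: "f \<in> carrier (hecke n)" and zc: "\<zeta> f \<in> carrier (T_alg n)"
    using f zeta_centre[OF f] by (auto simp: centre_def)
  have tc: "tensHC n f \<one>\<^bsub>cliff n\<^esub> \<in> carrier (HC n)" using fc by (simp add: tensHC_closed)
  have "theta_aut n (tensHC n f \<one>\<^bsub>cliff n\<^esub>) = \<ominus>\<^bsub>HC n\<^esub> tensHC n f \<one>\<^bsub>cliff n\<^esub>"
    using fc by (simp add: theta_aut_def tensor_endo_tensHC[OF hecke_theta_hom alg_hom_id] odd tensHC_minus_left)
  with vogan_rel_twist[OF rho zeta_rel[OF f] fc zc theta_aut_hom theta_aut_dirac theta_aut_tau[OF rho]]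
  obtain a where a: "a \<in> carrier (HC n)" and
    eq: "\<ominus>\<^bsub>HC n\<^esub> tensHC n f \<one>\<^bsub>cliff n\<^esub> = \<rho> (\<zeta> f) \<oplus>\<^bsub>HC n\<^esub> dirac n \<otimes>\<^bsub>HC n\<^esub> a \<oplus>\<^bsub>HC n\<^esub> a \<otimes>\<^bsub>HC n\<^esub> dirac n"
    by (auto simp: T_eps_zeta[OF f])
  have rz: "\<rho> (\<zeta> f) \<in> carrier (HC n)" by (rule alg_hom_closed[OF rho_hom zc])
  have "\<rho> (\<zeta> f) \<oplus>\<^bsub>HC n\<^esub> \<rho> (\<ominus>\<^bsub>T_alg n\<^esub> \<zeta> f) = \<rho> (\<zeta> f \<oplus>\<^bsub>T_alg n\<^esub> \<ominus>\<^bsub>T_alg n\<^esub> \<zeta> f)"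
    using zc by (simp add: alg_hom_add[OF rho_hom])
  also have "\<dots> = \<zero>\<^bsub>HC n\<^esub>"
    using zc by (simp add: T'.r_neg alg_hom_zero[OF rho_hom ring_T_alg ring_HC])
  finally have neg: "\<rho> (\<ominus>\<^bsub>T_alg n\<^esub> \<zeta> f) = \<ominus>\<^bsub>HC n\<^esub> \<rho> (\<zeta> f)"
    using zc rz alg_hom_closed[OF rho_hom] by (metis HC'.minus_equality HC'.a_comm T'.a_inv_closed)
  have "tensHC n f \<one>\<^bsub>cliff n\<^esub> = \<ominus>\<^bsub>HC n\<^esub> (\<rho> (\<zeta> f) \<oplus>\<^bsub>HC n\<^esub> dirac n \<otimes>\<^bsub>HC n\<^esub> a \<oplus>\<^bsub>HC n\<^esub> a \<otimes>\<^bsub>HC n\<^esub> dirac n)"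
    using eq tc by (metis HC'.minus_minus)
  also have "\<dots> = \<rho> (\<ominus>\<^bsub>T_alg n\<^esub> \<zeta> f) \<oplus>\<^bsub>HC n\<^esub> dirac n \<otimes>\<^bsub>HC n\<^esub> (\<ominus>\<^bsub>HC n\<^esub> a) \<oplus>\<^bsub>HC n\<^esub> (\<ominus>\<^bsub>HC n\<^esub> a) \<otimes>\<^bsub>HC n\<^esub> dirac n"
    unfolding neg using a rz by (simp add: HC'.minus_add HC'.l_minus HC'.r_minus)
  finally have "vogan_rel n \<rho> f (\<ominus>\<^bsub>T_alg n\<^esub> \<zeta> f)"
    unfolding vogan_rel_def using a by blast
  moreover have "\<ominus>\<^bsub>T_alg n\<^esub> \<zeta> f \<in> centre (T_alg n)"
    using zeta_centre[OF f] by (auto simp: centre_def T'.l_minus T'.r_minus)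
  ultimately have *: "\<zeta> f = \<ominus>\<^bsub>T_alg n\<^esub> \<zeta> f" using zeta_unique[OF f] by blast
  obtain p where p: "p \<in> fcar (T_gens n)" "\<zeta> f = T.cl n p" using zc by (rule T_cases)
  have "T.eqv n p (- p)" using * p by (simp add: T_ops T.cl_eq_iff)
  then have "T.eqv n (scal (1 / 2) * (p + p)) (scal (1 / 2) * (p + - p))"
    by (intro T.eqv_mult_left T.eqv_add) auto
  moreover have "scal (1 / 2) * (p + p) = p"
    by (simp add: distrib_left distrib_right[symmetric] scal_add[symmetric])
  ultimately have "T.eqv n p 0" by simp
  then show ?thesis using p by (simp add: T_ops T.cl_eq_iff)
qed

end

section \<open>Representations on functions of words and subsets\<close>

text \<open>As a type, linear operators form a \<open>ring_1\<close>, so that \<open>feval\<close>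
  can take values in them directly. They act on all functions; finite dimension enters through
  \<open>local_on\<close>.\<close>

typedef 'b lop = "{f :: ('b \<Rightarrow> complex) \<Rightarrow> 'b \<Rightarrow> complex.
    \<forall>\<phi> \<psi> a. f (\<lambda>x. \<phi> x + a * \<psi> x) = (\<lambda>x. f \<phi> x + a * f \<psi> x)}"
  morphisms app Lop
  by (rule exI[of _ "\<lambda>\<phi>. \<phi>"]) simp

setup_lifting type_definition_lop

lemma app_linear: "app f (\<lambda>x. \<phi> x + a * \<psi> x) = (\<lambda>x. app f \<phi> x + a * app f \<psi> x)"
  using app[of f] by blast

lemma app_add: "app f (\<lambda>x. \<phi> x + \<psi> x) = (\<lambda>x. app f \<phi> x + app f \<psi> x)"
  using app_linear[of f \<phi> 1 \<psi>] by simp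

lemma app_0: "app f (\<lambda>x. 0) = (\<lambda>x. 0)"
  using app_linear[of f "\<lambda>x. 0" "-1" "\<lambda>x. 0"] by simp

lemma app_scale: "app f (\<lambda>x. a * \<psi> x) = (\<lambda>x. a * app f \<psi> x)"
  using app_linear[of f "\<lambda>x. 0" a \<psi>] by (simp add: app_0)

lemma app_sum: "app f (\<lambda>x. \<Sum>i\<in>S. \<psi> i x) = (\<lambda>x. \<Sum>i\<in>S. app f (\<psi> i) x)"
  by (induction S rule: infinite_finite_induct) (simp_all add: app_0 app_add)

instantiation lop :: (type) ring_1
begin

lift_definition zero_lop :: "'a lop" is "\<lambda>\<phi> x. 0" by simp
lift_definition one_lop :: "'a lop" is "\<lambda>\<phi>. \<phi>" by simp
lift_definition plus_lop :: "'a lop \<Rightarrow> 'a lop \<Rightarrow> 'a lop" is "\<lambda>f g \<phi> x. f \<phi> x + g \<phi> x"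
  by (simp add: algebra_simps)
lift_definition uminus_lop :: "'a lop \<Rightarrow> 'a lop" is "\<lambda>f \<phi> x. - f \<phi> x"
  by (simp add: algebra_simps)
lift_definition minus_lop :: "'a lop \<Rightarrow> 'a lop \<Rightarrow> 'a lop" is "\<lambda>f g \<phi> x. f \<phi> x - g \<phi> x"
  by (simp add: algebra_simps)
lift_definition times_lop :: "'a lop \<Rightarrow> 'a lop \<Rightarrow> 'a lop" is "\<lambda>f g \<phi>. f (g \<phi>)"
  by simp

instance
proof
  show "(0 :: 'a lop) \<noteq> 1"
  proof
    assume "(0 :: 'a lop) = 1"
    then have "app (0 :: 'a lop) (\<lambda>x. 1) undefined = app 1 (\<lambda>x. 1) undefined" by simp
    then show False by (simp add: zero_lop.rep_eq one_lop.rep_eq)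
  qed
  fix a b c :: "'a lop"
  show "a * (b + c) = a * b + a * c"
    by (rule app_inject[THEN iffD1])
      (simp add: fun_eq_iff times_lop.rep_eq plus_lop.rep_eq app_add)
qed (transfer; simp add: fun_eq_iff algebra_simps)+

end

lemmas lop_app = zero_lop.rep_eq one_lop.rep_eq plus_lop.rep_eq uminus_lop.rep_eq minus_lop.rep_eq
  times_lop.rep_eq

lemma lop_eqI: "(\<And>\<phi> x. app f \<phi> x = app g \<phi> x) \<Longrightarrow> f = g"
  by (rule app_inject[THEN iffD1]) (simp add: fun_eq_iff)

lemma app_sum_lop: "app (\<Sum>i\<in>S. f i) \<phi> x = (\<Sum>i\<in>S. app (f i) \<phi> x)"
  by (induction S rule: infinite_finite_induct) (simp_all add: lop_app)

lift_definition osc :: "complex \<Rightarrow> 'b lop" is "\<lambda>c \<phi> x. c * \<phi> x"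
  by (simp add: algebra_simps)

interpretation osc: scalars "osc :: complex \<Rightarrow> 'b lop"
  by standard (auto intro!: lop_eqI simp: lop_app osc.rep_eq algebra_simps app_scale)

lemma osc_0 [simp]: "osc 0 = 0" and osc_1 [simp]: "osc 1 = 1"
  by (simp_all add: osc.zero osc.one)

lemma osc_minus: "osc (- c) = - osc c"
  by (rule lop_eqI) (simp add: lop_app osc.rep_eq)

text \<open>
  \<open>flip\<close> and the sign \<open>eps\<close> realise the spin module: \<open>cg i\<close> toggles the \<open>i\<close>-th exterior generator.
\<close>

definition flip :: "nat \<Rightarrow> nat set \<Rightarrow> nat set" where
  "flip i I = (if i \<in> I then I - {i} else insert i I)"

definition eps :: "nat \<Rightarrow> nat set \<Rightarrow> complex" where
  "eps i I = (- 1) ^ card {j \<in> I. j < i}"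

lemma flip_flip [simp]: "flip i (flip i I) = I"
  by (auto simp: flip_def)

lemma flip_commute: "flip i (flip j I) = flip j (flip i I)"
  by (auto simp: flip_def)

lemma eps_flip: "eps i (flip j I) = (if j < i then - eps i I else eps i I)"
proof (cases "j < i")
  case True
  let ?S = "{k \<in> I. k < i}"
  have fin: "finite ?S" by simp
  show ?thesis
  proof (cases "j \<in> I")
    case False
    have "{k \<in> flip j I. k < i} = insert j ?S" using True False by (auto simp: flip_def)
    moreover have "j \<notin> ?S" using False by simp
    ultimately show ?thesis using True fin by (simp add: eps_def)
  next
    case j: True
    have "?S = insert j {k \<in> flip j I. k < i}" using True j by (auto simp: flip_def)
    moreover have "j \<notin> {k \<in> flip j I. k < i}" using j by (simp add: flip_def)
    ultimately have "card ?S = Suc (card {k \<in> flip j I. k < i})"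
      using fin by (metis card_insert_disjoint finite_insert)
    then show ?thesis using True by (simp add: eps_def)
  qed
next
  case False
  then have "{k \<in> flip j I. k < i} = {k \<in> I. k < i}" by (auto simp: flip_def)
  with False show ?thesis by (simp add: eps_def)
qed

lemma eps_square: "eps i I * eps i I = 1"
  by (simp add: eps_def power_mult_distrib[symmetric])

lift_definition cg :: "nat \<Rightarrow> nat set lop" is "\<lambda>i \<psi> I. eps i I * \<psi> (flip i I)"
  by (simp add: algebra_simps)

lemma cg_square: "cg i * cg i = 1"
  by (rule lop_eqI) (simp add: lop_app cg.rep_eq eps_flip mult.assoc[symmetric] eps_square)

lemma cg_anticommute: "i \<noteq> j \<Longrightarrow> cg i * cg j = - (cg j * cg i)"
  by (rule lop_eqI) (auto simp: lop_app cg.rep_eq eps_flip flip_commute not_less_iff_gr_or_eq)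

lemma cg_anticomm: "cg i * cg j + cg j * cg i = osc (if i = j then 2 else 0)"
proof (cases "i = j")
  case True
  have "(1 :: nat set lop) + 1 = osc 2" using osc.add[of 1 1] by simp
  with True show ?thesis by (simp add: cg_square)
next
  case False
  then show ?thesis using cg_anticommute[OF False] by simp
qed

text \<open>
  A pair \<open>(b, I)\<close> consists of a word \<open>b\<close> in the parts of the partition, to be thought of as a function
  of the positions \<open>{1..n}\<close>, and of a basis vector \<open>I\<close> of the spin module. The operators
  \<open>crossed f w\<close> multiply like elements \<open>f w\<close> of a crossed product, where \<open>f\<close> is a function of words
  with values in the Clifford operators and \<open>w\<close> a permutation of the positions.
\<close>

type_synonym ws = "(nat \<Rightarrow> nat) \<times> nat set"

definition crossed :: "((nat \<Rightarrow> nat) \<Rightarrow> nat set lop) \<Rightarrow> (nat \<Rightarrow> nat) \<Rightarrow> ws lop" where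
  "crossed f w = Lop (\<lambda>\<phi> x. app (f (fst x)) (\<lambda>J. \<phi> (fst x \<circ> w, J)) (snd x))"

lemma crossed_rep_eq: "app (crossed f w) \<phi> x = app (f (fst x)) (\<lambda>J. \<phi> (fst x \<circ> w, J)) (snd x)"
proof -
  have "app (crossed f w) = (\<lambda>\<phi> x. app (f (fst x)) (\<lambda>J. \<phi> (fst x \<circ> w, J)) (snd x))"
    unfolding crossed_def by (rule Lop_inverse) (simp only: mem_Collect_eq app_linear simp_thms)
  then show ?thesis by simp
qed

lemma app_crossed: "app (crossed f w) \<phi> (b, I) = app (f b) (\<lambda>J. \<phi> (b \<circ> w, J)) I"
  by (simp add: crossed_rep_eq)

lemma crossed_mult: "crossed f w * crossed g v = crossed (\<lambda>b. f b * g (b \<circ> w)) (w \<circ> v)"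
  by (rule lop_eqI) (simp add: lop_app crossed_rep_eq comp_assoc)

lemma crossed_add: "crossed f w + crossed g w = crossed (\<lambda>b. f b + g b) w"
  by (rule lop_eqI) (simp add: lop_app crossed_rep_eq)

lemma crossed_minus: "- crossed f w = crossed (\<lambda>b. - f b) w"
  by (rule lop_eqI) (simp add: lop_app crossed_rep_eq)

lemma crossed_0: "crossed (\<lambda>b. 0) w = 0"
  by (rule lop_eqI) (simp add: lop_app crossed_rep_eq)

lemma crossed_1: "crossed (\<lambda>b. 1) id = 1"
  by (rule lop_eqI) (simp add: lop_app crossed_rep_eq)

lemma osc_crossed: "osc c * crossed f w = crossed (\<lambda>b. osc c * f b) w"
  by (rule lop_eqI) (simp add: lop_app crossed_rep_eq osc.rep_eq)

lemma crossed_osc: "crossed (\<lambda>b. osc c) id = osc c"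
  using osc_crossed[of c "\<lambda>b. 1" id] by (simp add: crossed_1)

section \<open>Operators for permutations, Clifford generators and vectors\<close>

definition Wop :: "(nat \<Rightarrow> nat) \<Rightarrow> ws lop" where
  "Wop w = crossed (\<lambda>b. 1) w"

definition Cop :: "nat \<Rightarrow> ws lop" where
  "Cop i = crossed (\<lambda>b. cg i) id"

text \<open>
  The operators \<open>Xop\<close> represent the generators of \<open>S(V)\<close>. The summand \<open>sg l j\<close> accounts for the
  Jucys-Murphy type correction, so that the elements \<open>tilde_vec\<close> only see the comparison of the labels.
\<close>

definition sg :: "nat \<Rightarrow> nat \<Rightarrow> complex" where
  "sg i j = (if i < j then 1 else if j < i then - 1 else 0)"

definition xco :: "nat \<Rightarrow> nat \<Rightarrow> (nat \<Rightarrow> nat) \<Rightarrow> complex" where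
  "xco l j b = (sg l j - sg (b l) (b j)) / 2"

text \<open>The summand j = l vanishes, because both comparisons in \<open>xco\<close> do.\<close>

definition Xop :: "nat \<Rightarrow> nat \<Rightarrow> ws lop" where
  "Xop n l = (\<Sum>j=1..n. crossed (\<lambda>b. osc (xco l j b)) (transpose l j))"

lemma app_Xop: "app (Xop n l) \<phi> (b, I) = (\<Sum>j=1..n. xco l j b * \<phi> (b \<circ> transpose l j, I))"
  by (simp add: Xop_def app_sum_lop app_crossed osc.rep_eq)

lemma Wop_mult: "Wop v * Wop w = Wop (v \<circ> w)"
  by (simp add: Wop_def crossed_mult)

lemma Wop_id: "Wop id = 1"
  by (simp add: Wop_def crossed_1)

lemma Cop_Wop: "Cop i * Wop w = Wop w * Cop i"
  by (simp add: Wop_def Cop_def crossed_mult)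

lemma Cop_Xop: "Cop i * Xop n l = Xop n l * Cop i"
  by (simp add: Xop_def Cop_def crossed_mult sum_distrib_left sum_distrib_right osc.central)

lemma Cop_anticomm: "Cop i * Cop j + Cop j * Cop i = osc (if i = j then 2 else 0)"
  unfolding Cop_def crossed_mult id_comp crossed_add cg_anticomm by (rule crossed_osc)

lemma sg_same [simp]: "sg i i = 0"
  by (simp add: sg_def)

lemma sg_swap: "sg j i = - sg i j"
  by (simp add: sg_def)

lemma xco_same [simp]: "xco l l b = 0"
  by (simp add: xco_def)

text \<open>After reindexing by the simple reflection s, both products run over the words b o (l j)
  o s, and the label comparisons cancel. A simple reflection reverses the order of no pair of
  positions except i, i+1; for that pair (l j) o s is the identity, which leaves the scalar.\<close>

lemma cross_Xop:
  assumes "l \<in> {1..n}" "i \<in> {1..<n}"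
  shows "Xop n l * Wop (simple_refl i) - Wop (simple_refl i) * Xop n (simple_refl i l)
    = osc (simple_root i l)"
proof (rule lop_eqI)
  fix \<phi> :: "ws \<Rightarrow> complex" and x :: ws
  obtain b I where x: "x = (b, I)" by (cases x)
  let ?s = "simple_refl i"
  have ss: "?s (?s j) = j" for j by (simp add: simple_refl_def)
  have s: "?s permutes {1..n}" using assms(2) by (rule simple_refl_permutes)
  have conj: "?s \<circ> transpose (?s l) (?s j) = transpose l j \<circ> ?s" for j
  proof
    fix y
    have "bij ?s" "inv_into UNIV ?s = ?s" by (simp_all add: simple_refl_def)
    then show "(?s \<circ> transpose (?s l) (?s j)) y = (transpose l j \<circ> ?s) y"
      using transpose_apply_commute[of ?s l j y] by simp
  qed
  have "app (Wop ?s * Xop n (?s l)) \<phi> (b, I)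
      = (\<Sum>j=1..n. xco (?s l) j (b \<circ> ?s) * \<phi> (b \<circ> ?s \<circ> transpose (?s l) j, I))"
    by (simp add: lop_app Wop_def app_crossed app_Xop)
  also have "\<dots> = (\<Sum>j=1..n. xco (?s l) (?s j) (b \<circ> ?s) * \<phi> (b \<circ> ?s \<circ> transpose (?s l) (?s j), I))"
    by (rule sum.permute[OF s, unfolded comp_def])
  also have "\<dots> = (\<Sum>j=1..n. (sg (?s l) (?s j) - sg (b l) (b j)) / 2 * \<phi> (b \<circ> transpose l j \<circ> ?s, I))"
    by (simp add: xco_def ss comp_assoc conj)
  finally have "app (Xop n l * Wop ?s - Wop ?s * Xop n (?s l)) \<phi> (b, I)
      = (\<Sum>j=1..n. (sg l j - sg (?s l) (?s j)) / 2 * \<phi> (b \<circ> transpose l j \<circ> ?s, I))"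
    by (simp add: lop_app app_Xop Wop_def app_crossed xco_def sum_subtractf[symmetric] algebra_simps diff_divide_distrib)
  also have "\<dots> = (\<Sum>j=1..n. if j = ?s l then simple_root i l * \<phi> (b, I) else 0)"
  proof (rule sum.cong)
    fix j assume "j \<in> {1..n}"
    show "(sg l j - sg (?s l) (?s j)) / 2 * \<phi> (b \<circ> transpose l j \<circ> ?s, I)
      = (if j = ?s l then simple_root i l * \<phi> (b, I) else 0)"
    proof (cases "j = ?s l \<and> l \<in> {i, Suc i}")
      case True
      then have "transpose l j \<circ> ?s = id"
        by (auto simp: fun_eq_iff simple_refl_def transpose_def)
      then have "b \<circ> transpose l j \<circ> ?s = b" by (simp add: comp_assoc)
      moreover have "(sg l j - sg (?s l) (?s j)) / 2 = simple_root i l"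
        using True by (auto simp: sg_def simple_refl_def simple_root_def xi_def)
      ultimately show ?thesis using True by simp
    next
      case False
      then have zero: "sg l j - sg (?s l) (?s j) = 0"
        unfolding simple_refl_def
        by (cases "l = i"; cases "l = Suc i"; cases "j = i"; cases "j = Suc i") (simp_all add: sg_def)
      have "simple_root i l = 0" if "j = ?s l"
        using False that by (simp add: simple_root_def xi_def)
      then show ?thesis unfolding zero by simp
    qed
  qed simp
  also have "\<dots> = simple_root i l * \<phi> (b, I)"
    using assms(1) permutes_in_image[OF s] by simp
  finally show "app (Xop n l * Wop ?s - Wop ?s * Xop n (?s l)) \<phi> x = app (osc (simple_root i l)) \<phi> x"
    by (simp add: x osc.rep_eq)
qed

lemma sum_split_two:
  assumes "l \<in> {1..n}" "k \<in> {1..n}" "l \<noteq> (k :: nat)"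
  shows "(\<Sum>j=1..n. F j) = F l + F k + (\<Sum>j\<in>{1..n} - {l, k}. (F j :: complex))"
proof -
  have "{1..n} = insert l (insert k ({1..n} - {l, k}))" using assms by auto
  then have "(\<Sum>j=1..n. F j) = (\<Sum>j\<in>insert l (insert k ({1..n} - {l, k})). F j)" by simp
  also have "\<dots> = F l + (F k + (\<Sum>j\<in>{1..n} - {l, k}. F j))"
    using assms by (subst sum.insert, simp, simp, subst sum.insert) auto
  finally show ?thesis by (simp add: add.assoc)
qed

text \<open>Products of two distinct transpositions of l, k, x are 3-cycles; these identities sort
  the six products of \<open>yang_baxter\<close> into the two of them.\<close>

lemma transpose_three_cycles:
  assumes "l \<noteq> k" "l \<noteq> x" "k \<noteq> x"
  shows "transpose l x \<circ> transpose k l = transpose k x \<circ> transpose l x"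
    "transpose k l \<circ> transpose l x = transpose l x \<circ> transpose k x"
    "transpose l k \<circ> transpose k x = transpose k x \<circ> transpose l x"
    "transpose k x \<circ> transpose l k = transpose l x \<circ> transpose k x"
proof -
  have *: "f = g" if "f l = g l" "f k = g k" "f x = g x" "\<And>y. y \<noteq> l \<Longrightarrow> y \<noteq> k \<Longrightarrow> y \<noteq> x \<Longrightarrow> f y = g y"
    for f g :: "'a \<Rightarrow> 'a"
    using that by (metis ext)
  note simps = transpose_def comp_def assms assms[symmetric]
  show "transpose l x \<circ> transpose k l = transpose k x \<circ> transpose l x"
    by (rule *) (simp_all add: simps)
  show "transpose k l \<circ> transpose l x = transpose l x \<circ> transpose k x"
    by (rule *) (simp_all add: simps)
  show "transpose l k \<circ> transpose k x = transpose k x \<circ> transpose l x"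
    by (rule *) (simp_all add: simps)
  show "transpose k x \<circ> transpose l k = transpose l x \<circ> transpose k x"
    by (rule *) (simp_all add: simps)
qed

text \<open>An Arnold-type relation for the sign function. Its constant 1 is the same for positions
  and for labels, so the two contributions can cancel in \<open>yang_baxter\<close>.\<close>

lemma sg_triangle:
  "sg l x * sg k x + sg l k * sg l x - sg k x * sg l k = (if l = k \<and> k = x then 0 else 1)"
  by (rule linorder_cases[of l k]; rule linorder_cases[of k x]; rule linorder_cases[of l x])
    (simp_all add: sg_def)

text \<open>These are the terms of the commutator of two vector operators that move three given
  positions. The coefficients of the two 3-cycles are, up to sign, a quarter of the difference
  between the triangle expressions of positions and of labels. If all labels agree, the label
  expression is 0 instead of 1, but then both 3-cycles give the same word and the two coefficients
  are opposite.\<close>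

lemma yang_baxter:
  assumes "l \<noteq> k" "l \<noteq> x" "k \<noteq> x"
  shows "xco l x b * xco k x (b \<circ> transpose l x) * \<phi> (b \<circ> transpose l x \<circ> transpose k x)
     - xco k x b * xco l x (b \<circ> transpose k x) * \<phi> (b \<circ> transpose k x \<circ> transpose l x)
     + (xco l x b * xco k l (b \<circ> transpose l x) * \<phi> (b \<circ> transpose l x \<circ> transpose k l)
     - xco k l b * xco l x (b \<circ> transpose k l) * \<phi> (b \<circ> transpose k l \<circ> transpose l x))
     + (xco l k b * xco k x (b \<circ> transpose l k) * \<phi> (b \<circ> transpose l k \<circ> transpose k x)
     - xco k x b * xco l k (b \<circ> transpose k x) * \<phi> (b \<circ> transpose k x \<circ> transpose l k)) = (0 :: complex)"
proof -
  define A where "A = \<phi> (b \<circ> (transpose l x \<circ> transpose k x))"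
  define B where "B = \<phi> (b \<circ> (transpose k x \<circ> transpose l x))"
  note eqs = transpose_three_cycles[OF assms]
  have AB: "A = B" if "b l = b k" "b k = b x"
  proof -
    have "b \<circ> transpose l x = b" "b \<circ> transpose k x = b"
      using that by (auto simp: fun_eq_iff transpose_def)
    then have "b \<circ> (transpose l x \<circ> transpose k x) = b \<circ> (transpose k x \<circ> transpose l x)"
      by (simp only: comp_assoc[symmetric])
    then show ?thesis by (simp add: A_def B_def)
  qed
  have fold: "\<phi> (b \<circ> transpose l x \<circ> transpose k x) = A" "\<phi> (b \<circ> transpose k x \<circ> transpose l x) = B"
    "\<phi> (b \<circ> transpose l x \<circ> transpose k l) = B" "\<phi> (b \<circ> transpose k l \<circ> transpose l x) = A"
    "\<phi> (b \<circ> transpose l k \<circ> transpose k x) = B" "\<phi> (b \<circ> transpose k x \<circ> transpose l k) = A"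
    by (simp_all only: comp_assoc eqs A_def B_def)
  have vals: "(b \<circ> transpose l x) k = b k" "(b \<circ> transpose l x) x = b l" "(b \<circ> transpose l x) l = b x"
    "(b \<circ> transpose k x) l = b l" "(b \<circ> transpose k x) x = b k" "(b \<circ> transpose k x) k = b x"
    "(b \<circ> transpose k l) l = b k" "(b \<circ> transpose k l) k = b l" "(b \<circ> transpose k l) x = b x"
    "(b \<circ> transpose l k) l = b k" "(b \<circ> transpose l k) k = b l" "(b \<circ> transpose l k) x = b x"
    using assms by (auto simp: transpose_def)
  define u v w where "u = sg l x" and "v = sg k x" and "w = sg l k"
  define P Q S where "P = sg (b l) (b x)" and "Q = sg (b k) (b x)" and "S = sg (b l) (b k)"
  have sgs: "sg k l = - w" "sg (b k) (b l) = - S"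
    by (simp_all add: w_def S_def sg_def)
  have pos: "u * v + w * u - v * w = 1"
    using sg_triangle[of l x k] assms by (simp add: u_def v_def w_def)
  note fin = xco_def vals sgs u_def[symmetric] v_def[symmetric] w_def[symmetric]
      P_def[symmetric] Q_def[symmetric] S_def[symmetric]
  show ?thesis
  proof (cases "b l = b k \<and> b k = b x")
    case True
    then have "P = 0" "Q = 0" "S = 0" "A = B" by (simp_all add: P_def Q_def S_def AB)
    then show ?thesis
      unfolding fold fin using pos by (simp add: field_simps)
  next
    case False
    then have lab: "P * Q + S * P - Q * S = 1"
      using sg_triangle[of "b l" "b x" "b k"] by (auto simp: P_def Q_def S_def)
    define e1 e2 e3 e4 e5 where "e1 = (u - P) / 2" and "e2 = (v + S) / 2" and "e3 = (S - w) / 2"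
      and "e4 = (u - Q) / 2" and "e5 = (v - Q) / 2"
    define e6 e7 e8 e9 e10 where "e6 = (w - P) / 2" and "e7 = (- w - Q) / 2" and "e8 = (w - S) / 2"
      and "e9 = (v - P) / 2" and "e10 = (u - S) / 2"
    note es = e1_def e2_def e3_def e4_def e5_def e6_def e7_def e8_def e9_def e10_def
    have "e1 * e2 - e3 * e4 - e5 * e6 = ((u * v + w * u - v * w) - (P * Q + S * P - Q * S)) / 4"
      by (simp add: es field_simps)
    then have i1: "e1 * e2 - e3 * e4 - e5 * e6 = 0" by (simp add: pos lab)
    have "e1 * e7 + e8 * e9 - e5 * e10 = ((P * Q + S * P - Q * S) - (u * v + w * u - v * w)) / 4"
      by (simp add: es field_simps)
    then have i2: "e1 * e7 + e8 * e9 - e5 * e10 = 0" by (simp add: pos lab)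
    have xs: "xco l x b = e1" "xco k x (b \<circ> transpose l x) = e2" "xco k x b = e5"
      "xco l x (b \<circ> transpose k x) = e10" "xco k l (b \<circ> transpose l x) = e7" "xco k l b = e3"
      "xco l x (b \<circ> transpose k l) = e4" "xco l k b = e8" "xco k x (b \<circ> transpose l k) = e9"
      "xco l k (b \<circ> transpose k x) = e6"
      unfolding fin es by simp_all
    have "e1 * e2 * A - e5 * e10 * B + (e1 * e7 * B - e3 * e4 * A) + (e8 * e9 * B - e5 * e6 * A)
      = (e1 * e2 - e3 * e4 - e5 * e6) * A + (e1 * e7 + e8 * e9 - e5 * e10) * B"
      by (simp add: algebra_simps)
    then show ?thesis
      unfolding fold xs by (simp add: i1 i2)
  qed
qed

lemma xco_swap: "xco k l b = - xco l k b"
  unfolding xco_def sg_swap[where j = k and i = l] sg_swap[where j = "b k" and i = "b l"]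
  by (simp add: field_simps)

text \<open>In the commutator, disjoint transpositions commute and leave each other's coefficients
  unchanged, and the pair (k, l) cancels by itself. What remains is grouped by the third position j
  into the triples of \<open>yang_baxter\<close>.\<close>

lemma Xop_commute:
  assumes l: "l \<in> {1..n}" and k: "k \<in> {1..n}"
  shows "Xop n l * Xop n k = Xop n k * Xop n l"
proof (cases "l = k")
  case False
  show ?thesis
  proof (rule lop_eqI)
    fix \<phi> :: "ws \<Rightarrow> complex" and x :: ws
    obtain b I where x: "x = (b, I)" by (cases x)
    define P where "P c = \<phi> (c, I)" for c
    define F where "F j m = xco l j b * xco k m (b \<circ> transpose l j) * P (b \<circ> transpose l j \<circ> transpose k m)
       - xco k m b * xco l j (b \<circ> transpose k m) * P (b \<circ> transpose k m \<circ> transpose l j)" for j m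
    let ?S = "{1..n} - {l, k}"
    have "app (Xop n l * Xop n k) \<phi> (b, I) = (\<Sum>j=1..n. \<Sum>m=1..n. xco l j b * xco k m (b \<circ> transpose l j) * P (b \<circ> transpose l j \<circ> transpose k m))"
      by (simp add: lop_app app_Xop P_def sum_distrib_left mult.assoc)
    moreover have "app (Xop n k * Xop n l) \<phi> (b, I) = (\<Sum>m=1..n. \<Sum>j=1..n. xco k m b * xco l j (b \<circ> transpose k m) * P (b \<circ> transpose k m \<circ> transpose l j))"
      by (simp add: lop_app app_Xop P_def sum_distrib_left mult.assoc)
    moreover have "(\<Sum>m=1..n. \<Sum>j=1..n. xco k m b * xco l j (b \<circ> transpose k m) * P (b \<circ> transpose k m \<circ> transpose l j))
      = (\<Sum>j=1..n. \<Sum>m=1..n. xco k m b * xco l j (b \<circ> transpose k m) * P (b \<circ> transpose k m \<circ> transpose l j))"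
      by (rule sum.swap)
    ultimately have "app (Xop n l * Xop n k) \<phi> (b, I) - app (Xop n k * Xop n l) \<phi> (b, I) = (\<Sum>j=1..n. \<Sum>m=1..n. F j m)"
      by (simp add: F_def sum_subtractf)
    also have "\<dots> = 0"
    proof -
      have Fl: "F l m = 0" for m by (simp add: F_def)
      have Fk: "F j k = 0" for j by (simp add: F_def)
      have Fkl: "F k l = 0"
      proof -
        have "xco l k b = - xco k l b" "xco k l (b \<circ> transpose l k) = - xco l k (b \<circ> transpose l k)"
          by (rule xco_swap)+
        moreover have "transpose l k = transpose k l" by (rule transpose_commute)
        moreover have "b \<circ> transpose l k \<circ> transpose k l = b" "b \<circ> transpose k l \<circ> transpose l k = b"
          by (auto simp: fun_eq_iff transpose_def)
        ultimately show ?thesis by (simp add: F_def)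
      qed
      have Fjm: "F j m = (if m = j then F j j else 0)" if "j \<in> ?S" "m \<in> ?S" for j m
      proof (cases "m = j")
        case False
        then have "transpose l j \<circ> transpose k m = transpose k m \<circ> transpose l j"
          using that \<open>l \<noteq> k\<close> by (intro ext) (simp add: transpose_def)
        then have "b \<circ> transpose l j \<circ> transpose k m = b \<circ> transpose k m \<circ> transpose l j"
          by (simp add: comp_assoc)
        then show ?thesis using that False \<open>l \<noteq> k\<close>
          by (simp add: F_def xco_def transpose_def)
      qed simp
      have "(\<Sum>m=1..n. F j m) = F j l + F j j" if j: "j \<in> ?S" for j
      proof -
        have "(\<Sum>m\<in>?S. F j m) = (\<Sum>m\<in>?S. if m = j then F j j else 0)"
          using Fjm j by (intro sum.cong) auto
        also have "\<dots> = F j j" using j by (simp add: sum.delta)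
        finally show ?thesis using sum_split_two[OF l k False, of "F j"] Fk by simp
      qed
      moreover have "(\<Sum>m=1..n. F k m) = (\<Sum>m\<in>?S. F k m)"
        using sum_split_two[OF l k False, of "F k"] Fk Fkl by simp
      ultimately have "(\<Sum>j=1..n. \<Sum>m=1..n. F j m) = (\<Sum>j\<in>?S. F k j) + (\<Sum>j\<in>?S. F j l + F j j)"
        using sum_split_two[OF l k False, of "\<lambda>j. \<Sum>m=1..n. F j m"] Fl by simp
      also have "\<dots> = (\<Sum>j\<in>?S. F j j + F j l + F k j)"
        by (simp add: sum.distrib algebra_simps)
      also have "\<dots> = 0"
      proof (rule sum.neutral, rule ballI)
        fix j assume j: "j \<in> ?S"
        show "F j j + F j l + F k j = 0"
          unfolding F_def by (rule yang_baxter) (use j False in auto)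
      qed
      finally show ?thesis .
    qed
    finally show "app (Xop n l * Xop n k) \<phi> x = app (Xop n k * Xop n l) \<phi> x"
      by (simp add: x)
  qed
qed simp

lemma (in scalars) left_commute: "x * (\<sigma> c * y) = \<sigma> c * (x * y)"
proof -
  have "x * (\<sigma> c * y) = (x * \<sigma> c) * y" by (simp only: mult.assoc)
  also have "x * \<sigma> c = \<sigma> c * x" by (rule central[symmetric])
  finally show ?thesis by (simp only: mult.assoc)
qed

lemma (in scalars) feval_commute:
  assumes "p \<in> fcar X" "\<And>x. x \<in> X \<Longrightarrow> g x * z = z * g x"
  shows "feval \<sigma> g p * z = z * feval \<sigma> g p"
  using assms(1)
proof (induction p rule: fcar_induct)
  case (mon c xs)
  then have "prod_list (map g xs) * z = z * prod_list (map g xs)"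
  proof (induction xs)
    case (Cons x xs)
    then have "g x * z = z * g x" using assms(2) by simp
    with Cons show ?case by (simp add: mult.assoc) (simp add: mult.assoc[symmetric])
  qed simp
  then show ?case
    by (simp add: feval_scal_mon mult.assoc left_commute)
qed (simp_all add: feval_add algebra_simps)

section \<open>From operators for the generators to representations of the algebras\<close>

definition gH :: "nat \<Rightarrow> hecke_gen \<Rightarrow> ws lop" where
  "gH n y = (case y of Xi i \<Rightarrow> Xop n i | Perm w \<Rightarrow> Wop w)"

lemma feval_gH_lin: "feval osc (gH n) (lin n Xi v) = (\<Sum>l=1..n. osc (v l) * Xop n l)"
  by (simp add: feval_lin[OF osc.scalars_axioms] gH_def)

lemma feval_gH_perm: "feval osc (gH n) (gen (Perm w)) = Wop w"
  by (simp add: osc.feval_gen gH_def)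

lemma osc_swap: "osc a * x * (osc b * y) = osc (a * b) * (x * y)"
proof -
  have "osc a * x * (osc b * y) = osc a * (x * osc b) * y" by (simp only: mult.assoc)
  also have "x * osc b = osc b * x" by (rule osc.central[symmetric])
  finally show ?thesis by (simp only: osc.mult mult.assoc)
qed

lemma osc_sum: "osc (\<Sum>i\<in>S. f i) = (\<Sum>i\<in>S. osc (f i))"
  by (induction S rule: infinite_finite_induct) (simp_all add: osc.add)

lemma lin_mult: "(\<Sum>i\<in>S. osc (u i) * A i) * (\<Sum>j\<in>S. osc (v j) * B j)
    = (\<Sum>i\<in>S. \<Sum>j\<in>S. osc (u i * v j) * (A i * B j))"
  by (simp add: sum_product osc_swap)

lemma gH_rels:
  assumes "r \<in> hecke_rels n"
  shows "feval osc (gH n) r = 0"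
proof -
  have comm: "feval osc (gH n) (lin n Xi u * lin n Xi v - lin n Xi v * lin n Xi u) = 0" for u v
  proof -
    have "(\<Sum>j=1..n. \<Sum>i=1..n. osc (v j * u i) * (Xop n j * Xop n i))
        = (\<Sum>i=1..n. \<Sum>j=1..n. osc (v j * u i) * (Xop n j * Xop n i))"
      by (rule sum.swap)
    also have "\<dots> = (\<Sum>i=1..n. \<Sum>j=1..n. osc (u i * v j) * (Xop n i * Xop n j))"
      by (intro sum.cong refl) (simp add: Xop_commute mult.commute[of "v _"])
    finally show ?thesis
      by (simp add: osc.feval_diff osc.feval_mult feval_gH_lin lin_mult)
  qed
  have cross: "feval osc (gH n) (lin n Xi v * gen (Perm (simple_refl i))
        - gen (Perm (simple_refl i)) * lin n Xi (act (simple_refl i) v)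
        - scal (bilin n (simple_root i) v)) = 0" if i: "i \<in> {1..<n}" for v i
  proof -
    let ?s = "simple_refl i"
    have s: "?s permutes {1..n}" using i by (rule simple_refl_permutes)
    have ss: "?s (?s j) = j" for j by (simp add: simple_refl_def)
    have act: "act ?s v l = v (?s l)" for l
      by (simp add: act_def simple_refl_def)
    have "(\<Sum>l=1..n. osc (v (?s l)) * Xop n l) = (\<Sum>l=1..n. osc (v l) * Xop n (?s l))"
      using sum.permute[OF s, of "\<lambda>l. osc (v (?s l)) * Xop n l"] by (simp add: comp_def ss)
    then have "feval osc (gH n) (lin n Xi v * gen (Perm ?s) - gen (Perm ?s) * lin n Xi (act ?s v))
      = (\<Sum>l=1..n. osc (v l) * Xop n l) * Wop ?s - Wop ?s * (\<Sum>l=1..n. osc (v l) * Xop n (?s l))"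
      by (simp add: osc.feval_diff osc.feval_mult feval_gH_lin feval_gH_perm act)
    also have "\<dots> = (\<Sum>l=1..n. osc (v l) * (Xop n l * Wop ?s - Wop ?s * Xop n (?s l)))"
    proof -
      have "Wop ?s * (osc (v l) * Xop n (?s l)) = osc (v l) * (Wop ?s * Xop n (?s l))" for l
        by (rule osc.left_commute)
      then show ?thesis
        by (simp add: sum_distrib_left sum_distrib_right sum_subtractf right_diff_distrib mult.assoc)
    qed
    also have "\<dots> = (\<Sum>l=1..n. osc (v l) * osc (simple_root i l))"
      by (intro sum.cong refl) (simp only: cross_Xop[OF _ i])
    also have "\<dots> = osc (bilin n (simple_root i) v)"
      by (simp add: bilin_def osc_sum osc.mult[symmetric] mult.commute)
    finally show ?thesis
      by (simp add: osc.feval_diff[of _ _ "scal _"] osc.feval_scal)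
  qed
  show ?thesis
    using assms comm cross unfolding hecke_rels_def
    by (auto simp: osc.feval_diff osc.feval_mult feval_gH_perm Wop_mult Wop_id)
qed

definition opH :: "nat \<Rightarrow> hecke_gen free set \<Rightarrow> ws lop" where
  "opH n x = feval osc (gH n) (H.rep n x)"

lemma opH_cl: "p \<in> fcar (hecke_gens n) \<Longrightarrow> opH n (H.cl n p) = feval osc (gH n) p"
  unfolding opH_def
  by (rule H.feval_cong[OF osc.scalars_axioms gH_rels H.rep_cl])

lemma feval_Cop_lin: "feval osc Cop (lin n id v) = (\<Sum>l=1..n. osc (v l) * Cop l)"
  by (simp add: feval_lin[OF osc.scalars_axioms])

lemma Cop_rels:
  assumes "r \<in> cliff_rels n"
  shows "feval osc Cop r = 0"
proof -
  have "feval osc Cop (lin n id u * lin n id v + lin n id v * lin n id u - scal (2 * bilin n u v)) = 0" for u v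
  proof -
    have "(\<Sum>j=1..n. \<Sum>i=1..n. osc (v j * u i) * (Cop j * Cop i))
        = (\<Sum>i=1..n. \<Sum>j=1..n. osc (u i * v j) * (Cop j * Cop i))"
      by (subst sum.swap) (simp add: mult.commute[of "v _"])
    then have "feval osc Cop (lin n id u * lin n id v + lin n id v * lin n id u)
      = (\<Sum>i=1..n. \<Sum>j=1..n. osc (u i * v j) * (Cop i * Cop j + Cop j * Cop i))"
      by (simp add: osc.feval_add osc.feval_mult feval_Cop_lin lin_mult sum.distrib distrib_left)
    also have "\<dots> = (\<Sum>i=1..n. \<Sum>j=1..n. if j = i then osc (2 * (u i * v i)) else 0)"
      by (intro sum.cong refl) (auto simp: Cop_anticomm osc.mult[symmetric] mult.commute)
    also have "\<dots> = osc (2 * bilin n u v)"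
      by (simp add: bilin_def sum_distrib_left osc_sum)
    finally show ?thesis by (simp add: osc.feval_diff osc.feval_scal)
  qed
  with assms show ?thesis by (auto simp: cliff_rels_def)
qed

definition opC :: "nat \<Rightarrow> nat free set \<Rightarrow> ws lop" where
  "opC n y = feval osc Cop (C.rep n y)"

lemma opC_cl: "p \<in> fcar (cliff_gens n) \<Longrightarrow> opC n (C.cl n p) = feval osc Cop p"
  unfolding opC_def
  by (rule C.feval_cong[OF osc.scalars_axioms Cop_rels C.rep_cl])

lemma gH_Cop: "gH n y * Cop i = Cop i * gH n y"
  by (cases y) (simp_all add: gH_def Cop_Xop Cop_Wop)

text \<open>The tensor product is ungraded, so the two factors must commute; Clifford generators act
  independently of the word and therefore do.\<close>

lemma opH_opC:
  assumes "x \<in> carrier (hecke n)" "y \<in> carrier (cliff n)"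
  shows "opH n x * opC n y = opC n y * opH n x"
proof -
  obtain p where p: "p \<in> fcar (hecke_gens n)" "x = H.cl n p" using assms(1) by (rule hecke_cases)
  obtain q where q: "q \<in> fcar (cliff_gens n)" "y = C.cl n q" using assms(2) by (rule cliff_cases)
  have "feval osc Cop q * gH n z = gH n z * feval osc Cop q" for z
    by (rule osc.feval_commute[OF q(1)]) (simp add: gH_Cop)
  then have "feval osc (gH n) p * feval osc Cop q = feval osc Cop q * feval osc (gH n) p"
    by (intro osc.feval_commute[OF p(1)]) simp
  with p q show ?thesis by (simp add: opH_cl opC_cl)
qed

lemma
  assumes "x \<in> carrier (hecke n)" "x' \<in> carrier (hecke n)"
  shows opH_mult: "opH n (x \<otimes>\<^bsub>hecke n\<^esub> x') = opH n x * opH n x'"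
    and opH_add: "opH n (x \<oplus>\<^bsub>hecke n\<^esub> x') = opH n x + opH n x'"
    and opH_smult: "opH n (c \<odot>\<^bsub>hecke n\<^esub> x) = osc c * opH n x"
  using assms
  by (auto elim!: hecke_cases simp: hecke_ops opH_cl osc.feval_mult osc.feval_add osc.feval_scal)

lemma opH_one: "opH n \<one>\<^bsub>hecke n\<^esub> = 1"
  by (simp add: hecke_ops opH_cl)

lemma
  assumes "x \<in> carrier (cliff n)" "x' \<in> carrier (cliff n)"
  shows opC_mult: "opC n (x \<otimes>\<^bsub>cliff n\<^esub> x') = opC n x * opC n x'"
    and opC_add: "opC n (x \<oplus>\<^bsub>cliff n\<^esub> x') = opC n x + opC n x'"
    and opC_smult: "opC n (c \<odot>\<^bsub>cliff n\<^esub> x) = osc c * opC n x"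
  using assms
  by (auto elim!: cliff_cases simp: cliff_ops opC_cl osc.feval_mult osc.feval_add osc.feval_scal)

lemma opC_one: "opC n \<one>\<^bsub>cliff n\<^esub> = 1"
  by (simp add: cliff_ops opC_cl)

definition gHC :: "nat \<Rightarrow> hecke_gen free set \<times> nat free set \<Rightarrow> ws lop" where
  "gHC n = (\<lambda>(x, y). opH n x * opC n y)"

lemma gHC_rels:
  assumes "r \<in> tensor_rels (hecke n) (cliff n)"
  shows "feval osc (gHC n) r = 0"
proof -
  have m: "opH n a * opC n b * (opH n a' * opC n b') = opH n (a \<otimes>\<^bsub>hecke n\<^esub> a') * opC n (b \<otimes>\<^bsub>cliff n\<^esub> b')"
    if "a \<in> carrier (hecke n)" "a' \<in> carrier (hecke n)" "b \<in> carrier (cliff n)" "b' \<in> carrier (cliff n)" for a a' b b'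
  proof -
    have "opH n a * opC n b * (opH n a' * opC n b') = opH n a * (opC n b * opH n a') * opC n b'"
      by (simp only: mult.assoc)
    also have "opC n b * opH n a' = opH n a' * opC n b" using that by (simp add: opH_opC)
    finally show ?thesis using that by (simp add: opH_mult opC_mult mult.assoc)
  qed
  have sc: "opH n a * (osc c * y) = osc c * (opH n a * y)" for a c y
    by (rule osc.left_commute)
  show ?thesis
    using assms unfolding tensor_rels_def
    by (elim UnE CollectE exE conjE singletonE; hypsubst;
        simp only: osc.feval_diff osc.feval_mult osc.feval_gen osc.feval_scal osc.feval_1 gHC_def prod.case
          opH_add opC_add opH_smult opC_smult opH_one opC_one m[unfolded mult.assoc] sc distrib_left distrib_right mult.assoc)
      simp_all
qed

definition opHC :: "nat \<Rightarrow> hecke_cliff \<Rightarrow> ws lop" where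
  "opHC n x = feval osc (gHC n) (HC.rep n x)"

lemma opHC_cl: "p \<in> fcar (carrier (hecke n) \<times> carrier (cliff n)) \<Longrightarrow> opHC n (HC.cl n p) = feval osc (gHC n) p"
  unfolding opHC_def
  by (rule HC.feval_cong[OF osc.scalars_axioms gHC_rels HC.rep_cl])

lemma
  assumes "x \<in> carrier (HC n)" "x' \<in> carrier (HC n)"
  shows opHC_mult: "opHC n (x \<otimes>\<^bsub>HC n\<^esub> x') = opHC n x * opHC n x'"
    and opHC_add: "opHC n (x \<oplus>\<^bsub>HC n\<^esub> x') = opHC n x + opHC n x'"
  using assms
  by (auto elim!: HC_cases simp: HC_ops opHC_cl osc.feval_mult osc.feval_add)

lemma opHC_tensHC: "x \<in> carrier (hecke n) \<Longrightarrow> y \<in> carrier (cliff n) \<Longrightarrow> opHC n (tensHC n x y) = opH n x * opC n y"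
  by (simp add: tensHC_cl opHC_cl fcar_gen osc.feval_gen gHC_def)

section \<open>Operators anticommuting with the Dirac operator\<close>

definition dco :: "nat \<Rightarrow> nat \<Rightarrow> (nat \<Rightarrow> nat) \<Rightarrow> complex" where
  "dco l j b = - sg (b l) (b j) / 2"

definition dterm :: "nat \<Rightarrow> nat \<Rightarrow> ws lop" where
  "dterm l j = crossed (\<lambda>b. osc (dco l j b) * cg l) (transpose l j)"

definition Dop :: "nat \<Rightarrow> ws lop" where
  "Dop n = (\<Sum>l=1..n. \<Sum>j=1..n. dterm l j)"

lemma sg_w0: "l \<in> {1..n} \<Longrightarrow> j \<in> {1..n} \<Longrightarrow> sg (w0 n l) (w0 n j) = - sg l j"
  by (auto simp: sg_def w0_def)

lemma delta_vec_xi: "delta_vec n (xi l) = (\<lambda>j. - xi (w0 n l) j)"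
proof -
  have inv: "inv_into UNIV (w0 n) = w0 n"
    using w0_w0[of n] by (intro inv_unique_comp) auto
  have "xi l (w0 n j) = xi (w0 n l) j" for j
    using w0_w0[of n] by (auto simp: xi_def fun_eq_iff)
  then show ?thesis by (simp add: delta_vec_def act_def inv fun_eq_iff)
qed

text \<open>The vector \<delta>(\<xi>_l) is the negative of \<xi>_(w0 l), so the element is the mean
  of \<xi>_l and w0 \<xi>_(w0 l) w0. Conjugation by w0 negates \<open>sg l j\<close> and keeps the
  comparison of labels; in the mean the position terms cancel.\<close>

lemma opH_tilde:
  assumes "l \<in> {1..n}"
  shows "opH n (tilde_vec n (xi l)) = (\<Sum>j=1..n. crossed (\<lambda>b. osc (dco l j b)) (transpose l j))"
proof -
  let ?w = "w0 n"
  have ww: "?w (?w j) = j" for j using w0_w0[of n] by (simp add: fun_eq_iff)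
  have wl: "?w l \<in> {1..n}" using assms permutes_in_image[OF w0_permutes[of n]] by blast
  have inv: "inv_into UNIV ?w = ?w"
    using w0_w0[of n] by (intro inv_unique_comp) auto
  have conj: "?w \<circ> (transpose (?w l) (?w j) \<circ> ?w) = transpose l j" for j
  proof
    fix y
    have "bij ?w" using permutes_bij[OF w0_permutes] .
    then show "(?w \<circ> (transpose (?w l) (?w j) \<circ> ?w)) y = transpose l j y"
      using transpose_apply_commute[of ?w l j "?w y"] by (simp add: inv ww)
  qed
  have "Wop ?w * Xop n (?w l) * Wop ?w = (\<Sum>j=1..n. crossed (\<lambda>b. osc (xco (?w l) j (b \<circ> ?w))) (?w \<circ> (transpose (?w l) j \<circ> ?w)))"
    by (simp add: Xop_def Wop_def sum_distrib_left sum_distrib_right crossed_mult comp_assoc)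
  also have "\<dots> = (\<Sum>j=1..n. crossed (\<lambda>b. osc (xco (?w l) (?w j) (b \<circ> ?w))) (?w \<circ> (transpose (?w l) (?w j) \<circ> ?w)))"
    by (rule sum.reindex_bij_betw[OF permutes_imp_bij[OF w0_permutes], symmetric])
  also have "\<dots> = (\<Sum>j=1..n. crossed (\<lambda>b. osc ((- sg l j - sg (b l) (b j)) / 2)) (transpose l j))"
  proof (rule sum.cong[OF refl])
    fix j assume "j \<in> {1..n}"
    from sg_w0[OF assms this]
    show "crossed (\<lambda>b. osc (xco (?w l) (?w j) (b \<circ> ?w))) (?w \<circ> (transpose (?w l) (?w j) \<circ> ?w))
      = crossed (\<lambda>b. osc ((- sg l j - sg (b l) (b j)) / 2)) (transpose l j)"
      by (simp add: conj xco_def ww)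
  qed
  finally have W: "Wop ?w * Xop n (?w l) * Wop ?w
      = (\<Sum>j=1..n. crossed (\<lambda>b. osc ((- sg l j - sg (b l) (b j)) / 2)) (transpose l j))" .
  have lin: "lin n Xi (delta_vec n (xi l)) = - gen (Xi (?w l))"
  proof -
    have "lin n Xi (delta_vec n (xi l)) = - lin n Xi (xi (?w l))"
      by (simp add: delta_vec_xi lin_def scal_minus sum_negf)
    then show ?thesis using wl by (simp add: lin_xi)
  qed
  have "opH n (tilde_vec n (xi l)) = osc (1 / 2) * (Xop n l + Wop ?w * Xop n (?w l) * Wop ?w)"
  proof -
    have "tilde_free n (xi l) = scal (1 / 2) * (gen (Xi l) + gen (Perm ?w) * gen (Xi (?w l)) * gen (Perm ?w))"
      unfolding tilde_free_def lin lin_xi[OF assms] by simp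
    moreover have "opH n (tilde_vec n (xi l)) = feval osc (gH n) (tilde_free n (xi l))"
      by (simp add: tilde_vec_cl opH_cl)
    ultimately show ?thesis
      by (simp add: osc.feval_mult osc.feval_add osc.feval_scal osc.feval_gen gH_def)
  qed
  also have "\<dots> = (\<Sum>j=1..n. crossed (\<lambda>b. osc (dco l j b)) (transpose l j))"
    unfolding W unfolding Xop_def sum.distrib[symmetric] crossed_add sum_distrib_left osc_crossed osc.add[symmetric] osc.mult[symmetric]
    by (intro sum.cong refl arg_cong2[where f = crossed] ext arg_cong[where f = osc])
      (simp add: xco_def dco_def field_simps)
  finally show ?thesis .
qed

lemma opHC_dirac: "opHC n (dirac n) = Dop n"
proof -
  have c: "opC n (cliff_vec n (xi l)) = Cop l" if "l \<in> {1..n}" for l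
  proof -
    have "l \<in> cliff_gens n" using that by (simp add: cliff_gens_def)
    then show ?thesis using that by (simp add: cliff_vec_cl opC_cl lin_xi osc.feval_gen fcar_gen)
  qed
  have "opHC n (dirac n) = (\<Sum>l=1..n. opH n (tilde_vec n (xi l)) * opC n (cliff_vec n (xi l)))"
    by (simp add: dirac_cl opHC_cl) (simp add: dirac_free_def osc.feval_sum osc.feval_gen gHC_def)
  also have "\<dots> = Dop n"
    unfolding Dop_def dterm_def
    by (intro sum.cong refl) (simp add: opH_tilde c sum_distrib_right Cop_def crossed_mult)
  finally show ?thesis .
qed

text \<open>In a Clifford algebra, conjugation by a root acts on vectors as minus the
  reflection.\<close>

lemma cg_reflect:
  assumes "l \<noteq> j"
  shows "(cg l - cg j) * cg (transpose l j i) = - (cg i * (cg l - cg j))"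
proof -
  consider "i = l" | "i = j" | "i \<noteq> l" "i \<noteq> j" by blast
  then show ?thesis
  proof cases
    case 1
    then show ?thesis using cg_anticommute[OF assms] by (simp add: algebra_simps cg_square)
  next
    case 2
    then show ?thesis using cg_anticommute[OF assms] by (simp add: algebra_simps cg_square)
  next
    case 3
    then show ?thesis using cg_anticommute[of l i] cg_anticommute[of j i] by (simp add: algebra_simps)
  qed
qed

text \<open>A vector determined by the word: the reflection (l j) carries the vector of b o (l j) to
  that of b, which is the content of \<open>label_sum_reflect\<close>.\<close>

definition label_sum :: "nat \<Rightarrow> nat \<Rightarrow> (nat \<Rightarrow> nat) \<Rightarrow> nat set lop" where
  "label_sum n a b = (\<Sum>i=1..n. if b i = a then cg i else 0)"

definition Rop :: "nat \<Rightarrow> nat \<Rightarrow> ws lop" where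
  "Rop n a = crossed (label_sum n a) id"

lemma label_sum_reflect:
  assumes "l \<in> {1..n}" "j \<in> {1..n}" "l \<noteq> j"
  shows "(cg l - cg j) * label_sum n a (b \<circ> transpose l j) = - (label_sum n a b * (cg l - cg j))"
proof -
  have "transpose l j permutes {1..n}" using assms by (intro permutes_swap_id)
  from sum.permute[OF this, of "\<lambda>i. if b (transpose l j i) = a then cg i else 0"]
  have "label_sum n a (b \<circ> transpose l j) = (\<Sum>i=1..n. if b i = a then cg (transpose l j i) else 0)"
    by (simp add: label_sum_def comp_def)
  moreover have "(cg l - cg j) * (if b i = a then cg (transpose l j i) else 0)
      = - ((if b i = a then cg i else 0) * (cg l - cg j))" for i
    by (simp add: cg_reflect[OF assms(3)])
  ultimately show ?thesis
    by (simp add: label_sum_def sum_distrib_left sum_distrib_right sum_negf)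
qed

lemma lop_double_zero: "x + x = 0 \<Longrightarrow> x = (0 :: 'b lop)"
proof -
  assume "x + x = 0"
  then have "osc (1 / 2) * (x + x) = 0" by simp
  moreover have "osc (1 / 2) * (x + x) = (osc (1 / 2) + osc (1 / 2)) * x" by (simp add: algebra_simps)
  ultimately show ?thesis by (simp add: osc.add[symmetric])
qed

lemma dco_swap: "dco j l b = - dco l j b"
  by (simp add: dco_def sg_def)

text \<open>In the anticommutator, \<open>dco l j\<close> is antisymmetric in l and j while the
  transposition is symmetric. Adding the terms (l, j) and (j, l) therefore produces the root c_l -
  c_j, to which the reflection rule applies. This shows that twice the anticommutator is
  zero.\<close>

lemma Dop_Rop: "Dop n * Rop n a = - (Rop n a * Dop n)"
proof -
  define G where "G l j = crossed (\<lambda>b. osc (dco l j b) * (cg l * label_sum n a (b \<circ> transpose l j) + label_sum n a b * cg l)) (transpose l j)" for l j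
  have osc_c: "label_sum n a b * (osc c * y) = osc c * (label_sum n a b * y)" for b c y
    by (rule osc.left_commute)
  have "Dop n * Rop n a + Rop n a * Dop n = (\<Sum>l=1..n. \<Sum>j=1..n. G l j)"
    unfolding Dop_def Rop_def dterm_def sum_distrib_left sum_distrib_right crossed_mult sum.distrib[symmetric] G_def
      id_comp comp_id crossed_add
    by (simp add: distrib_left mult.assoc osc_c)
  moreover have "(\<Sum>l=1..n. \<Sum>j=1..n. G l j) + (\<Sum>l=1..n. \<Sum>j=1..n. G l j) = 0"
  proof -
    have G0: "G l j + G j l = 0" if "l \<in> {1..n}" "j \<in> {1..n}" for l j
    proof (cases "l = j")
      case True
      then show ?thesis by (simp add: G_def dco_def crossed_0)
    next
      case False
      have "osc (dco l j b) * (cg l * label_sum n a (b \<circ> transpose l j) + label_sum n a b * cg l)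
         + osc (dco j l b) * (cg j * label_sum n a (b \<circ> transpose j l) + label_sum n a b * cg j) = 0" for b
      proof -
        have "osc (dco l j b) * (cg l * label_sum n a (b \<circ> transpose l j) + label_sum n a b * cg l)
         + osc (dco j l b) * (cg j * label_sum n a (b \<circ> transpose j l) + label_sum n a b * cg j)
         = osc (dco l j b) * ((cg l - cg j) * label_sum n a (b \<circ> transpose l j) + label_sum n a b * (cg l - cg j))"
          by (simp add: dco_swap[of j l] osc_minus transpose_commute[of j l] algebra_simps)
        then show ?thesis by (simp add: label_sum_reflect[OF that False])
      qed
      then show ?thesis
        unfolding G_def transpose_commute[of j l] crossed_add by (simp add: transpose_commute[of j l] crossed_0)
    qed
    have "(\<Sum>l=1..n. \<Sum>j=1..n. G l j) + (\<Sum>l=1..n. \<Sum>j=1..n. G l j)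
       = (\<Sum>l=1..n. \<Sum>j=1..n. G l j) + (\<Sum>j=1..n. \<Sum>l=1..n. G l j)"
      by (subst (2) sum.swap) simp
    also have "\<dots> = (\<Sum>l=1..n. \<Sum>j=1..n. G l j + G j l)"
      by (simp add: sum.distrib)
    also have "\<dots> = 0" using G0 by (intro sum.neutral ballI) auto
    finally show ?thesis .
  qed
  ultimately have "Dop n * Rop n a + Rop n a * Dop n = 0"
    by (metis lop_double_zero)
  then show ?thesis by (simp add: add_eq_0_iff2 add_eq_0_iff)
qed

text \<open>The operator of \<tau>_i under the diagonal embedding, without the factor 1/sqrt
  2.\<close>

definition Sop :: "nat \<Rightarrow> ws lop" where
  "Sop i = crossed (\<lambda>b. cg i - cg (Suc i)) (simple_refl i)"

text \<open>D compares labels only, so moving the reflection past it renames l, j to their images.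
  The sum over all pairs absorbs the renaming, and \<open>cg_reflect\<close> contributes the
  sign.\<close>

lemma Dop_Sop:
  assumes "i \<in> {1..<n}"
  shows "Dop n * Sop i = - (Sop i * Dop n)"
proof -
  let ?s = "simple_refl i" and ?c = "cg i - cg (Suc i)"
  have s: "?s permutes {1..n}" using assms by (rule simple_refl_permutes)
  have ss: "?s (?s j) = j" for j by (simp add: simple_refl_def)
  have conj: "?s \<circ> transpose (?s l) (?s j) = transpose l j \<circ> ?s" for l j
  proof
    fix y
    have "bij ?s" "inv_into UNIV ?s = ?s" by (simp_all add: simple_refl_def)
    then show "(?s \<circ> transpose (?s l) (?s j)) y = (transpose l j \<circ> ?s) y"
      using transpose_apply_commute[of ?s l j y] by simp
  qed
  have refl: "?c * cg (?s l) = - (cg l * ?c)" for l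
    unfolding simple_refl_def by (rule cg_reflect) simp
  have osc_c: "?c * (osc c * y) = osc c * (?c * y)" for c y
    by (rule osc.left_commute)
  have dco: "dco (?s l) (?s j) (b \<circ> ?s) = dco l j b" for l j b
    by (simp add: dco_def ss)
  have t: "Sop i * dterm (?s l) (?s j) = crossed (\<lambda>b. - (osc (dco l j b) * (cg l * ?c))) (transpose l j \<circ> ?s)" for l j
    unfolding Sop_def dterm_def crossed_mult conj dco osc_c refl by simp
  have "Sop i * Dop n = (\<Sum>l=1..n. \<Sum>j=1..n. Sop i * dterm l j)"
    by (simp add: Dop_def sum_distrib_left)
  also have "\<dots> = (\<Sum>l=1..n. \<Sum>j=1..n. Sop i * dterm (?s l) (?s j))"
  proof -
    have "(\<Sum>j=1..n. Sop i * dterm l j) = (\<Sum>j=1..n. Sop i * dterm l (?s j))" for l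
      using sum.permute[OF s, of "\<lambda>j. Sop i * dterm l j"] by (simp add: comp_def)
    then have "(\<Sum>l=1..n. \<Sum>j=1..n. Sop i * dterm l j) = (\<Sum>l=1..n. \<Sum>j=1..n. Sop i * dterm l (?s j))" by simp
    also have "\<dots> = (\<Sum>l=1..n. \<Sum>j=1..n. Sop i * dterm (?s l) (?s j))"
      using sum.permute[OF s, of "\<lambda>l. \<Sum>j=1..n. Sop i * dterm l (?s j)"] by (simp add: comp_def)
    finally show ?thesis .
  qed
  also have "\<dots> = (\<Sum>l=1..n. \<Sum>j=1..n. crossed (\<lambda>b. - (osc (dco l j b) * (cg l * ?c))) (transpose l j \<circ> ?s))"
    by (simp only: t)
  also have "\<dots> = - (Dop n * Sop i)"
    by (simp add: Dop_def dterm_def Sop_def sum_distrib_right crossed_mult crossed_minus[symmetric] sum_negf mult.assoc)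
  finally show ?thesis by simp
qed

definition cvol :: "nat \<Rightarrow> nat set lop" where
  "cvol n = prod_list (map cg [1..<Suc n])"

text \<open>The generator c_l anticommutes with every factor except itself. The exponent counts all
  factors and, instead of subtracting 1 for c_l, adds 1.\<close>

lemma cg_prod_list:
  assumes "distinct xs"
  shows "cg l * prod_list (map cg xs) = (- 1) ^ (length xs + (if l \<in> set xs then 1 else 0)) * (prod_list (map cg xs) * cg l)"
  using assms
proof (induction xs)
  case (Cons x xs)
  have pw: "y * ((- 1) ^ k * z) = (- 1) ^ k * (y * z)" for y z :: "nat set lop" and k
    by (cases "even k") simp_all
  show ?case
  proof (cases "l = x")
    case True
    with Cons.prems have "l \<notin> set xs" by simp
    with Cons have IH: "cg l * prod_list (map cg xs) = (- 1) ^ length xs * (prod_list (map cg xs) * cg l)" by simp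
    have "cg l * prod_list (map cg (x # xs)) = cg l * (cg l * prod_list (map cg xs))" by (simp add: True)
    also have "\<dots> = (- 1) ^ length xs * (cg l * (prod_list (map cg xs) * cg l))"
      by (subst IH) (rule pw)
    finally show ?thesis by (simp add: True[symmetric] mult.assoc power_add)
  next
    case False
    with Cons have IH: "cg l * prod_list (map cg xs)
      = (- 1) ^ (length xs + (if l \<in> set xs then 1 else 0)) * (prod_list (map cg xs) * cg l)" by simp
    have "cg l * prod_list (map cg (x # xs)) = - (cg x * (cg l * prod_list (map cg xs)))"
      using cg_anticommute[OF False] by (simp add: mult.assoc[symmetric])
    also have "cg x * (cg l * prod_list (map cg xs))
      = (- 1) ^ (length xs + (if l \<in> set xs then 1 else 0)) * (cg x * (prod_list (map cg xs) * cg l))"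
      by (subst IH) (rule pw)
    finally show ?thesis using False by (simp add: mult.assoc power_add)
  qed
qed simp

lemma cg_cvol: "l \<in> {1..n} \<Longrightarrow> cg l * cvol n = (- 1) ^ (n + 1) * (cvol n * cg l)"
  using cg_prod_list[of "[1..<Suc n]" l] by (auto simp: cvol_def)

definition Vop :: "nat \<Rightarrow> ws lop" where
  "Vop n = crossed (\<lambda>b. cvol n) id"

lemma Dop_Vop: "Dop n * Vop n = (- 1) ^ (n + 1) * (Vop n * Dop n)"
proof -
  have t: "dterm l j * Vop n = (- 1) ^ (n + 1) * (Vop n * dterm l j)" if "l \<in> {1..n}" for l j
  proof -
    have "cvol n * (osc c * y) = osc c * (cvol n * y)" for c y
      by (rule osc.left_commute)
    then show ?thesis
      by (cases "even n") (simp_all add: dterm_def Vop_def crossed_mult mult.assoc cg_cvol[OF that] crossed_minus)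
  qed
  have "Dop n * Vop n = (\<Sum>l=1..n. \<Sum>j=1..n. dterm l j * Vop n)"
    by (simp add: Dop_def sum_distrib_right)
  also have "\<dots> = (\<Sum>l=1..n. \<Sum>j=1..n. (- 1) ^ (n + 1) * (Vop n * dterm l j))"
    by (intro sum.cong refl) (simp add: t)
  also have "\<dots> = (- 1) ^ (n + 1) * (Vop n * Dop n)"
    by (simp add: Dop_def sum_distrib_left)
  finally show ?thesis .
qed

section \<open>A nonzero trace\<close>

definition point :: "'b \<Rightarrow> 'b \<Rightarrow> complex" where
  "point x = (\<lambda>y. if y = x then 1 else 0)"

text \<open>The operator descends to functions on B, as values outside B do not influence values
  inside. This gives the trace over a finite B its cyclic property, although the operators act on
  functions on an infinite type.\<close>

definition local_on :: "'b set \<Rightarrow> 'b lop \<Rightarrow> bool" where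
  "local_on B F \<longleftrightarrow> (\<forall>\<phi>. (\<forall>y\<in>B. \<phi> y = 0) \<longrightarrow> (\<forall>x\<in>B. app F \<phi> x = 0))"

lemma local_onD: "local_on B F \<Longrightarrow> (\<And>y. y \<in> B \<Longrightarrow> \<phi> y = 0) \<Longrightarrow> x \<in> B \<Longrightarrow> app F \<phi> x = 0"
  by (simp add: local_on_def)

definition trace_on :: "'b set \<Rightarrow> 'b lop \<Rightarrow> complex" where
  "trace_on B F = (\<Sum>x\<in>B. app F (point x) x)"

lemma local_on_add: "local_on B F \<Longrightarrow> local_on B G \<Longrightarrow> local_on B (F + G)"
  by (simp add: local_on_def lop_app)

lemma local_on_0: "local_on B 0"
  by (simp add: local_on_def lop_app)

lemma local_on_1: "local_on B 1"
  by (simp add: local_on_def lop_app)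

lemma local_on_diff: "local_on B F \<Longrightarrow> local_on B G \<Longrightarrow> local_on B (F - G)"
  by (simp add: local_on_def lop_app)

lemma local_on_mult: "local_on B F \<Longrightarrow> local_on B G \<Longrightarrow> local_on B (F * G)"
  by (simp add: local_on_def lop_app)

lemma local_on_osc: "local_on B (osc c)"
  by (simp add: local_on_def osc.rep_eq)

lemma local_on_sum: "(\<And>i. i \<in> S \<Longrightarrow> local_on B (f i)) \<Longrightarrow> local_on B (sum f S)"
  by (induction S rule: infinite_finite_induct) (auto intro: local_on_0 local_on_add)

lemma local_on_prod_list: "(\<And>x. x \<in> set xs \<Longrightarrow> local_on B x) \<Longrightarrow> local_on B (prod_list xs)"
  by (induction xs) (auto intro: local_on_1 local_on_mult)

lemma local_on_feval:
  assumes "p \<in> fcar X" "\<And>x. x \<in> X \<Longrightarrow> local_on B (g x)"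
  shows "local_on B (feval osc g p)"
  using assms(1)
proof (induction p rule: fcar_induct)
  case (mon c xs)
  then show ?case
    unfolding osc.feval_scal_mon
    by (intro local_on_mult local_on_osc local_on_prod_list) (auto intro: assms(2))
qed (auto simp: osc.feval_add intro: local_on_0 local_on_add)

lemma local_on_expand:
  assumes "finite B" "local_on B F" "x \<in> B"
  shows "app F \<phi> x = (\<Sum>y\<in>B. \<phi> y * app F (point y) x)"
proof -
  \<comment> \<open>The function and its expansion in point functions agree on B, and locality makes
    their images agree there.\<close>
  have van: "app F (\<lambda>z. \<phi> z + (- 1) * (\<Sum>y\<in>B. \<phi> y * point y z)) x = 0"
  proof -
    have "\<phi> z + (- 1) * (\<Sum>y\<in>B. \<phi> y * point y z) = 0" if "z \<in> B" for z
    proof -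
      have "(\<Sum>y\<in>B. \<phi> y * point y z) = (\<Sum>y\<in>B. if y = z then \<phi> z else 0)"
        by (intro sum.cong) (auto simp: point_def)
      also have "\<dots> = \<phi> z"
        using assms(1) that by (simp add: sum.delta)
      finally show ?thesis by simp
    qed
    then show ?thesis by (rule local_onD[OF assms(2) _ assms(3)])
  qed
  have "app F (\<lambda>z. \<phi> z + (- 1) * (\<Sum>y\<in>B. \<phi> y * point y z)) x
    = app F \<phi> x + (- 1) * (\<Sum>y\<in>B. \<phi> y * app F (point y) x)"
    by (simp only: app_linear app_sum app_scale)
  with van show ?thesis by simp
qed

lemma trace_on_commute:
  assumes "finite B" "local_on B F" "local_on B G"
  shows "trace_on B (F * G) = trace_on B (G * F)"
proof -
  have "trace_on B (F * G) = (\<Sum>x\<in>B. \<Sum>y\<in>B. app G (point x) y * app F (point y) x)"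
    unfolding trace_on_def
    by (intro sum.cong refl, unfold times_lop.rep_eq) (rule local_on_expand[OF assms(1,2)])
  also have "\<dots> = (\<Sum>y\<in>B. \<Sum>x\<in>B. app F (point y) x * app G (point x) y)"
    by (subst sum.swap) (simp add: mult.commute)
  also have "\<dots> = trace_on B (G * F)"
    unfolding trace_on_def
    by (intro sum.cong refl, unfold times_lop.rep_eq) (rule local_on_expand[OF assms(1,3), symmetric])
  finally show ?thesis .
qed

lemma trace_on_add: "trace_on B (F + G) = trace_on B F + trace_on B G"
  by (simp add: trace_on_def lop_app sum.distrib)

lemma trace_on_uminus: "trace_on B (- F) = - trace_on B F"
  by (simp add: trace_on_def lop_app sum_negf)

text \<open>Cyclicity carries D around a K, and anticommuting with K brings it back with a minus
  sign.\<close>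

lemma trace_anticommutator:
  assumes B: "finite B" and loc: "local_on B D" "local_on B a" "local_on B K"
    and anti: "D * K = - (K * D)"
  shows "trace_on B ((D * a + a * D) * K) = 0"
proof -
  have "trace_on B (D * a * K) = trace_on B (a * K * D)"
    using trace_on_commute[OF B loc(1) local_on_mult[OF loc(2,3)]] by (simp add: mult.assoc)
  also have "a * K * D = - (a * (D * K))" by (simp add: anti mult.assoc)
  finally show ?thesis
    by (simp add: distrib_right trace_on_add trace_on_uminus mult.assoc)
qed

text \<open>
  Right multiplications: they commute with all \<open>cg i\<close> and act transitively, so an operator commuting
  with them has constant diagonal.
\<close>

lift_definition rgt :: "nat \<Rightarrow> nat \<Rightarrow> nat set lop"
  is "\<lambda>n i \<psi> I. (- 1) ^ card {j \<in> I. i < j \<and> j \<le> n} * \<psi> (flip i I)"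
  by (simp add: algebra_simps)

text \<open>The bound by n keeps the counted set finite even for infinite I, so that toggling
  changes its cardinality by one.\<close>

definition rps :: "nat \<Rightarrow> nat \<Rightarrow> nat set \<Rightarrow> complex" where
  "rps n i I = (- 1) ^ card {j \<in> I. i < j \<and> j \<le> n}"

lemma app_rgt: "app (rgt n i) \<psi> I = rps n i I * \<psi> (flip i I)"
  by (simp add: rgt.rep_eq rps_def)

lemma rps_flip: "rps n i (flip j I) = (if i < j \<and> j \<le> n then - rps n i I else rps n i I)"
proof (cases "i < j \<and> j \<le> n")
  case True
  let ?S = "{k \<in> I. i < k \<and> k \<le> n}"
  have fin: "finite ?S" by (rule finite_subset[of _ "{..n}"]) auto
  show ?thesis
  proof (cases "j \<in> I")
    case False
    have "{k \<in> flip j I. i < k \<and> k \<le> n} = insert j ?S" using True False by (auto simp: flip_def)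
    moreover have "j \<notin> ?S" using False by simp
    ultimately show ?thesis using True fin by (simp add: rps_def)
  next
    case j: True
    have "?S = insert j {k \<in> flip j I. i < k \<and> k \<le> n}" using True j by (auto simp: flip_def)
    moreover have "j \<notin> {k \<in> flip j I. i < k \<and> k \<le> n}" using j by (simp add: flip_def)
    ultimately have "card ?S = Suc (card {k \<in> flip j I. i < k \<and> k \<le> n})"
      using fin by (metis card_insert_disjoint finite_insert)
    then show ?thesis using True by (simp add: rps_def)
  qed
next
  case False
  then have "{k \<in> flip j I. i < k \<and> k \<le> n} = {k \<in> I. i < k \<and> k \<le> n}" by (auto simp: flip_def)
  with False show ?thesis by (auto simp: rps_def)
qed

lemma rps_square: "rps n i I * rps n i I = 1"
  by (simp add: rps_def power_mult_distrib[symmetric])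

lemma rgt_cg: "j \<in> {1..n} \<Longrightarrow> rgt n i * cg j = cg j * rgt n i"
  by (rule lop_eqI) (auto simp: lop_app app_rgt cg.rep_eq rps_flip eps_flip flip_commute)

text \<open>Up to a sign that occurs twice, \<open>rgt n i\<close> moves the basis vector I to
  \<open>flip i I\<close>; an operator commuting with it has the same diagonal entry at
  both.\<close>

lemma diagonal_flip:
  assumes "rgt n i * y = y * rgt n i"
  shows "app y (point (flip i I)) (flip i I) = app y (point I) I"
proof -
  have pt: "point (flip i I) = (\<lambda>J. rps n i I * app (rgt n i) (point I) J)"
  proof
    fix J
    have "flip i J = I \<longleftrightarrow> J = flip i I" by auto
    then show "point (flip i I) J = rps n i I * app (rgt n i) (point I) J"
      by (auto simp: point_def app_rgt rps_flip rps_square)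
  qed
  have "app y (point (flip i I)) (flip i I) = rps n i I * app (y * rgt n i) (point I) (flip i I)"
    by (simp add: pt app_scale lop_app)
  also have "y * rgt n i = rgt n i * y" by (rule assms[symmetric])
  also have "rps n i I * app (rgt n i * y) (point I) (flip i I) = app y (point I) I"
    by (simp add: lop_app app_rgt rps_flip mult.assoc[symmetric] rps_square)
  finally show ?thesis .
qed

lemma diagonal_const:
  assumes "\<And>i. i \<in> {1..n} \<Longrightarrow> rgt n i * y = y * rgt n i" "I \<subseteq> {1..n}"
  shows "app y (point I) I = app y (point {}) {}"
proof -
  have "finite I" using assms(2) finite_subset by blast
  then show ?thesis
    using assms(2)
  proof (induction I rule: finite_induct)
    case (insert i I)
    then have "insert i I = flip i I" "i \<in> {1..n}" "I \<subseteq> {1..n}" by (auto simp: flip_def)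
    with insert.IH diagonal_flip[OF assms(1)[of i], of I] show ?case by metis
  qed simp
qed

text \<open>Evaluated at I, a product of distinct generators outside I reads only the coefficient at
  the union; s is the product of the signs \<open>eps\<close> met on the way.\<close>

lemma prod_cg_coefficient:
  assumes "distinct xs" "set xs \<inter> I = {}"
  shows "\<exists>s. s \<noteq> 0 \<and> (\<forall>\<psi>. app (prod_list (map cg xs)) \<psi> I = s * \<psi> (I \<union> set xs))"
  using assms
proof (induction xs arbitrary: I)
  case Nil
  show ?case by (intro exI[of _ 1]) (simp add: lop_app)
next
  case (Cons x xs)
  then have "x \<notin> I" "flip x I = insert x I" by (auto simp: flip_def)
  moreover from Cons have "distinct xs" "set xs \<inter> insert x I = {}" by auto
  from Cons.IH[OF this] obtain s where s: "s \<noteq> 0"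
    "\<forall>\<psi>. app (prod_list (map cg xs)) \<psi> (insert x I) = s * \<psi> (insert x I \<union> set xs)" by auto
  moreover have "eps x I \<noteq> 0" by (simp add: eps_def)
  ultimately show ?case
    by (intro exI[of _ "eps x I * s"]) (simp add: lop_app cg.rep_eq)
qed

text \<open>
  A word \<open>\<beta>\<close> in which each part \<open>a\<close> of \<open>\<Lambda>\<close> fills a contiguous block of \<open>a\<close> positions, starting after
  position \<open>p a\<close>.
\<close>

locale strict_word =
  fixes n :: nat and \<Lambda> :: "nat set" and \<beta> p :: "nat \<Rightarrow> nat"
  assumes Lambda: "finite \<Lambda>" "0 \<notin> \<Lambda>"
    and beta_in: "i \<in> {1..n} \<Longrightarrow> \<beta> i \<in> \<Lambda>"
    and beta_out: "i \<notin> {1..n} \<Longrightarrow> \<beta> i = 0"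
    and block: "a \<in> \<Lambda> \<Longrightarrow> {i \<in> {1..n}. \<beta> i = a} = {p a + 1..p a + a}"
begin

lemma contiguous:
  assumes "1 \<le> i" "i \<le> j" "j \<le> l" "l \<le> n" "\<beta> i = \<beta> l"
  shows "\<beta> j = \<beta> l"
proof -
  have "\<beta> l \<in> \<Lambda>" using assms by (intro beta_in) simp
  note b = block[OF this]
  have "i \<in> {i \<in> {1..n}. \<beta> i = \<beta> l}" "l \<in> {i \<in> {1..n}. \<beta> i = \<beta> l}" using assms by auto
  then have "j \<in> {i \<in> {1..n}. \<beta> i = \<beta> l}" unfolding b using assms(2,3) by auto
  then show ?thesis by simp
qed

lemma block_card: "a \<in> \<Lambda> \<Longrightarrow> card {i \<in> {1..n}. \<beta> i = a} = a"
  by (simp only: block) simp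

text \<open>At i = n the right-hand value is the default 0, which is not a part, so the last
  position always ends a block.\<close>

definition joined :: "nat \<Rightarrow> bool" where
  "joined i \<longleftrightarrow> \<beta> i = \<beta> (Suc i)"

lemma joined_less: "i \<in> {1..n} \<Longrightarrow> joined i \<Longrightarrow> i < n"
proof (rule ccontr)
  assume "i \<in> {1..n}" "joined i" "\<not> i < n"
  then have "\<beta> i = 0" using beta_out[of "Suc i"] by (simp add: joined_def)
  with beta_in[OF \<open>i \<in> {1..n}\<close>] Lambda(2) show False by simp
qed

lemma beta_refl: "joined i \<Longrightarrow> \<beta> \<circ> simple_refl i = \<beta>"
  by (auto simp: joined_def fun_eq_iff simple_refl_def transpose_def)

text \<open>
  One factor for each position, each anticommuting with the Dirac operator. In the product over all
  positions the permutations involved multiply to a cycle on each block, whose only fixed word in the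
  orbit of \<open>\<beta>\<close> is \<open>\<beta>\<close> itself (\<open>fixed_word\<close>).
\<close>

primrec Kop :: "nat \<Rightarrow> ws lop" where
  "Kop 0 = 1"
| "Kop (Suc k) = (if joined (Suc k) then Sop (Suc k) else Rop n (\<beta> (Suc k))) * Kop k"

definition kperm :: "nat \<Rightarrow> nat \<Rightarrow> nat" where
  "kperm k = rec_nat id (\<lambda>k w. (if joined (Suc k) then simple_refl (Suc k) else id) \<circ> w) k"

lemma kperm_0: "kperm 0 = id"
  and kperm_Suc: "kperm (Suc k) = (if joined (Suc k) then simple_refl (Suc k) else id) \<circ> kperm k"
  by (simp_all add: kperm_def)

definition factor_op :: "nat \<Rightarrow> nat set lop" where
  "factor_op i = (if joined i then cg i - cg (Suc i) else label_sum n (\<beta> i) \<beta>)"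

primrec factor_prod :: "nat \<Rightarrow> nat set lop" where
  "factor_prod 0 = 1"
| "factor_prod (Suc k) = factor_op (Suc k) * factor_prod k"

text \<open>Every permutation in the product fixes \<beta>, since joined positions carry equal
  labels; the Clifford part at \<beta> is therefore the plain product of the local factors.\<close>

lemma Kop_crossed: "\<exists>f. Kop k = crossed f (kperm k) \<and> f \<beta> = factor_prod k"
proof (induction k)
  case 0
  show ?case
    by (intro exI[of _ "\<lambda>b. 1"] conjI) (simp_all only: kperm_0 crossed_1 Kop.simps factor_prod.simps)
next
  case (Suc k)
  then obtain f where f: "Kop k = crossed f (kperm k)" "f \<beta> = factor_prod k" by blast
  show ?case
  proof (cases "joined (Suc k)")
    case True
    then show ?thesis
      unfolding kperm_Suc if_P[OF True] using f beta_refl[OF True]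
      by (intro exI[of _ "\<lambda>b. (cg (Suc k) - cg (Suc (Suc k))) * f (b \<circ> simple_refl (Suc k))"])
        (simp add: Sop_def crossed_mult factor_op_def comp_def)
  next
    case False
    then show ?thesis
      unfolding kperm_Suc if_not_P[OF False] using f by (intro exI[of _ "\<lambda>b. label_sum n (\<beta> (Suc k)) b * f b"]) (simp add: Rop_def crossed_mult factor_op_def comp_def)
  qed
qed

lemma kperm_permutes: "k \<le> n \<Longrightarrow> kperm k permutes {1..n}"
proof (induction k)
  case (Suc k)
  then have "(if joined (Suc k) then simple_refl (Suc k) else id) permutes {1..n}"
    using joined_less[of "Suc k"] by (auto intro: simple_refl_permutes permutes_id)
  with Suc show ?case
    unfolding kperm_Suc by (intro permutes_compose) simp_all
next
  case 0
  show ?case unfolding kperm_0 by (rule permutes_id)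
qed

lemma Dop_Kop: "k \<le> n \<Longrightarrow> Dop n * Kop k = (- 1) ^ k * (Kop k * Dop n)"
proof (induction k)
  case (Suc k)
  define Y where "Y = (if joined (Suc k) then Sop (Suc k) else Rop n (\<beta> (Suc k)))"
  have Y: "Dop n * Y = - (Y * Dop n)"
    using Suc.prems joined_less[of "Suc k"] by (auto simp: Y_def intro!: Dop_Sop Dop_Rop)
  have sgn: "Y * ((- 1) ^ k * Z) = (- 1) ^ k * (Y * Z)" for Z
    by (cases "even k") simp_all
  have "Dop n * Kop (Suc k) = (Dop n * Y) * Kop k"
    by (simp add: Y_def mult.assoc)
  also have "\<dots> = - (Y * (Dop n * Kop k))" by (simp add: Y mult.assoc)
  also have "\<dots> = - ((- 1) ^ k * (Y * (Kop k * Dop n)))" using Suc by (simp add: sgn)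
  also have "\<dots> = (- 1) ^ Suc k * (Kop (Suc k) * Dop n)"
    by (simp add: Y_def mult.assoc)
  finally show ?case .
qed simp

lemma kperm_above: "k < i \<Longrightarrow> kperm k (Suc i) = Suc i"
  by (induction k) (auto simp: simple_refl_def kperm_0 kperm_Suc)

text \<open>Factors before s_i do not reach i+1, the factor s_i sends it to i, and later factors
  leave i alone. The whole product thus shifts each block down by one.\<close>

lemma kperm_joined:
  assumes "1 \<le> i" "joined i" "i \<le> k"
  shows "kperm k (Suc i) = i"
  using assms(3)
proof (induction k rule: dec_induct)
  case base
  from assms(1) obtain m where m: "i = Suc m" by (cases i) auto
  then have "kperm m (Suc i) = Suc i" by (intro kperm_above) simp
  then show ?case using assms(2) by (simp add: m simple_refl_def kperm_Suc)
next
  case (step k)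
  then show ?case by (auto simp: simple_refl_def kperm_Suc)
qed

text \<open>A fixed word is constant on the blocks of \<beta>, so it arises by permuting the labels
  with some g. The block of a has a positions, while g a occurs g a times in any rearrangement of
  \<beta>; hence g a = a. This is the place where equal parts would give further fixed
  words.\<close>

lemma fixed_word:
  assumes v: "v permutes {1..n}" and b: "b = \<beta> \<circ> v" and fixed: "b \<circ> kperm n = b"
  shows "b = \<beta>"
proof -
  have b_in: "b i \<in> \<Lambda>" if "i \<in> {1..n}" for i
    using that permutes_in_image[OF v, of i] by (simp add: b beta_in)
  have step: "b (Suc i) = b i" if "1 \<le> i" "joined i" "i \<le> n" for i
    using fun_cong[OF fixed, of "Suc i"] kperm_joined[OF that] by simp
  define g where "g a = b (p a + 1)" for a
  have g: "b i = g (\<beta> i)" if i: "i \<in> {1..n}" for i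
  proof -
    define a where "a = \<beta> i"
    have a: "a \<in> \<Lambda>" using i by (simp add: a_def beta_in)
    have run: "b (p a + 1 + k) = g a" if "p a + 1 + k \<le> p a + a" for k
      using that
    proof (induction k)
      case (Suc k)
      have "p a + 1 + k \<in> {p a + 1..p a + a}" "Suc (p a + 1 + k) \<in> {p a + 1..p a + a}"
        using Suc.prems by auto
      then have "\<beta> (p a + 1 + k) = a" "\<beta> (Suc (p a + 1 + k)) = a" "p a + 1 + k \<in> {1..n}"
        unfolding block[OF a, symmetric] by auto
      then have "b (Suc (p a + 1 + k)) = b (p a + 1 + k)"
        by (intro step) (auto simp: joined_def)
      with Suc show ?case by simp
    qed (simp add: g_def)
    have "i \<in> {p a + 1..p a + a}"
      unfolding block[OF a, symmetric] using i by (simp add: a_def)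
    moreover define k where "k = i - (p a + 1)"
    ultimately have i': "i = p a + 1 + k" and le: "p a + 1 + k \<le> p a + a" by auto
    from run[OF le] show ?thesis by (simp only: i'[symmetric] a_def[symmetric])
  qed
  have ne: "\<exists>i\<in>{1..n}. \<beta> i = a" if "a \<in> \<Lambda>" for a
  proof -
    have "a \<noteq> 0" using that Lambda(2) by metis
    then have "{i \<in> {1..n}. \<beta> i = a} \<noteq> {}" using block[OF that] by simp
    then show ?thesis by blast
  qed
  have "g ` \<Lambda> = \<Lambda>"
  proof
    show "g ` \<Lambda> \<subseteq> \<Lambda>"
    proof
      fix c assume "c \<in> g ` \<Lambda>"
      then obtain a where a: "a \<in> \<Lambda>" "c = g a" by blast
      obtain i where i: "i \<in> {1..n}" "\<beta> i = a" using ne[OF a(1)] by blast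
      then have "b i = c" using a g by simp
      then show "c \<in> \<Lambda>" using b_in[OF i(1)] by simp
    qed
    show "\<Lambda> \<subseteq> g ` \<Lambda>"
    proof
      fix c assume "c \<in> \<Lambda>"
      then obtain i where i: "i \<in> {1..n}" "\<beta> i = c" using ne by blast
      then have "i \<in> v ` {1..n}" by (simp only: permutes_image[OF v])
      then obtain j where j: "i = v j" "j \<in> {1..n}" by blast
      then have "c = g (\<beta> j)" using i g[OF j(2)] by (simp add: b)
      then show "c \<in> g ` \<Lambda>" using beta_in[OF j(2)] by blast
    qed
  qed
  then have inj: "inj_on g \<Lambda>"
    using Lambda(1) by (intro finite_surj_inj) auto
  have "g a = a" if a: "a \<in> \<Lambda>" for a
  proof -
    have ga: "g a \<in> \<Lambda>" using a \<open>g ` \<Lambda> = \<Lambda>\<close> by blast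
    have "{i \<in> {1..n}. b i = g a} = {i \<in> {1..n}. \<beta> i = a}"
    proof (rule Collect_cong)
      fix i
      show "(i \<in> {1..n} \<and> b i = g a) = (i \<in> {1..n} \<and> \<beta> i = a)"
      proof (cases "i \<in> {1..n}")
        case True
        then show ?thesis
          using g[OF True] inj_on_eq_iff[OF inj beta_in[OF True] a] by simp
      qed auto
    qed
    then have "card {i \<in> {1..n}. b i = g a} = a" by (simp only: block_card[OF a])
    moreover have "v ` {i \<in> {1..n}. b i = g a} = {i \<in> {1..n}. \<beta> i = g a}"
    proof
      show "v ` {i \<in> {1..n}. b i = g a} \<subseteq> {i \<in> {1..n}. \<beta> i = g a}"
        using permutes_in_image[OF v] by (auto simp: b)
      show "{i \<in> {1..n}. \<beta> i = g a} \<subseteq> v ` {i \<in> {1..n}. b i = g a}"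
      proof
        fix i assume i: "i \<in> {i \<in> {1..n}. \<beta> i = g a}"
        then have "i \<in> v ` {1..n}" by (simp add: permutes_image[OF v])
        then obtain j where "i = v j" "j \<in> {1..n}" by blast
        with i show "i \<in> v ` {i \<in> {1..n}. b i = g a}" by (auto simp: b)
      qed
    qed
    then have "card {i \<in> {1..n}. b i = g a} = g a"
      using block_card[OF ga] card_image[OF permutes_inj_on[OF v], of "{i \<in> {1..n}. b i = g a}"] by simp
    ultimately show ?thesis by simp
  qed
  then have "b i = \<beta> i" if "i \<in> {1..n}" for i
    using that g beta_in by simp
  moreover have "b i = \<beta> i" if "i \<notin> {1..n}" for i
    using permutes_not_in[OF v that] by (simp add: b)
  ultimately show ?thesis by blast
qed

end

lemma card_flip: "finite I \<Longrightarrow> card (flip i I) = (if i \<in> I then card I - 1 else Suc (card I))"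
  by (simp add: flip_def)

lemma finite_flip [simp]: "finite (flip i I) \<longleftrightarrow> finite I"
  by (simp add: flip_def)

context strict_word
begin

text \<open>
  The invariant of the induction computing the top-degree component of a partial product of the
  Clifford factors applied to the vacuum: it is proportional to the alternating sum over the positions
  of the last block of the monomials omitting one position.
\<close>

definition tail_block :: "nat \<Rightarrow> nat set" where
  "tail_block k = {j \<in> {1..Suc k}. \<beta> j = \<beta> (Suc k)}"

definition top_pattern :: "nat \<Rightarrow> (nat set \<Rightarrow> complex) \<Rightarrow> complex \<Rightarrow> bool" where
  "top_pattern k \<psi> \<kappa> \<longleftrightarrow> (\<forall>I. finite I \<longrightarrow> k < card I \<longrightarrow> \<psi> I = 0) \<and>
     (\<forall>j\<in>tail_block k. \<psi> ({1..Suc k} - {j}) = \<kappa> * (- 1) ^ j) \<and>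
     (\<forall>I. finite I \<longrightarrow> card I = k \<longrightarrow> (\<forall>j\<in>tail_block k. I \<noteq> {1..Suc k} - {j}) \<longrightarrow> \<psi> I = 0)"

lemma tail_block_bounds: "j \<in> tail_block k \<Longrightarrow> 1 \<le> j \<and> j \<le> Suc k"
  by (auto simp: tail_block_def)

text \<open>Only creation raises the degree. The generator at k+2 is added to every monomial of the
  pattern, and the one at k+1 to the monomial omitting k+1, which yields the monomial omitting k+2.
  Taking the difference of the two generators keeps the signs alternating.\<close>

lemma top_pattern_joined:
  assumes "joined (Suc k)" and top: "top_pattern k \<psi> \<kappa>"
  shows "top_pattern (Suc k) (app (cg (Suc k) - cg (Suc (Suc k))) \<psi>) (- ((- 1) ^ k * \<kappa>))"
proof -
  let ?m = "Suc k"
  have big: "\<psi> I = 0" if "finite I" "k < card I" for I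
    using top that by (simp add: top_pattern_def)
  have val: "\<psi> ({1..?m} - {j}) = \<kappa> * (- 1) ^ j" if "j \<in> tail_block k" for j
    using top that by (simp add: top_pattern_def)
  have zero: "\<psi> I = 0" if "finite I" "card I = k" "\<And>j. j \<in> tail_block k \<Longrightarrow> I \<noteq> {1..?m} - {j}" for I
    using top that by (simp add: top_pattern_def)
  have app: "app (cg ?m - cg (Suc ?m)) \<psi> I = eps ?m I * \<psi> (flip ?m I) - eps (Suc ?m) I * \<psi> (flip (Suc ?m) I)" for I
    by (simp add: lop_app cg.rep_eq)
  have tb: "tail_block ?m = insert (Suc ?m) (tail_block k)"
    using assms(1) by (auto simp: tail_block_def joined_def le_Suc_eq)
  have m_tb: "?m \<in> tail_block k" by (simp add: tail_block_def)
  have epsm: "eps ?m {1..?m} = (- 1) ^ k"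
  proof -
    have "{x \<in> {1..?m}. x < ?m} = {1..k}" by auto
    then show ?thesis by (simp add: eps_def)
  qed
  show ?thesis
    unfolding top_pattern_def
  proof (intro conjI allI impI ballI)
    fix I :: "nat set" assume I: "finite I" "?m < card I"
    then have "k < card (flip ?m I)" "k < card (flip (Suc ?m) I)" by (auto simp: card_flip)
    with I(1) show "app (cg ?m - cg (Suc ?m)) \<psi> I = 0" by (simp add: app big)
  next
    fix j assume "j \<in> tail_block ?m"
    then consider "j = Suc ?m" | "j \<in> tail_block k" "j \<noteq> Suc ?m" by (auto simp: tb)
    then show "app (cg ?m - cg (Suc ?m)) \<psi> ({1..Suc ?m} - {j}) = - ((- 1) ^ k * \<kappa>) * (- 1) ^ j"
    proof cases
      case 1
      then have I: "{1..Suc ?m} - {j} = {1..?m}" by auto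
      have "flip ?m {1..?m} = {1..?m} - {?m}" "flip (Suc ?m) {1..?m} = {1..Suc ?m}"
        by (auto simp: flip_def)
      then show ?thesis
        unfolding I app epsm by (simp add: val[OF m_tb] big 1)
    next
      case 2
      have j: "1 \<le> j" "j \<le> ?m" using tail_block_bounds[OF 2(1)] by auto
      let ?I = "{1..Suc ?m} - {j}"
      have "flip (Suc ?m) ?I = {1..?m} - {j}" using j by (auto simp: flip_def)
      moreover have "eps (Suc ?m) ?I = (- 1) ^ k"
      proof -
        have "{x \<in> ?I. x < Suc ?m} = {1..?m} - {j}" by auto
        moreover have "card ({1..?m} - {j}) = k" using j by (subst card_Diff_singleton) auto
        ultimately show ?thesis by (simp add: eps_def)
      qed
      moreover have "\<psi> (flip ?m ?I) = 0"
      proof (cases "j = ?m")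
        case True
        then have "flip ?m ?I = {1..Suc ?m}" by (auto simp: flip_def)
        then show ?thesis by (simp add: big)
      next
        case False
        then have f: "flip ?m ?I = ?I - {?m}" using j by (auto simp: flip_def)
        have "card (?I - {?m}) = k"
          using j False by (subst card_Diff_singleton, simp, subst card_Diff_singleton) auto
        moreover have mem: "Suc ?m \<in> ?I - {?m}" using j by auto
        have "?I - {?m} \<noteq> {1..?m} - {j'}" for j'
        proof
          assume "?I - {?m} = {1..?m} - {j'}"
          with mem have "Suc ?m \<in> {1..?m} - {j'}" by (simp only:)
          then show False by simp
        qed
        ultimately show ?thesis unfolding f by (intro zero) auto
      qed
      ultimately show ?thesis by (simp add: app val[OF 2(1)])
    qed
  next
    fix I :: "nat set"
    assume I: "finite I" "card I = ?m" and ne: "\<forall>j\<in>tail_block ?m. I \<noteq> {1..Suc ?m} - {j}"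
    have "\<psi> (flip ?m I) = 0"
    proof (cases "?m \<in> I")
      case False
      then show ?thesis using I by (intro big) (auto simp: card_flip)
    next
      case True
      have "flip ?m I \<noteq> {1..?m} - {j}" if j: "j \<in> tail_block k" for j
      proof
        assume eq: "flip ?m I = {1..?m} - {j}"
        have "j = ?m"
        proof (rule ccontr)
          assume "j \<noteq> ?m"
          then have "?m \<in> flip ?m I" unfolding eq by simp
          with True show False by (simp add: flip_def)
        qed
        have "I = insert ?m (flip ?m I)" using True by (simp add: flip_def insert_absorb)
        also have "\<dots> = insert ?m ({1..?m} - {?m})" by (simp only: eq \<open>j = ?m\<close>)
        also have "\<dots> = {1..Suc ?m} - {Suc ?m}" by auto
        finally have "I = {1..Suc ?m} - {Suc ?m}" .
        with ne show False by (simp add: tb)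
      qed
      then show ?thesis using I True by (intro zero) (auto simp: card_flip)
    qed
    moreover have "\<psi> (flip (Suc ?m) I) = 0"
    proof (cases "Suc ?m \<in> I")
      case False
      then show ?thesis using I by (intro big) (auto simp: card_flip)
    next
      case True
      have "flip (Suc ?m) I \<noteq> {1..?m} - {j}" if j: "j \<in> tail_block k" for j
      proof
        assume eq: "flip (Suc ?m) I = {1..?m} - {j}"
        have "I = insert (Suc ?m) (flip (Suc ?m) I)" using True by (simp add: flip_def insert_absorb)
        also have "\<dots> = {1..Suc ?m} - {j}"
          unfolding eq using tail_block_bounds[OF j] by auto
        finally show False using ne j by (simp add: tb)
      qed
      then show ?thesis using I True by (intro zero) (auto simp: card_flip)
    qed
    ultimately show "app (cg ?m - cg (Suc ?m)) \<psi> I = 0" by (simp add: app)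
  qed
qed

lemma app_label_sum: "app (label_sum n a b) \<psi> I = (\<Sum>i\<in>{i \<in> {1..n}. b i = a}. eps i I * \<psi> (flip i I))"
proof -
  have "app (label_sum n a b) \<psi> I = (\<Sum>i=1..n. if b i = a then eps i I * \<psi> (flip i I) else 0)"
    unfolding label_sum_def app_sum_lop by (intro sum.cong refl) (simp add: cg.rep_eq lop_app)
  also have "\<dots> = (\<Sum>i\<in>{i \<in> {1..n}. b i = a}. eps i I * \<psi> (flip i I))"
    by (rule sum.inter_filter[symmetric]) simp
  finally show ?thesis .
qed

text \<open>At the end of a block, the sum of its generators fills the omitted position of every
  monomial, and all of them become the full set. The creation sign times the alternating sign is -1
  throughout, so the terms add up to a multiple of the block size instead of cancelling.\<close>

lemma top_pattern_end:
  assumes "\<not> joined (Suc k)" "Suc k \<le> n" and top: "top_pattern k \<psi> \<kappa>"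
  shows "top_pattern (Suc k) (app (label_sum n (\<beta> (Suc k)) \<beta>) \<psi>)
    ((- 1) ^ Suc k * (\<kappa> * of_nat (card (tail_block k))))"
proof -
  let ?m = "Suc k"
  have big: "\<psi> I = 0" if "finite I" "k < card I" for I
    using top that by (simp add: top_pattern_def)
  have val: "\<psi> ({1..?m} - {j}) = \<kappa> * (- 1) ^ j" if "j \<in> tail_block k" for j
    using top that by (simp add: top_pattern_def)
  have zero: "\<psi> I = 0" if "finite I" "card I = k" "\<And>j. j \<in> tail_block k \<Longrightarrow> I \<noteq> {1..?m} - {j}" for I
    using top that by (simp add: top_pattern_def)
  have ne: "\<beta> i \<noteq> \<beta> ?m" if "?m < i" "i \<le> n" for i
    using contiguous[of ?m "Suc ?m" i] that assms(1) by (auto simp: joined_def)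
  have blk: "{i \<in> {1..n}. \<beta> i = \<beta> ?m} = tail_block k"
    using ne assms(2) by (auto simp: tail_block_def not_le[symmetric])
  have app: "app (label_sum n (\<beta> ?m) \<beta>) \<psi> I = (\<Sum>i\<in>tail_block k. eps i I * \<psi> (flip i I))" for I
    unfolding app_label_sum blk ..
  \<comment> \<open>Position k+2 opens a new block, or lies beyond n and carries the default label
    0.\<close>
  have tb: "tail_block ?m = {Suc ?m}"
  proof -
    have "\<beta> j \<noteq> \<beta> (Suc ?m)" if "1 \<le> j" "j \<le> ?m" for j
    proof (cases "?m = n")
      case True
      then have "\<beta> (Suc ?m) = 0" by (intro beta_out) auto
      moreover have "\<beta> j \<in> \<Lambda>" using that True by (intro beta_in) auto
      ultimately show ?thesis using Lambda(2) by metis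
    next
      case False
      then show ?thesis
        using contiguous[of j ?m "Suc ?m"] that assms by (auto simp: joined_def)
    qed
    then show ?thesis by (auto simp: tail_block_def le_Suc_eq)
  qed
  show ?thesis
    unfolding top_pattern_def
  proof (intro conjI allI impI ballI)
    fix I :: "nat set" assume I: "finite I" "?m < card I"
    have "\<psi> (flip i I) = 0" for i
      using I by (intro big) (auto simp: card_flip)
    then show "app (label_sum n (\<beta> ?m) \<beta>) \<psi> I = 0" by (simp add: app)
  next
    fix j assume "j \<in> tail_block ?m"
    then have j: "j = Suc ?m" by (simp add: tb)
    have I: "{1..Suc ?m} - {j} = {1..?m}" by (auto simp: j)
    have "eps i {1..?m} * \<psi> (flip i {1..?m}) = - \<kappa>" if i: "i \<in> tail_block k" for i
    proof -
      note b = tail_block_bounds[OF i]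
      obtain i' where i': "i = Suc i'" using b by (cases i) auto
      have "{x \<in> {1..?m}. x < i} = {1..i'}" using b i' by auto
      then have e: "eps i {1..?m} = (- 1) ^ i'" by (simp add: eps_def)
      have fl: "flip i {1..?m} = {1..?m} - {i}" using b by (auto simp: flip_def)
      have "(- 1) ^ i' * (\<kappa> * (- 1) ^ Suc i') = - \<kappa>"
        by (cases "even i'") simp_all
      then show ?thesis unfolding e fl val[OF i] unfolding i' .
    qed
    then have f1: "app (label_sum n (\<beta> ?m) \<beta>) \<psi> {1..?m} = - (\<kappa> * of_nat (card (tail_block k)))"
      by (simp add: app mult.commute)
    have f2: "((- 1 :: complex) ^ ?m * x) * (- 1) ^ Suc ?m = - x" for x
      by (cases "even k") simp_all
    show "app (label_sum n (\<beta> ?m) \<beta>) \<psi> ({1..Suc ?m} - {j}) =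
        (- 1) ^ ?m * (\<kappa> * of_nat (card (tail_block k))) * (- 1) ^ j"
      unfolding I unfolding j f1 f2 ..
  next
    fix I :: "nat set"
    assume I: "finite I" "card I = ?m" and ne: "\<forall>j\<in>tail_block ?m. I \<noteq> {1..Suc ?m} - {j}"
    have ne': "I \<noteq> {1..?m}" using ne by (auto simp: tb)
    have "\<psi> (flip i I) = 0" if i: "i \<in> tail_block k" for i
    proof (cases "i \<in> I")
      case False
      then show ?thesis using I by (intro big) (auto simp: card_flip)
    next
      case True
      have "flip i I \<noteq> {1..?m} - {j}" if j: "j \<in> tail_block k" for j
      proof
        assume eq: "flip i I = {1..?m} - {j}"
        have "i \<notin> flip i I" using True by (simp add: flip_def)
        then have "i = j" using eq tail_block_bounds[OF i] by auto
        moreover have "I = insert i (flip i I)" using True by (simp add: flip_def insert_absorb)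
        ultimately have "I = insert j ({1..?m} - {j})" using eq by metis
        then have "I = {1..?m}" using tail_block_bounds[OF j] by auto
        with ne' show False by simp
      qed
      then show ?thesis using I True by (intro zero) (auto simp: card_flip)
    qed
    then show "app (label_sum n (\<beta> ?m) \<beta>) \<psi> I = 0" by (simp add: app)
  qed
qed

lemma top_coefficient: "k \<le> n \<Longrightarrow> \<exists>\<kappa>. \<kappa> \<noteq> 0 \<and> top_pattern k (app (factor_prod k) (point {})) \<kappa>"
proof (induction k)
  case 0
  have "tail_block 0 = {1}" by (auto simp: tail_block_def One_nat_def)
  \<comment> \<open>The pattern at the empty set reads \<kappa> times (-1)^1, and the vacuum has
    coefficient 1 there.\<close>
  then have "top_pattern 0 (app (factor_prod 0) (point {})) (- 1)"
    by (auto simp: top_pattern_def lop_app point_def One_nat_def)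
  then show ?case by (intro exI[of _ "- 1"]) simp
next
  case (Suc k)
  then obtain \<kappa> where k: "\<kappa> \<noteq> 0" "top_pattern k (app (factor_prod k) (point {})) \<kappa>" by auto
  show ?case
  proof (cases "joined (Suc k)")
    case True
    from top_pattern_joined[OF True k(2)] k(1) True show ?thesis
      by (intro exI[of _ "- ((- 1) ^ k * \<kappa>)"]) (simp add: factor_op_def lop_app)
  next
    case False
    have "Suc k \<in> tail_block k" by (simp add: tail_block_def)
    moreover have "finite (tail_block k)" by (simp add: tail_block_def)
    ultimately have "card (tail_block k) \<noteq> 0" by auto
    with top_pattern_end[OF False Suc.prems k(2)] k(1) False show ?thesis
      by (intro exI[of _ "(- 1) ^ Suc k * (\<kappa> * of_nat (card (tail_block k)))"]) (simp add: factor_op_def lop_app)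
  qed
qed

lemma factor_prod_top_nonzero: "app (factor_prod n) (point {}) {1..n} \<noteq> 0"
proof -
  obtain \<kappa> where k: "\<kappa> \<noteq> 0" "top_pattern n (app (factor_prod n) (point {})) \<kappa>"
    using top_coefficient[of n] by blast
  \<comment> \<open>The omitted position is the fictitious n+1, so the pattern is read off at the
    full set of positions.\<close>
  have "Suc n \<in> tail_block n" by (simp add: tail_block_def)
  then have "app (factor_prod n) (point {}) ({1..Suc n} - {Suc n}) = \<kappa> * (- 1) ^ Suc n"
    using k(2) unfolding top_pattern_def by blast
  moreover have "{1..Suc n} - {Suc n} = {1..n}" by auto
  ultimately show ?thesis using k(1) by simp
qed

lemma cvol_factor_prod_nonzero: "app (cvol n * factor_prod n) (point {}) {} \<noteq> 0"
proof -
  have "{} \<union> set [1..<Suc n] = {1..n}" by (simp only: set_upt atLeastLessThanSuc_atLeastAtMost) simp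
  moreover have "distinct [1..<Suc n]" "set [1..<Suc n] \<inter> {} = {}" by (rule distinct_upt, blast)
  ultimately obtain s where "s \<noteq> 0" "\<forall>\<psi>. app (cvol n) \<psi> {} = s * \<psi> {1..n}"
    unfolding cvol_def using prod_cg_coefficient by metis
  with factor_prod_top_nonzero show ?thesis by (simp add: lop_app)
qed

section \<open>The trace over the rearrangements of the word\<close>

definition orbit :: "(nat \<Rightarrow> nat) set" where
  "orbit = (\<lambda>v. \<beta> \<circ> v) ` {v. v permutes {1..n}}"

definition idx :: "ws set" where
  "idx = orbit \<times> Pow {1..n}"

lemma finite_idx: "finite idx"
  by (simp add: idx_def orbit_def finite_permutations)

lemma orbit_comp: "b \<in> orbit \<Longrightarrow> w permutes {1..n} \<Longrightarrow> b \<circ> w \<in> orbit"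
proof -
  assume "b \<in> orbit" and w: "w permutes {1..n}"
  then obtain v where "v permutes {1..n}" "b = \<beta> \<circ> v" by (auto simp: orbit_def)
  then have "b \<circ> w = \<beta> \<circ> (v \<circ> w)" "v \<circ> w permutes {1..n}"
    using w by (simp_all only: comp_assoc permutes_compose)
  then show "b \<circ> w \<in> orbit" unfolding orbit_def by blast
qed

lemma beta_orbit: "\<beta> \<in> orbit"
  unfolding orbit_def by (rule image_eqI[of _ _ id]) (simp_all only: comp_id mem_Collect_eq permutes_id)

lemma local_on_crossed:
  assumes "w permutes {1..n}" "\<And>b. local_on (Pow {1..n}) (f b)"
  shows "local_on idx (crossed f w)"
  unfolding local_on_def
proof (intro allI impI ballI)
  fix \<phi> :: "ws \<Rightarrow> complex" and x assume z: "\<forall>y\<in>idx. \<phi> y = 0" and "x \<in> idx"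
  then obtain b I where x: "x = (b, I)" "b \<in> orbit" "I \<in> Pow {1..n}" by (auto simp: idx_def)
  have "\<phi> (b \<circ> w, J) = 0" if "J \<in> Pow {1..n}" for J
    using z that orbit_comp[OF x(2) assms(1)] by (simp add: idx_def)
  then show "app (crossed f w) \<phi> x = 0"
    unfolding x(1) app_crossed by (rule local_onD[OF assms(2) _ x(3)])
qed

lemma local_on_cg: "i \<in> {1..n} \<Longrightarrow> local_on (Pow {1..n}) (cg i)"
proof -
  assume i: "i \<in> {1..n}"
  then have "flip i I \<in> Pow {1..n}" if "I \<in> Pow {1..n}" for I using that by (auto simp: flip_def)
  then show ?thesis by (simp add: local_on_def cg.rep_eq)
qed

lemma local_on_gH: "y \<in> hecke_gens n \<Longrightarrow> local_on idx (gH n y)"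
  by (auto simp: hecke_gens_def gH_def Xop_def Wop_def
      intro!: local_on_sum local_on_crossed local_on_osc local_on_1 permutes_swap_id)

lemma local_on_Cop: "i \<in> {1..n} \<Longrightarrow> local_on idx (Cop i)"
  unfolding Cop_def by (intro local_on_crossed permutes_id local_on_cg)

lemma local_on_opHC:
  assumes "x \<in> carrier (HC n)"
  shows "local_on idx (opHC n x)"
proof -
  have H: "local_on idx (opH n x)" if x: "x \<in> carrier (hecke n)" for x
  proof -
    obtain q where q: "q \<in> fcar (hecke_gens n)" "x = H.cl n q" using x by (rule hecke_cases)
    have "local_on idx (feval osc (gH n) q)"
      by (rule local_on_feval[OF q(1)]) (rule local_on_gH)
    then show ?thesis using q by (simp add: opH_cl)
  qed
  have C: "local_on idx (opC n y)" if y: "y \<in> carrier (cliff n)" for y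
  proof -
    obtain q where q: "q \<in> fcar (cliff_gens n)" "y = C.cl n q" using y by (rule cliff_cases)
    have "local_on idx (feval osc Cop q)"
      by (rule local_on_feval[OF q(1)], rule local_on_Cop) (simp add: cliff_gens_def)
    then show ?thesis using q by (simp add: opC_cl)
  qed
  obtain p where p: "p \<in> fcar (carrier (hecke n) \<times> carrier (cliff n))" "x = HC.cl n p"
    using assms by (rule HC_cases)
  have "local_on idx (feval osc (gHC n) p)"
    by (rule local_on_feval[OF p(1)]) (auto simp: gHC_def intro!: local_on_mult H C)
  then show ?thesis using p by (simp add: opHC_cl)
qed

text \<open>
  The Dirac operator commutes with \<open>Kop n\<close> up to the sign \<open>(- 1) ^ n\<close>, and with the Clifford volume
  element up to \<open>(- 1) ^ (n + 1)\<close>.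
\<close>

definition Nop :: "ws lop" where
  "Nop = Vop n * Kop n"

lemma local_on_label_sum: "local_on (Pow {1..n}) (label_sum n a b)"
  unfolding label_sum_def by (intro local_on_sum) (auto intro: local_on_cg local_on_0)

lemma local_on_Kop: "k \<le> n \<Longrightarrow> local_on idx (Kop k)"
proof (induction k)
  case (Suc k)
  have "local_on idx (Sop (Suc k))" if "joined (Suc k)"
  proof -
    have "Suc k < n" using that Suc.prems joined_less[of "Suc k"] by auto
    then show ?thesis
      unfolding Sop_def by (intro local_on_crossed simple_refl_permutes local_on_diff local_on_cg) auto
  qed
  moreover have "local_on idx (Rop n a)" for a
    unfolding Rop_def by (intro local_on_crossed permutes_id local_on_label_sum)
  ultimately show ?case using Suc by (simp add: local_on_mult)
qed (simp add: local_on_1)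

lemma local_on_Nop: "local_on idx Nop"
  unfolding Nop_def Vop_def cvol_def
  by (intro local_on_mult local_on_Kop local_on_crossed permutes_id local_on_prod_list order_refl)
    (auto intro!: local_on_cg)

lemma Dop_Nop: "Dop n * Nop = - (Nop * Dop n)"
proof -
  have sgn: "x * ((- 1) ^ k * y) = (- 1) ^ k * (x * y)" for x y :: "ws lop" and k
    by (cases "even k") simp_all
  have "Dop n * Nop = (Dop n * Vop n) * Kop n" by (simp only: Nop_def mult.assoc)
  also have "\<dots> = (- 1) ^ (n + 1) * (Vop n * (Dop n * Kop n))" by (simp only: Dop_Vop mult.assoc)
  also have "\<dots> = (- 1) ^ (n + 1) * (Vop n * ((- 1) ^ n * (Kop n * Dop n)))"
    by (simp only: Dop_Kop[OF order_refl])
  also have "Vop n * ((- 1) ^ n * (Kop n * Dop n)) = (- 1) ^ n * (Vop n * (Kop n * Dop n))"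
    by (rule sgn)
  also have "(- 1) ^ (n + 1) * ((- 1) ^ n * (Vop n * (Kop n * Dop n))) = - (Nop * Dop n)"
    by (cases "even n") (simp_all add: Nop_def mult.assoc)
  finally show ?thesis .
qed

lemma rgt_prod_list:
  assumes "\<And>x. x \<in> set xs \<Longrightarrow> rgt n i * x = x * rgt n i"
  shows "rgt n i * prod_list xs = prod_list xs * rgt n i"
  using assms
proof (induction xs)
  case (Cons x xs)
  have "rgt n i * (x * prod_list xs) = x * (rgt n i * prod_list xs)"
    using Cons.prems[of x] by (simp add: mult.assoc[symmetric])
  with Cons show ?case by (simp add: mult.assoc)
qed simp

lemma rgt_factor_prod: "k \<le> n \<Longrightarrow> rgt n i * factor_prod k = factor_prod k * rgt n i"
proof (induction k)
  case (Suc k)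
  have "rgt n i * factor_op (Suc k) = factor_op (Suc k) * rgt n i"
  proof (cases "joined (Suc k)")
    case True
    then have "Suc k < n" using Suc.prems joined_less[of "Suc k"] by auto
    then show ?thesis using True by (simp add: factor_op_def algebra_simps rgt_cg)
  next
    case False
    have "rgt n i * label_sum n a b = label_sum n a b * rgt n i" for a b
      unfolding label_sum_def sum_distrib_left sum_distrib_right
    proof (rule sum.cong[OF refl])
      fix j assume "j \<in> {1..n}"
      from rgt_cg[OF this] show "rgt n i * (if b j = a then cg j else 0) = (if b j = a then cg j else 0) * rgt n i"
        by simp
    qed
    then show ?thesis using False by (simp add: factor_op_def)
  qed
  then have "rgt n i * (factor_op (Suc k) * factor_prod k) = factor_op (Suc k) * (rgt n i * factor_prod k)"
    by (simp add: mult.assoc[symmetric])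
  with Suc show ?case by (simp add: mult.assoc)
qed simp

text \<open>A nonzero diagonal entry at (b, I) requires a fixed word, hence b = \<beta>. There the
  Clifford part commutes with the right multiplications, so all 2^n entries equal the one at the
  vacuum.\<close>

lemma trace_Nop: "trace_on idx Nop \<noteq> 0"
proof -
  obtain f where f: "Kop n = crossed f (kperm n)" "f \<beta> = factor_prod n" using Kop_crossed by blast
  have N: "Nop = crossed (\<lambda>b. cvol n * f b) (kperm n)"
    by (simp add: Nop_def Vop_def f(1) crossed_mult)
  let ?c = "app (cvol n * factor_prod n) (point {}) {}"
  have val: "app Nop (point (b, I)) (b, I) = (if b = \<beta> then ?c else 0)"
    if b: "b \<in> orbit" and I: "I \<in> Pow {1..n}" for b I
  proof (cases "b \<circ> kperm n = b")
    case True
    with b have "b = \<beta>" by (auto simp: orbit_def intro: fixed_word)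
    have pt: "(\<lambda>J. point (\<beta>, I) (\<beta>, J)) = point I" by (auto simp: point_def)
    have "rgt n i * (cvol n * factor_prod n) = cvol n * factor_prod n * rgt n i" for i
    proof -
      have "rgt n i * cvol n = cvol n * rgt n i"
        unfolding cvol_def by (intro rgt_prod_list) (auto simp: rgt_cg)
      then have "rgt n i * (cvol n * factor_prod n) = cvol n * (rgt n i * factor_prod n)"
        by (simp add: mult.assoc[symmetric])
      then show ?thesis by (simp add: rgt_factor_prod mult.assoc)
    qed
    then have "app (cvol n * factor_prod n) (point I) I = ?c" using I by (intro diagonal_const) auto
    then show ?thesis using True \<open>b = \<beta>\<close> by (simp add: N app_crossed f(2) pt)
  next
    case False
    then have "(\<lambda>J. point (b, I) (b \<circ> kperm n, J)) = (\<lambda>J. 0)" by (auto simp: point_def)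
    then have "app Nop (point (b, I)) (b, I) = 0" by (simp add: N app_crossed app_0)
    \<comment> \<open>In this branch b is not fixed, whereas \<beta> is fixed by every partial
      product.\<close>
    moreover have "b \<noteq> \<beta>"
    proof
      assume "b = \<beta>"
      have "kperm k permutes {1..n} \<and> \<beta> \<circ> kperm k = \<beta>" if "k \<le> n" for k
        using that
      proof (induction k)
        case 0 show ?case unfolding kperm_0 by (intro conjI permutes_id comp_id)
      next
        case (Suc k)
        then show ?case
          using kperm_permutes[OF Suc.prems] beta_refl[of "Suc k"]
          by (simp only: kperm_Suc comp_assoc[symmetric]) (cases "joined (Suc k)"; simp)
      qed
      with False \<open>b = \<beta>\<close> show False by blast
    qed
    ultimately show ?thesis by simp
  qed
  have "trace_on idx Nop = (\<Sum>(b, I)\<in>orbit \<times> Pow {1..n}. if b = \<beta> then ?c else 0)"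
    unfolding trace_on_def idx_def
  proof (rule sum.cong[OF refl])
    fix x assume "x \<in> orbit \<times> Pow {1..n}"
    then obtain b I where x: "x = (b, I)" "b \<in> orbit" "I \<in> Pow {1..n}" by blast
    show "app Nop (point x) x = (case x of (b, I) \<Rightarrow> if b = \<beta> then ?c else 0)"
      unfolding x(1) prod.case by (rule val[OF x(2,3)])
  qed
  also have "\<dots> = (\<Sum>b\<in>orbit. \<Sum>I\<in>Pow {1..n}. if b = \<beta> then ?c else 0)"
    by (rule sum.cartesian_product[symmetric])
  also have "\<dots> = (\<Sum>b\<in>orbit. if b = \<beta> then 2 ^ n * ?c else 0)"
    by (intro sum.cong refl) (simp add: card_Pow)
  also have "\<dots> = 2 ^ n * ?c"
    using beta_orbit finite_permutations[of "{1..n}"] by (subst sum.delta) (auto simp: orbit_def)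
  finally show ?thesis using cvol_factor_prod_nonzero by simp
qed

lemma scalar_boundary_zero:
  assumes f: "f \<in> carrier (hecke n)" and a: "a \<in> carrier (HC n)"
    and eq: "tensHC n f \<one>\<^bsub>cliff n\<^esub> = dirac n \<otimes>\<^bsub>HC n\<^esub> a \<oplus>\<^bsub>HC n\<^esub> a \<otimes>\<^bsub>HC n\<^esub> dirac n"
    and scalar: "\<And>\<phi> x. x \<in> idx \<Longrightarrow> app (opH n f) \<phi> x = \<chi> * \<phi> x"
  shows "\<chi> = 0"
proof -
  interpret HC': ring "HC n" by (rule ring_HC)
  interpret C': ring "cliff n" by (rule ring_cliff)
  have "opH n f = opHC n (tensHC n f \<one>\<^bsub>cliff n\<^esub>)"
    using f by (simp add: opHC_tensHC opC_one)
  also have "\<dots> = Dop n * opHC n a + opHC n a * Dop n"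
    unfolding eq using a by (simp add: opHC_add opHC_mult opHC_dirac)
  finally have op: "opH n f = Dop n * opHC n a + opHC n a * Dop n" .
  have D: "local_on idx (Dop n)"
    unfolding opHC_dirac[symmetric] by (rule local_on_opHC) simp
  have "trace_on idx (opH n f * Nop) = 0"
    unfolding op by (rule trace_anticommutator[OF finite_idx D local_on_opHC[OF a] local_on_Nop Dop_Nop])
  moreover have "trace_on idx (opH n f * Nop) = \<chi> * trace_on idx Nop"
    by (simp add: trace_on_def lop_app scalar sum_distrib_left)
  ultimately show ?thesis using trace_Nop by simp
qed

end

section \<open>Commutation modulo the relations\<close>

context presentation
begin

definition commutes :: "'a free \<Rightarrow> 'a free \<Rightarrow> bool" where
  "commutes s p \<longleftrightarrow> p * s \<doteq> s * p"

lemma commutes_add: "commutes s p \<Longrightarrow> commutes s q \<Longrightarrow> commutes s (p + q)"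
  using eqv_add[of "p * s" "s * p" "q * s" "s * q"] by (simp add: commutes_def algebra_simps)

lemma commutes_diff: "commutes s p \<Longrightarrow> commutes s q \<Longrightarrow> commutes s (p - q)"
  using eqv_diff[of "p * s" "s * p" "q * s" "s * q"] by (simp add: commutes_def algebra_simps)

lemma commutes_scal: "commutes s (scal c)"
  by (simp add: commutes_def scal_central)

lemma commutes_0: "commutes s 0" and commutes_1: "commutes s 1"
  by (simp_all add: commutes_def)

lemma commutes_mult:
  assumes "commutes s p" "commutes s q" "p \<in> fcar X" "q \<in> fcar X"
  shows "commutes s (p * q)"
proof -
  have "p * (q * s) \<doteq> p * (s * q)" using assms by (intro eqv_mult_left) (auto simp: commutes_def)
  moreover have "(p * s) * q \<doteq> (s * p) * q" using assms by (intro eqv_mult_right) (auto simp: commutes_def)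
  ultimately show ?thesis
    unfolding commutes_def using eqv_trans[of "p * (q * s)" "p * (s * q)" "(s * p) * q"] by (simp add: mult.assoc)
qed

lemma commutes_sum: "(\<And>i. i \<in> I \<Longrightarrow> commutes s (f i)) \<Longrightarrow> commutes s (sum f I)"
  by (induction I rule: infinite_finite_induct) (auto intro: commutes_0 commutes_add)

lemma commutes_power: "commutes s p \<Longrightarrow> p \<in> fcar X \<Longrightarrow> commutes s (p ^ k)"
  by (induction k) (auto intro: commutes_1 commutes_mult)

lemma commutes_prod_list:
  "(\<And>x. x \<in> set xs \<Longrightarrow> commutes s x \<and> x \<in> fcar X) \<Longrightarrow> commutes s (prod_list xs)"
  by (induction xs) (auto intro!: commutes_1 commutes_mult fcar_prod_list)

lemma commutes_eqv:
  assumes "commutes s p" "p \<doteq> q" "s \<in> fcar X"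
  shows "commutes s q"
proof -
  have "q * s \<doteq> p * s" by (rule eqv_mult_right[OF eqv_sym[OF assms(2)] assms(3)])
  also have "p * s \<doteq> s * p" using assms(1) by (simp add: commutes_def)
  also have "s * p \<doteq> s * q" by (rule eqv_mult_left[OF assms(2,3)])
  finally show ?thesis by (simp add: commutes_def)
qed

lemma commutes_sym: "commutes s p \<Longrightarrow> commutes p s"
  by (simp add: commutes_def eqv_sym)

lemma commutes_eqv_left: "commutes s p \<Longrightarrow> s \<doteq> t \<Longrightarrow> p \<in> fcar X \<Longrightarrow> commutes t p"
  by (rule commutes_sym[OF commutes_eqv[OF commutes_sym]])

lemma centre_cl:
  assumes p: "p \<in> fcar X" and "\<And>x. x \<in> X \<Longrightarrow> commutes (gen x) p"
  shows "cl p \<in> centre A"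
proof -
  have "commutes p q" if "q \<in> fcar X" for q
    using that
  proof (induction q rule: fcar_induct)
    case (mon c xs)
    have "commutes p (mon xs)" using mon
    proof (induction xs)
      case (Cons x xs)
      then show ?case
        by (auto simp: mon_Cons intro!: commutes_mult commutes_sym[OF assms(2)] fcar_gen fcar_mon)
    qed (simp add: commutes_1)
    then show ?case using mon by (intro commutes_mult commutes_scal) (auto simp: fcar_mon)
  qed (auto intro: commutes_0 commutes_add)
  then have *: "cl q \<otimes>\<^bsub>A\<^esub> cl p = cl p \<otimes>\<^bsub>A\<^esub> cl q" if "q \<in> fcar X" for q
    using p that by (simp add: mult_cl cl_eq_iff commutes_def)
  show ?thesis
    unfolding centre_def
  proof (intro CollectI conjI ballI)
    show "cl p \<in> carrier A" using p by simp
    fix x assume "x \<in> carrier A"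
    then obtain q where "q \<in> fcar X" "x = cl q" by (rule carrier_cases)
    then show "x \<otimes>\<^bsub>A\<^esub> cl p = cl p \<otimes>\<^bsub>A\<^esub> x" using * by simp
  qed
qed

end

section \<open>Symmetric polynomials are central in the Hecke algebra\<close>

definition perm_of :: "nat list \<Rightarrow> nat \<Rightarrow> nat" where
  "perm_of xs = foldr (\<circ>) (map simple_refl xs) id"

lemma perm_of_Nil: "perm_of [] = id"
  and perm_of_Cons: "perm_of (x # xs) = simple_refl x \<circ> perm_of xs"
  by (simp_all add: perm_of_def)

lemma perm_of_append: "perm_of (xs @ ys) = perm_of xs \<circ> perm_of ys"
  by (induction xs) (simp_all only: perm_of_Nil perm_of_Cons append_Nil append_Cons id_comp comp_assoc)

lemma perm_of_permutes: "set xs \<subseteq> {1..<n} \<Longrightarrow> perm_of xs permutes {1..n}"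
proof (induction xs)
  case Nil
  show ?case unfolding perm_of_Nil by (rule permutes_id)
next
  case (Cons x xs)
  then show ?case
    unfolding perm_of_Cons by (intro permutes_compose simple_refl_permutes) auto
qed

lemma transpose_word:
  assumes "1 \<le> a" "a < b" "b \<le> n"
  shows "\<exists>xs. set xs \<subseteq> {1..<n} \<and> perm_of xs = transpose a b"
  using assms(2,3)
proof (induction b)
  case (Suc b)
  show ?case
  proof (cases "a = b")
    case True
    then have "perm_of [a] = transpose a (Suc b)"
      by (simp add: perm_of_def simple_refl_def)
    then show ?thesis using Suc.prems assms(1) True by (intro exI[of _ "[a]"]) auto
  next
    case False
    with Suc obtain xs where xs: "set xs \<subseteq> {1..<n}" "perm_of xs = transpose a b" by auto
    have "simple_refl b \<circ> (transpose a b \<circ> simple_refl b) = transpose a (Suc b)"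
      using False Suc.prems unfolding simple_refl_def
      by (intro ext) (simp add: transpose_def)
    then have "perm_of (b # xs @ [b]) = transpose a (Suc b)"
      by (simp only: perm_of_Cons perm_of_append perm_of_Nil xs comp_id comp_assoc)
    then show ?thesis using Suc.prems assms(1) False xs(1) by (intro exI[of _ "b # xs @ [b]"]) auto
  qed
qed simp

lemma permutation_word:
  assumes "w permutes {1..n}"
  shows "\<exists>xs. set xs \<subseteq> {1..<n} \<and> perm_of xs = w"
  using assms finite_atLeastAtMost
proof (induction w rule: permutes_induct)
  case id
  show ?case by (intro exI[of _ "[]"]) (simp only: perm_of_Nil list.set empty_subsetI simp_thms)
next
  case (swap a b w)
  then obtain xs where xs: "set xs \<subseteq> {1..<n}" "perm_of xs = w" by blast
  have "\<exists>ys. set ys \<subseteq> {1..<n} \<and> perm_of ys = transpose a b"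
    using swap.hyps(1-3) transpose_word[of a b n] transpose_word[of b a n]
    by (cases "a < b") (auto simp: transpose_commute[of a b])
  then obtain ys where ys: "set ys \<subseteq> {1..<n}" "perm_of ys = transpose a b" by blast
  show ?case
    by (intro exI[of _ "ys @ xs"] conjI) (use xs ys in \<open>simp_all only: perm_of_append set_append Un_least\<close>)
qed

lemma hecke_perm_mult_eqv:
  "v permutes {1..n} \<Longrightarrow> w permutes {1..n} \<Longrightarrow> H.eqv n (gen (Perm v) * gen (Perm w)) (gen (Perm (v \<circ> w)))"
  by (rule H.eqv_rel) (auto simp: hecke_rels_def)

lemma hecke_perm_id_eqv: "H.eqv n (gen (Perm id)) 1"
  by (rule H.eqv_rel) (simp add: hecke_rels_def)

lemma hecke_Xi_commutes:
  assumes "i \<in> {1..n}" "j \<in> {1..n}"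
  shows "H.commutes n (gen (Xi i)) (gen (Xi j))"
proof -
  have "lin n Xi (xi j) * lin n Xi (xi i) - lin n Xi (xi i) * lin n Xi (xi j) \<in> hecke_rels n"
    using assms xi_V unfolding hecke_rels_def by blast
  then show ?thesis
    unfolding H.commutes_def lin_xi[OF assms(1)] lin_xi[OF assms(2)] by (rule H.eqv_rel)
qed

lemma hecke_cross:
  assumes i: "i \<in> {1..<n}" and l: "l \<in> {1..n}"
  shows "H.eqv n (gen (Xi l) * gen (Perm (simple_refl i)))
    (gen (Perm (simple_refl i)) * gen (Xi (simple_refl i l)) + scal (simple_root i l))"
proof -
  let ?s = "simple_refl i"
  have sl: "?s l \<in> {1..n}" using permutes_in_image[OF simple_refl_permutes[OF i]] l by blast
  have inv: "inv_into UNIV ?s = ?s" by (simp add: simple_refl_def)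
  have ss: "?s (?s j) = j" for j by (simp add: simple_refl_def)
  have act: "act ?s (xi l) = xi (?s l)"
  proof
    fix j
    have "?s j = l \<longleftrightarrow> j = ?s l" using ss by metis
    then show "act ?s (xi l) j = xi (?s l) j" by (simp add: act_def inv xi_def)
  qed
  have bil: "bilin n (simple_root i) (xi l) = simple_root i l"
  proof -
    have "bilin n (simple_root i) (xi l) = (\<Sum>j=1..n. if j = l then simple_root i l else 0)"
      unfolding bilin_def by (intro sum.cong refl) (auto simp: xi_def)
    then show ?thesis using l by simp
  qed
  have "lin n Xi (xi l) * gen (Perm ?s) - gen (Perm ?s) * lin n Xi (act ?s (xi l))
      - scal (bilin n (simple_root i) (xi l)) \<in> hecke_rels n"
    using i xi_V[OF l] unfolding hecke_rels_def by blast
  then show ?thesis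
    unfolding act bil lin_xi[OF l] lin_xi[OF sl] by (intro H.eqv_rel) (simp add: diff_diff_eq)
qed

lemma hecke_centre:
  assumes p: "p \<in> fcar (hecke_gens n)"
    and X: "\<And>i. i \<in> {1..n} \<Longrightarrow> H.commutes n (gen (Xi i)) p"
    and s: "\<And>i. i \<in> {1..<n} \<Longrightarrow> H.commutes n (gen (Perm (simple_refl i))) p"
  shows "H.cl n p \<in> centre (hecke n)"
  unfolding hecke_def
proof (rule H.centre_cl[OF p])
  fix x assume "x \<in> hecke_gens n"
  then consider i where "x = Xi i" "i \<in> {1..n}" | w where "x = Perm w" "w permutes {1..n}"
    by (auto simp: hecke_gens_def)
  then show "H.commutes n (gen x) p"
  proof cases
    case 1
    then show ?thesis using X by simp
  next
    case 2
    have "H.commutes n (gen (Perm (perm_of xs))) p" if "set xs \<subseteq> {1..<n}" for xs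
      using that
    proof (induction xs)
      case Nil
      show ?case
        unfolding perm_of_Nil
        by (rule H.commutes_eqv_left[OF H.commutes_sym[OF H.commutes_1] H.eqv_sym[OF hecke_perm_id_eqv] p])
    next
      case (Cons i xs)
      then have i: "i \<in> {1..<n}" and xs: "set xs \<subseteq> {1..<n}" by auto
      have perm: "simple_refl i permutes {1..n}" "perm_of xs permutes {1..n}"
        using simple_refl_permutes[OF i] perm_of_permutes[OF xs] by auto
      have "H.commutes n (gen (Perm (simple_refl i)) * gen (Perm (perm_of xs))) p"
        using perm by (intro H.commutes_sym[OF H.commutes_mult[OF H.commutes_sym[OF s[OF i]]
            H.commutes_sym[OF Cons.IH[OF xs]]]]) simp_all
      then show ?case
        unfolding perm_of_Cons by (rule H.commutes_eqv_left[OF _ hecke_perm_mult_eqv[OF perm] p])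
    qed
    then show ?thesis using permutation_word[OF 2(2)] 2(1) by auto
  qed
qed

section \<open>One simple reflection and symmetric functions of its two variables\<close>

context
  fixes n i :: nat
  assumes i: "i \<in> {1..<n}"
begin

abbreviation (input) "sR \<equiv> (gen (Perm (simple_refl i)) :: hecke_gen free)"
abbreviation (input) "xA \<equiv> (gen (Xi i) :: hecke_gen free)"
abbreviation (input) "xB \<equiv> (gen (Xi (Suc i)) :: hecke_gen free)"

lemma pair_fcar: "sR \<in> fcar (hecke_gens n)" "xA \<in> fcar (hecke_gens n)" "xB \<in> fcar (hecke_gens n)"
  using i simple_refl_permutes[OF i] by auto

lemma cross_A: "H.eqv n (xA * sR) (sR * xB + 1)"
  using hecke_cross[OF i, of i] i by (simp add: simple_refl_def simple_root_def xi_def)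

lemma cross_B: "H.eqv n (xB * sR) (sR * xA - 1)"
  using hecke_cross[OF i, of "Suc i"] i by (simp add: simple_refl_def simple_root_def xi_def scal_minus)

lemma commutes_other: "l \<in> {1..n} \<Longrightarrow> l \<noteq> i \<Longrightarrow> l \<noteq> Suc i \<Longrightarrow> H.commutes n sR (gen (Xi l))"
  using hecke_cross[OF i, of l] by (simp add: H.commutes_def simple_refl_def simple_root_def xi_def)

lemma commutes_pair_sum: "H.commutes n sR (xA + xB)"
  using H.eqv_add[OF cross_A cross_B] by (simp add: H.commutes_def algebra_simps)

lemma AB: "H.eqv n (xA * xB) (xB * xA)"
  using hecke_Xi_commutes[of "Suc i" n i] i by (simp add: H.commutes_def)

text \<open>The corrections 1 and -1 of the two cross relations cancel.\<close>

lemma commutes_pair_prod: "H.commutes n sR (xA * xB)"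
proof -
  have "xA * xB * sR = xA * (xB * sR)" by (simp add: mult.assoc)
  also have "H.eqv n \<dots> (xA * (sR * xA - 1))"
    by (rule H.eqv_mult_left[OF cross_B pair_fcar(2)])
  also have "xA * (sR * xA - 1) = (xA * sR) * xA - xA" by (simp add: algebra_simps)
  also have "H.eqv n \<dots> ((sR * xB + 1) * xA - xA)"
    by (intro H.eqv_diff H.eqv_mult_right cross_A pair_fcar H.eqv_refl)
  also have "(sR * xB + 1) * xA - xA = sR * (xB * xA)" by (simp add: algebra_simps)
  also have "H.eqv n \<dots> (sR * (xA * xB))"
    by (intro H.eqv_mult_left H.eqv_sym[OF AB] pair_fcar)
  finally show ?thesis by (simp add: H.commutes_def)
qed

lemma AB_power: "H.commutes n xA (xB ^ k)" "H.commutes n xB (xA ^ k)"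
proof -
  have "H.commutes n xA xB" "H.commutes n xB xA"
    unfolding H.commutes_def by (rule H.eqv_sym[OF AB], rule AB)
  then show "H.commutes n xA (xB ^ k)" "H.commutes n xB (xA ^ k)"
    by (simp_all add: H.commutes_power pair_fcar)
qed

text \<open>The Newton recursion p_(d+2) = e_1 p_(d+1) - e_2 p_d in two variables, where e_1 and e_2
  are already known to commute with the reflection.\<close>

lemma commutes_power_sum: "H.commutes n sR (xA ^ k + xB ^ k)"
proof (induction k rule: less_induct)
  case (less k)
  consider "k = 0" | "k = 1" | d where "k = Suc (Suc d)" by (metis One_nat_def not0_implies_Suc)
  then show ?case
  proof cases
    case 1
    have "H.commutes n sR (1 + 1)" by (intro H.commutes_add H.commutes_1)
    with 1 show ?thesis by simp
  next
    case 2
    then show ?thesis by (simp add: commutes_pair_sum)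
  next
    case (3 d)
    have "H.commutes n sR ((xA + xB) * (xA ^ Suc d + xB ^ Suc d) - (xA * xB) * (xA ^ d + xB ^ d))"
    proof -
      have "H.commutes n sR (xA ^ Suc d + xB ^ Suc d)" "H.commutes n sR (xA ^ d + xB ^ d)"
        by (rule less; use 3 in simp)+
      then show ?thesis
        using pair_fcar
        by (intro H.commutes_diff[OF H.commutes_mult[OF commutes_pair_sum] H.commutes_mult[OF commutes_pair_prod]])
          simp_all
    qed
    moreover have "H.eqv n ((xA + xB) * (xA ^ Suc d + xB ^ Suc d) - (xA * xB) * (xA ^ d + xB ^ d)) (xA ^ k + xB ^ k)"
    proof -
      have "(xA + xB) * (xA ^ Suc d + xB ^ Suc d) - (xA * xB) * (xA ^ d + xB ^ d)
        = xA ^ k + xB ^ k + xB * xA * xA ^ d - xA * xB * xA ^ d"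
        by (simp add: 3 algebra_simps)
      moreover have "H.eqv n (xA ^ k + xB ^ k + xB * xA * xA ^ d - xA * xB * xA ^ d)
          (xA ^ k + xB ^ k + xA * xB * xA ^ d - xA * xB * xA ^ d)"
        using pair_fcar by (intro H.eqv_diff H.eqv_add H.eqv_refl H.eqv_mult_right H.eqv_sym[OF AB]) auto
      ultimately show ?thesis by simp
    qed
    ultimately show ?thesis using pair_fcar by (auto intro: H.commutes_eqv)
  qed
qed

lemma AB_mult_power: "H.eqv n ((xA * xB) ^ a) (xA ^ a * xB ^ a)"
proof (induction a)
  case (Suc a)
  have "(xA * xB) ^ Suc a = xA * xB * (xA * xB) ^ a" by simp
  also have "H.eqv n \<dots> (xA * xB * (xA ^ a * xB ^ a))"
    using Suc pair_fcar by (intro H.eqv_mult_left) auto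
  also have "xA * xB * (xA ^ a * xB ^ a) = xA * (xB * xA ^ a) * xB ^ a" by (simp add: mult.assoc)
  also have "H.eqv n \<dots> (xA * (xA ^ a * xB) * xB ^ a)"
    using H.eqv_sym[OF AB_power(2)[of a, unfolded H.commutes_def]] pair_fcar
    by (intro H.eqv_mult_right H.eqv_mult_left) simp_all
  also have "xA * (xA ^ a * xB) * xB ^ a = xA ^ Suc a * xB ^ Suc a" by (simp add: mult.assoc)
  finally show ?case .
qed simp

text \<open>For a \<le> b and d = b - a, taking out the common power of AB leaves a power sum:
  (AB)^a (A^d + B^d).\<close>

lemma commutes_pair_monomials: "H.commutes n sR (xA ^ a * xB ^ b + xA ^ b * xB ^ a)"
proof -
  have *: "H.commutes n sR (xA ^ a * xB ^ b + xA ^ b * xB ^ a)" if ab: "a \<le> b" for a b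
  proof -
    obtain d where b: "b = a + d" using ab le_Suc_ex by blast
    have "H.commutes n sR ((xA * xB) ^ a * (xA ^ d + xB ^ d))"
      using pair_fcar by (intro H.commutes_mult H.commutes_power commutes_pair_prod commutes_power_sum) auto
    moreover have "H.eqv n ((xA * xB) ^ a * (xA ^ d + xB ^ d)) (xA ^ a * xB ^ b + xA ^ b * xB ^ a)"
    proof -
      have "H.eqv n ((xA * xB) ^ a * (xA ^ d + xB ^ d)) (xA ^ a * xB ^ a * (xA ^ d + xB ^ d))"
        using pair_fcar by (intro H.eqv_mult_right AB_mult_power) auto
      also have "xA ^ a * xB ^ a * (xA ^ d + xB ^ d) = xA ^ a * (xB ^ a * xA ^ d) + xA ^ a * xB ^ b"
        by (simp add: b power_add algebra_simps)
      also have "H.eqv n \<dots> (xA ^ a * (xA ^ d * xB ^ a) + xA ^ a * xB ^ b)"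
      proof -
        have "H.commutes n (xA ^ d) (xB ^ a)"
          using AB_power pair_fcar by (intro H.commutes_power H.commutes_sym[OF AB_power(2)]) auto
        then show ?thesis
          using pair_fcar by (intro H.eqv_add H.eqv_mult_left) (auto simp: H.commutes_def)
      qed
      finally show ?thesis by (simp add: b power_add mult.assoc add.commute)
    qed
    ultimately show ?thesis using pair_fcar by (auto intro: H.commutes_eqv)
  qed
  show ?thesis
    using *[of a b] *[of b a] by (cases "a \<le> b") (auto simp: add.commute)
qed

end

section \<open>Polynomials in several variables\<close>

definition monomial_free :: "nat \<Rightarrow> (nat \<Rightarrow>\<^sub>0 nat) \<Rightarrow> hecke_gen free" where
  "monomial_free n m = prod_list (map (\<lambda>i. gen (Xi i) ^ Poly_Mapping.lookup m i) [1..<Suc n])"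

definition poly_free :: "nat \<Rightarrow> mpoly \<Rightarrow> hecke_gen free" where
  "poly_free n p = (\<Sum>m\<in>Poly_Mapping.keys p. scal (Poly_Mapping.lookup p m) * monomial_free n m)"

lemma hecke_poly_cl: "hecke_poly n p = H.cl n (poly_free n p)"
  by (simp only: hecke_poly_def H.cl_def poly_free_def monomial_free_def)

lemma monomial_free_fcar [simp]: "monomial_free n m \<in> fcar (hecke_gens n)"
  unfolding monomial_free_def by (rule fcar_prod_list) (auto intro!: fcar_power fcar_gen_Xi)

lemma poly_free_fcar [simp]: "poly_free n p \<in> fcar (hecke_gens n)"
  unfolding poly_free_def by (rule fcar_sum) simp

lemma commutes_monomial_Xi: "i \<in> {1..n} \<Longrightarrow> H.commutes n (gen (Xi i)) (monomial_free n m)"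
  unfolding monomial_free_def
  by (rule H.commutes_prod_list)
    (auto intro!: fcar_power fcar_gen_Xi H.commutes_power hecke_Xi_commutes)

definition swap_exp :: "nat \<Rightarrow> (nat \<Rightarrow>\<^sub>0 nat) \<Rightarrow> (nat \<Rightarrow>\<^sub>0 nat)" where
  "swap_exp i m = Poly_Mapping.map_key (simple_refl i) m"

lemma lookup_swap_exp: "Poly_Mapping.lookup (swap_exp i m) j = Poly_Mapping.lookup m (simple_refl i j)"
  unfolding swap_exp_def by (simp add: map_key.rep_eq simple_refl_def)

lemma swap_exp_involution: "swap_exp i (swap_exp i m) = m"
  by (rule poly_mapping_eqI) (simp add: lookup_swap_exp, simp add: simple_refl_def)

text \<open>The powers of the other variables commute with the reflection and are the same in both
  monomials; what is left in the middle is a symmetrised monomial in two variables.\<close>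

lemma commutes_monomial_pair:
  assumes i: "i \<in> {1..<n}"
  shows "H.commutes n (gen (Perm (simple_refl i))) (monomial_free n m + monomial_free n (swap_exp i m))"
proof -
  let ?F = "\<lambda>m i. (gen (Xi i) :: hecke_gen free) ^ Poly_Mapping.lookup m i"
  have split: "[1..<Suc n] = [1..<i] @ [i, Suc i] @ [Suc (Suc i)..<Suc n]"
  proof -
    have "[1..<Suc n] = [1..<i] @ [i..<Suc n]"
      using upt_add_eq_append[of 1 i "Suc n - i"] i by (simp del: upt_Suc)
    moreover have "[i..<Suc n] = i # Suc i # [Suc (Suc i)..<Suc n]"
    proof -
      have "[i..<Suc n] = i # [Suc i..<Suc n]" by (rule upt_conv_Cons) (use i in auto)
      moreover have "[Suc i..<Suc n] = Suc i # [Suc (Suc i)..<Suc n]" by (rule upt_conv_Cons) (use i in auto)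
      ultimately show ?thesis by (simp only:)
    qed
    ultimately show ?thesis by (simp only: append_Cons append_Nil)
  qed
  define P where "P = prod_list (map (?F m) [1..<i])"
  define Q where "Q = prod_list (map (?F m) [Suc (Suc i)..<Suc n])"
  have other: "?F (swap_exp i m) j = ?F m j" if "j \<noteq> i" "j \<noteq> Suc i" for j
    using that by (simp add: lookup_swap_exp simple_refl_def)
  have eq1: "map (?F (swap_exp i m)) [1..<i] = map (?F m) [1..<i]"
    by (rule map_cong[OF refl], rule other) auto
  have eq2: "map (?F (swap_exp i m)) [Suc (Suc i)..<Suc n] = map (?F m) [Suc (Suc i)..<Suc n]"
    by (rule map_cong[OF refl], rule other) auto
  have m2: "monomial_free n (swap_exp i m)
    = P * (?F (swap_exp i m) i * ?F (swap_exp i m) (Suc i)) * Q"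
    unfolding monomial_free_def split P_def Q_def
    by (simp only: map_append prod_list.append eq1 eq2 list.map prod_list.Cons prod_list.Nil mult_1_right mult.assoc)
  have m1: "monomial_free n m = P * (?F m i * ?F m (Suc i)) * Q"
    unfolding monomial_free_def split P_def Q_def
    by (simp only: map_append prod_list.append list.map prod_list.Cons prod_list.Nil mult_1_right mult.assoc)
  let ?a = "Poly_Mapping.lookup m i" and ?b = "Poly_Mapping.lookup m (Suc i)"
  have sum: "monomial_free n m + monomial_free n (swap_exp i m)
    = P * (gen (Xi i) ^ ?a * gen (Xi (Suc i)) ^ ?b + gen (Xi i) ^ ?b * gen (Xi (Suc i)) ^ ?a) * Q"
    unfolding m1 m2 lookup_swap_exp by (simp add: simple_refl_def algebra_simps)
  have comm: "H.commutes n (gen (Perm (simple_refl i))) (prod_list (map (?F m) xs)) \<and>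
      prod_list (map (?F m) xs) \<in> fcar (hecke_gens n)"
    if "\<And>j. j \<in> set xs \<Longrightarrow> j \<in> {1..n} \<and> j \<noteq> i \<and> j \<noteq> Suc i" for xs
  proof -
    have "H.commutes n (gen (Perm (simple_refl i))) x \<and> x \<in> fcar (hecke_gens n)"
      if "x \<in> set (map (?F m) xs)" for x
    proof -
      from that obtain j where "j \<in> set xs" "x = ?F m j" by auto
      moreover from this \<open>\<And>j. j \<in> set xs \<Longrightarrow> j \<in> {1..n} \<and> j \<noteq> i \<and> j \<noteq> Suc i\<close>
      have "j \<in> {1..n}" "j \<noteq> i" "j \<noteq> Suc i" by blast+
      ultimately show ?thesis
        by (simp only: H.commutes_power commutes_other[OF i] fcar_power fcar_gen_Xi simp_thms)
    qed
    then show ?thesis by (blast intro: H.commutes_prod_list fcar_prod_list)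
  qed
  have P: "H.commutes n (gen (Perm (simple_refl i))) P" "P \<in> fcar (hecke_gens n)"
    unfolding P_def using comm[of "[1..<i]"] i by auto
  have Q: "H.commutes n (gen (Perm (simple_refl i))) Q" "Q \<in> fcar (hecke_gens n)"
    unfolding Q_def using comm[of "[Suc (Suc i)..<Suc n]"] i by (auto simp del: upt_Suc)
  show ?thesis
    unfolding sum using P Q pair_fcar[OF i]
    by (intro H.commutes_mult commutes_pair_monomials[OF i] fcar_mult fcar_add fcar_power) auto
qed

lemma symmetric_swap:
  assumes "symmetric_poly n p" "i \<in> {1..<n}"
  shows "Poly_Mapping.lookup p (swap_exp i m) = Poly_Mapping.lookup p m"
  using assms simple_refl_permutes[OF assms(2)] by (simp add: symmetric_poly_def swap_exp_def)

lemma hecke_poly_centre: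
  assumes "symmetric_poly n p"
  shows "hecke_poly n p \<in> centre (hecke n)"
  unfolding hecke_poly_cl
proof (rule hecke_centre)
  show "H.commutes n (gen (Xi i)) (poly_free n p)" if "i \<in> {1..n}" for i
    unfolding poly_free_def using that
    by (intro H.commutes_sum H.commutes_mult H.commutes_scal commutes_monomial_Xi) auto
  fix i assume i: "i \<in> {1..<n}"
  let ?K = "Poly_Mapping.keys p" and ?s = "gen (Perm (simple_refl i)) :: hecke_gen free"
  have sym: "Poly_Mapping.lookup p (swap_exp i m) = Poly_Mapping.lookup p m" for m
    using assms i by (rule symmetric_swap)
  then have "swap_exp i m \<in> ?K" if "m \<in> ?K" for m using that by (simp add: in_keys_iff)
  then have "bij_betw (swap_exp i) ?K ?K"
    by (intro bij_betw_byWitness[where f' = "swap_exp i"]) (auto simp: swap_exp_involution)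
  then have "poly_free n p = (\<Sum>m\<in>?K. scal (Poly_Mapping.lookup p (swap_exp i m)) * monomial_free n (swap_exp i m))"
    unfolding poly_free_def by (rule sum.reindex_bij_betw[symmetric])
  \<comment> \<open>Doubling pairs every monomial with its swap, including the monomials fixed by
    the swap; the factor 2 is divided out afterwards.\<close>
  then have "poly_free n p + poly_free n p = (\<Sum>m\<in>?K. scal (Poly_Mapping.lookup p m) * (monomial_free n m + monomial_free n (swap_exp i m)))"
    by (simp add: sym) (simp add: poly_free_def distrib_left sum.distrib)
  moreover have "H.commutes n ?s (\<Sum>m\<in>?K. scal (Poly_Mapping.lookup p m) * (monomial_free n m + monomial_free n (swap_exp i m)))"
    by (intro H.commutes_sum H.commutes_mult H.commutes_scal commutes_monomial_pair[OF i]) auto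
  ultimately have "H.commutes n ?s (poly_free n p + poly_free n p)" by simp
  then have "H.commutes n ?s (scal (1 / 2) * (poly_free n p + poly_free n p))"
    by (intro H.commutes_mult H.commutes_scal fcar_scal fcar_add poly_free_fcar)
  moreover have "scal (1 / 2) * (poly_free n p + poly_free n p) = poly_free n p"
    by (simp add: distrib_left distrib_right[symmetric] scal_add[symmetric])
  ultimately show "H.commutes n ?s (poly_free n p)" by simp
qed simp

lemma hecke_theta_odd_poly:
  assumes "odd_poly n p"
  shows "hecke_theta n (hecke_poly n p) = \<ominus>\<^bsub>hecke n\<^esub> hecke_poly n p"
proof -
  have mon: "feval scal hecke_sign (prod_list (map (\<lambda>i. gen (Xi i) ^ Poly_Mapping.lookup m i) xs))
    = (- 1) ^ (\<Sum>i\<leftarrow>xs. Poly_Mapping.lookup m i) * prod_list (map (\<lambda>i. gen (Xi i) ^ Poly_Mapping.lookup m i) xs)" for m xs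
  proof (induction xs)
    case (Cons i xs)
    have "feval scal hecke_sign (gen (Xi i) ^ k) = (- 1) ^ k * gen (Xi i) ^ k" for k
      by (simp add: scal.feval_power scal.feval_gen hecke_sign_def power_minus[symmetric])
    moreover have "(- 1) ^ k * x * ((- 1) ^ l * y) = (- 1) ^ (k + l) * (x * y)" for x y :: "hecke_gen free" and k l
      by (cases "even k"; cases "even l") simp_all
    ultimately show ?case
      using Cons by (simp only: list.map prod_list.Cons sum_list.Cons scal.feval_mult)
  qed simp
  have "feval scal hecke_sign (poly_free n p) = - poly_free n p"
    unfolding poly_free_def scal.feval_sum sum_negf[symmetric]
  proof (rule sum.cong[OF refl])
    fix m assume "m \<in> Poly_Mapping.keys p"
    with assms have "odd (\<Sum>i=1..n. Poly_Mapping.lookup m i)" by (simp add: odd_poly_def)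
    moreover have "(\<Sum>i\<leftarrow>[1..<Suc n]. Poly_Mapping.lookup m i) = (\<Sum>i=1..n. Poly_Mapping.lookup m i)"
      by (simp only: sum_list_distinct_conv_sum_set distinct_upt set_upt atLeastLessThanSuc_atLeastAtMost)
    ultimately show "feval scal hecke_sign (scal (Poly_Mapping.lookup p m) * monomial_free n m)
        = - (scal (Poly_Mapping.lookup p m) * monomial_free n m)"
      by (simp only: scal.feval_mult scal.feval_scal monomial_free_def mon) simp
  qed
  then show ?thesis
    by (simp add: hecke_poly_cl hecke_theta_cl hecke_ops)
qed

section \<open>Central characters of strict partitions\<close>

text \<open>For k = 1, ..., a these are half the weights of the irreducible sl_2-module of dimension
  a, a string symmetric about 0.\<close>

definition str :: "nat \<Rightarrow> nat \<Rightarrow> complex" where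
  "str a k = (of_nat a + 1 - 2 * of_nat k) / 2"

text \<open>The value of q(\<xi>_1) + ... + q(\<xi>_n) in the central character of \<Lambda>.
  Allowing every polynomial q, instead of powers only, leaves room to prescribe its zeros.\<close>

definition string_sum :: "nat set \<Rightarrow> complex poly \<Rightarrow> complex" where
  "string_sum \<Lambda> q = (\<Sum>a\<in>\<Lambda>. \<Sum>k=1..a. poly q (str a k))"

lemma str_less:
  assumes "1 \<le> k" "a < c \<or> (a = c \<and> 2 \<le> k)"
  shows "str a k \<noteq> str c 1"
proof
  assume eq: "str a k = str c 1"
  have "of_nat a + 1 - 2 * of_nat k = 2 * str a k" "2 * str c 1 = of_nat c - 1"
    by (simp_all add: str_def)
  then have "of_nat a + 1 - 2 * of_nat k = (of_nat c - 1 :: complex)"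
    by (simp only: eq)
  then have "of_nat a + (2 :: complex) = of_nat c + 2 * of_nat k"
    by (simp add: algebra_simps)
  then have "(of_nat (a + 2) :: complex) = of_nat (c + 2 * k)" by (simp add: add.commute)
  then have "a + 2 = c + 2 * k" by (simp only: of_nat_eq_iff)
  with assms show False by auto
qed

text \<open>
  The polynomial vanishes on the strings of all parts below \<open>c\<close> and on the string of \<open>c\<close> except at its
  top \<open>(c - 1) / 2\<close>, a value that none of the others attains.
\<close>

lemma string_sum_separates_aux:
  assumes fin: "finite \<Lambda>" "finite M" and c: "c \<in> \<Lambda>" "c \<notin> M" "0 < c"
    and larger: "\<And>a. c < a \<Longrightarrow> a \<in> \<Lambda> \<longleftrightarrow> a \<in> M"
  shows "\<exists>q. string_sum \<Lambda> q \<noteq> string_sum M q"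
proof -
  define Y where "Y = (\<lambda>(a, k). str a k) ` {(a, k). 1 \<le> k \<and> k \<le> a \<and> (a < c \<or> (a = c \<and> 2 \<le> k))}"
  define q where "q = (\<Prod>y\<in>Y. [:- y, 1:])"
  have "finite {(a, k). 1 \<le> k \<and> k \<le> a \<and> (a < c \<or> (a = c \<and> 2 \<le> k))}"
    by (rule finite_subset[of _ "{..c} \<times> {..c}"]) auto
  then have finY: "finite Y" by (simp add: Y_def)
  have poly: "poly q x = (\<Prod>y\<in>Y. x - y)" for x by (simp add: q_def poly_prod)
  define T where "T a = (\<Sum>k=1..a. poly q (str a k))" for a
  have zero: "poly q (str a k) = 0" if "1 \<le> k" "k \<le> a" "a < c \<or> (a = c \<and> 2 \<le> k)" for a k
  proof -
    have "str a k \<in> Y" using that unfolding Y_def by force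
    then show ?thesis using finY by (auto simp: poly)
  qed
  have T0: "T a = 0" if "a < c" for a
    unfolding T_def using that by (intro sum.neutral ballI zero) auto
  have "T c = poly q (str c 1) + (\<Sum>k\<in>{1..c} - {1}. poly q (str c k))"
    unfolding T_def using c(3) by (intro sum.remove) auto
  also have "(\<Sum>k\<in>{1..c} - {1}. poly q (str c k)) = 0"
    by (intro sum.neutral ballI zero) auto
  finally have "T c = poly q (str c 1)" by simp
  moreover have "str c 1 \<notin> Y"
  proof
    assume "str c 1 \<in> Y"
    then obtain y where y: "str c 1 = (\<lambda>(a, k). str a k) y"
      "y \<in> {(a, k). 1 \<le> k \<and> k \<le> a \<and> (a < c \<or> (a = c \<and> 2 \<le> k))}"
      unfolding Y_def by (rule imageE)
    obtain a k where "y = (a, k)" by (rule prod.exhaust)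
    with y have "1 \<le> k" "a < c \<or> (a = c \<and> 2 \<le> k)" "str a k = str c 1" by simp_all
    with str_less[of k a c] show False by simp
  qed
  ultimately have Tc: "T c \<noteq> 0"
    using finY by (auto simp: poly)
  have L: "string_sum \<Lambda> q = T c + (\<Sum>a\<in>{a \<in> \<Lambda>. c < a}. T a)"
  proof -
    have "string_sum \<Lambda> q = (\<Sum>a\<in>insert c {a \<in> \<Lambda>. c < a}. T a)"
      unfolding string_sum_def T_def[symmetric] using fin c(1)
      by (intro sum.mono_neutral_right) (auto intro!: T0)
    then show ?thesis using fin by simp
  qed
  have M: "string_sum M q = (\<Sum>a\<in>{a \<in> M. c < a}. T a)"
    unfolding string_sum_def T_def[symmetric] using fin c(2)
    by (intro sum.mono_neutral_right) (auto intro!: T0 simp: not_less le_less)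
  have "{a \<in> \<Lambda>. c < a} = {a \<in> M. c < a}" using larger by auto
  with L M Tc show ?thesis by (intro exI[of _ q]) simp
qed

text \<open>Let c be the largest element of the symmetric difference: larger parts contribute
  equally to both sums, and smaller ones are killed by the polynomial built for c.\<close>

lemma string_sum_separates:
  assumes fin: "finite \<Lambda>" "finite M" and pos: "0 \<notin> \<Lambda>" "0 \<notin> M" and "\<Lambda> \<noteq> M"
  shows "\<exists>q. string_sum \<Lambda> q \<noteq> string_sum M q"
proof -
  define D where "D = (\<Lambda> - M) \<union> (M - \<Lambda>)"
  have D: "finite D" "D \<noteq> {}" using fin \<open>\<Lambda> \<noteq> M\<close> by (auto simp: D_def)
  define c where "c = Max D"
  have c: "c \<in> D" using D by (simp add: c_def)
  have larger: "a \<in> \<Lambda> \<longleftrightarrow> a \<in> M" if "c < a" for a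
  proof -
    have "a \<notin> D" using that D Max_ge[of D a] by (auto simp: c_def)
    then show ?thesis by (auto simp: D_def)
  qed
  show ?thesis
  proof (cases "c \<in> \<Lambda>")
    case True
    then have "c \<notin> M" "0 < c" using c pos by (auto simp: D_def intro: gr0I)
    from string_sum_separates_aux[OF fin True this larger] show ?thesis .
  next
    case False
    then have "c \<in> M" "0 < c" using c pos by (auto simp: D_def intro: gr0I)
    from string_sum_separates_aux[OF fin(2,1) this(1) False this(2) larger[symmetric]] obtain q
      where "string_sum M q \<noteq> string_sum \<Lambda> q" by blast
    then show ?thesis by metis
  qed
qed

section \<open>Eigenvalues of the vectors at the increasing word\<close>

locale ordered_word = strict_word +
  assumes mono: "1 \<le> i \<Longrightarrow> i \<le> j \<Longrightarrow> j \<le> n \<Longrightarrow> \<beta> i \<le> \<beta> j"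
begin

text \<open>The eigenvector is the functional evaluating at \<beta>, which suits operators that act
  by substitution in the word. Eigenvalues of products multiply, as for any common
  eigenvector.\<close>

definition eig :: "hecke_gen free \<Rightarrow> complex \<Rightarrow> bool" where
  "eig q \<chi> \<longleftrightarrow> (\<forall>\<phi> I. app (feval osc (gH n) q) \<phi> (\<beta>, I) = \<chi> * \<phi> (\<beta>, I))"

lemma eig_add: "eig q \<chi> \<Longrightarrow> eig r \<chi>' \<Longrightarrow> eig (q + r) (\<chi> + \<chi>')"
  by (simp add: eig_def osc.feval_add lop_app algebra_simps)

lemma eig_mult: "eig q \<chi> \<Longrightarrow> eig r \<chi>' \<Longrightarrow> eig (q * r) (\<chi> * \<chi>')"
  by (simp add: eig_def osc.feval_mult lop_app)

lemma eig_scal: "eig (scal c) c"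
  by (simp add: eig_def osc.feval_scal osc.rep_eq)

lemma eig_0: "eig 0 0"
  using eig_scal[of 0] by simp

lemma eig_sum: "(\<And>i. i \<in> S \<Longrightarrow> eig (f i) (g i)) \<Longrightarrow> eig (sum f S) (sum g S)"
  by (induction S rule: infinite_finite_induct) (auto intro: eig_0 eig_add)

lemma eig_power: "eig q \<chi> \<Longrightarrow> eig (q ^ k) (\<chi> ^ k)"
  using eig_scal[of 1] by (induction k) (auto intro: eig_mult)

definition xval :: "nat \<Rightarrow> complex" where
  "xval l = (\<Sum>j\<in>{j \<in> {1..n}. \<beta> j = \<beta> l}. sg l j) / 2"

text \<open>In a weakly increasing word, positions with different labels are ordered like their
  labels, so \<open>xco\<close> vanishes for them. The remaining transpositions act inside one block
  and fix \<beta>.\<close>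

lemma eig_Xi:
  assumes l: "l \<in> {1..n}"
  shows "eig (gen (Xi l)) (xval l)"
  unfolding eig_def
proof (intro allI)
  fix \<phi> I
  have "app (feval osc (gH n) (gen (Xi l))) \<phi> (\<beta>, I) = (\<Sum>j=1..n. xco l j \<beta> * \<phi> (\<beta> \<circ> transpose l j, I))"
    by (simp add: osc.feval_gen gH_def app_Xop)
  also have "\<dots> = (\<Sum>j=1..n. if \<beta> j = \<beta> l then sg l j / 2 * \<phi> (\<beta>, I) else 0)"
  proof (rule sum.cong[OF refl])
    fix j assume j: "j \<in> {1..n}"
    show "xco l j \<beta> * \<phi> (\<beta> \<circ> transpose l j, I) = (if \<beta> j = \<beta> l then sg l j / 2 * \<phi> (\<beta>, I) else 0)"
    proof (cases "\<beta> j = \<beta> l")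
      case True
      then have "\<beta> \<circ> transpose l j = \<beta>" by (auto simp: fun_eq_iff transpose_def)
      then show ?thesis using True by (simp add: xco_def)
    next
      case False
      have "sg l j = sg (\<beta> l) (\<beta> j)"
        using mono[of l j] mono[of j l] l j False by (auto simp: sg_def)
      then show ?thesis using False by (simp add: xco_def)
    qed
  qed
  also have "\<dots> = (\<Sum>j\<in>{j \<in> {1..n}. \<beta> j = \<beta> l}. sg l j / 2 * \<phi> (\<beta>, I))"
    by (rule sum.inter_filter[symmetric]) simp
  also have "\<dots> = xval l * \<phi> (\<beta>, I)"
    by (simp add: xval_def sum_divide_distrib sum_distrib_right)
  finally show "app (feval osc (gH n) (gen (Xi l))) \<phi> (\<beta>, I) = xval l * \<phi> (\<beta>, I)" .
qed

text \<open>The k-th position of a block has k - 1 positions before it and a - k after it, and half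
  the difference is the string entry.\<close>

lemma xval_block:
  assumes a: "a \<in> \<Lambda>" and k: "k \<in> {1..a}"
  shows "xval (p a + k) = str a k"
proof -
  let ?l = "p a + k"
  have "?l \<in> {p a + 1..p a + a}" using k by auto
  then have "\<beta> ?l = a" unfolding block[OF a, symmetric] by simp
  then have blk: "{j \<in> {1..n}. \<beta> j = \<beta> ?l} = {p a + 1..p a + a}" using block[OF a] by simp
  have split: "{p a + 1..p a + a} = {p a + 1..<?l} \<union> insert ?l {?l<..p a + a}" using k by auto
  have "(\<Sum>j\<in>{p a + 1..p a + a}. sg ?l j) = (\<Sum>j\<in>{p a + 1..<?l}. sg ?l j) + (\<Sum>j\<in>insert ?l {?l<..p a + a}. sg ?l j)"
    unfolding split by (rule sum.union_disjoint) auto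
  also have "(\<Sum>j\<in>{p a + 1..<?l}. sg ?l j) = (\<Sum>j\<in>{p a + 1..<?l}. - 1)"
    by (intro sum.cong refl) (auto simp: sg_def)
  also have "(\<Sum>j\<in>insert ?l {?l<..p a + a}. sg ?l j) = (\<Sum>j\<in>{?l<..p a + a}. 1)"
    by (simp add: sg_def)
  finally have "(\<Sum>j\<in>{p a + 1..p a + a}. sg ?l j) = of_nat (a - k) - of_nat (k - 1)"
    by simp
  then show ?thesis
    using k unfolding xval_def blk str_def by (simp add: of_nat_diff)
qed

lemma xval_sum: "(\<Sum>l=1..n. poly q (xval l)) = string_sum \<Lambda> q"
proof -
  have "(\<Sum>l=1..n. poly q (xval l)) = (\<Sum>a\<in>\<Lambda>. \<Sum>l\<in>{l \<in> {1..n}. \<beta> l = a}. poly q (xval l))"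
    by (rule sum.group[symmetric]) (use Lambda beta_in in auto)
  also have "\<dots> = (\<Sum>a\<in>\<Lambda>. \<Sum>k=1..a. poly q (str a k))"
  proof (rule sum.cong[OF refl])
    fix a assume a: "a \<in> \<Lambda>"
    have "(\<Sum>l\<in>{p a + 1..p a + a}. poly q (xval l)) = (\<Sum>k=1..a. poly q (xval (p a + k)))"
      using sum.shift_bounds_cl_nat_ivl[of "\<lambda>l. poly q (xval l)" 1 "p a" a] by (simp add: add.commute)
    also have "\<dots> = (\<Sum>k=1..a. poly q (str a k))"
      by (rule sum.cong[OF refl]) (simp only: xval_block[OF a])
    finally show "(\<Sum>l\<in>{l \<in> {1..n}. \<beta> l = a}. poly q (xval l)) = (\<Sum>k=1..a. poly q (str a k))"
      by (simp only: block[OF a])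
  qed
  finally show ?thesis by (simp add: string_sum_def)
qed

end

definition power_free :: "nat \<Rightarrow> complex poly \<Rightarrow> hecke_gen free" where
  "power_free n q = (\<Sum>k\<le>degree q. scal (coeff q k) * (\<Sum>l=1..n. gen (Xi l) ^ k))"

lemma power_free_fcar [simp]: "power_free n q \<in> fcar (hecke_gens n)"
  unfolding power_free_def by (intro fcar_sum fcar_mult fcar_scal fcar_power fcar_gen_Xi)

lemma (in ordered_word) eig_power_free: "eig (power_free n q) (string_sum \<Lambda> q)"
proof -
  have "eig (power_free n q) (\<Sum>k\<le>degree q. coeff q k * (\<Sum>l=1..n. xval l ^ k))"
    unfolding power_free_def by (intro eig_sum eig_mult eig_scal eig_power eig_Xi)
  also have "(\<Sum>k\<le>degree q. coeff q k * (\<Sum>l=1..n. xval l ^ k)) = (\<Sum>l=1..n. poly q (xval l))"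
    unfolding poly_altdef sum_distrib_left by (rule sum.swap)
  finally show ?thesis unfolding xval_sum .
qed

lemma power_free_centre: "H.cl n (power_free n q) \<in> centre (hecke n)"
proof (rule hecke_centre[OF power_free_fcar])
  have pw: "(\<Sum>l=1..n. gen (Xi l) ^ k) \<in> fcar (hecke_gens n)" for k
    by (intro fcar_sum fcar_power fcar_gen_Xi)
  show "H.commutes n (gen (Xi i)) (power_free n q)" if "i \<in> {1..n}" for i
    unfolding power_free_def using that pw
    by (intro H.commutes_sum H.commutes_mult H.commutes_scal H.commutes_power hecke_Xi_commutes) simp_all
  fix i assume i: "i \<in> {1..<n}"
  have "H.commutes n (gen (Perm (simple_refl i))) (\<Sum>l=1..n. gen (Xi l) ^ k)" for k
  proof -
    have sub: "{i, Suc i} \<subseteq> {1..n}" using i by auto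
    have "(\<Sum>l=1..n. gen (Xi l) ^ k) = (\<Sum>l\<in>{1..n} - {i, Suc i}. gen (Xi l) ^ k) + (\<Sum>l\<in>{i, Suc i}. gen (Xi l) ^ k :: hecke_gen free)"
      by (rule sum.subset_diff[OF sub]) simp
    also have "(\<Sum>l\<in>{i, Suc i}. gen (Xi l) ^ k :: hecke_gen free) = gen (Xi i) ^ k + gen (Xi (Suc i)) ^ k"
      by simp
    finally have split: "(\<Sum>l=1..n. gen (Xi l) ^ k) = (\<Sum>l\<in>{1..n} - {i, Suc i}. gen (Xi l) ^ k)
      + (gen (Xi i) ^ k + gen (Xi (Suc i)) ^ k :: hecke_gen free)" .
    show ?thesis
      unfolding split
    proof (intro H.commutes_add[of n _ "sum _ _"] H.commutes_sum commutes_power_sum[OF i])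
      fix l assume "l \<in> {1..n} - {i, Suc i}"
      then show "H.commutes n (gen (Perm (simple_refl i))) (gen (Xi l) ^ k)"
        by (intro H.commutes_power commutes_other[OF i]) auto
    qed
  qed
  then show "H.commutes n (gen (Perm (simple_refl i))) (power_free n q)"
    unfolding power_free_def
    by (intro H.commutes_sum[where I = "{.._}"] H.commutes_mult[OF H.commutes_scal _ fcar_scal pw])
qed

text \<open>Parts are added in increasing order, each new block being appended behind all smaller
  ones; hence the new block starts after the sum of the previous parts.\<close>

lemma ordered_word_exists:
  assumes "finite \<Lambda>" "0 \<notin> \<Lambda>"
  shows "\<exists>\<beta> p. ordered_word (\<Sum>\<Lambda>) \<Lambda> \<beta> p"
  using assms
proof (induction \<Lambda> rule: finite_linorder_max_induct)
  case empty
  have "ordered_word 0 {} (\<lambda>_. 0) (\<lambda>_. 0)"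
    by unfold_locales auto
  then show ?case by auto
next
  case (insert a B)
  then obtain \<beta> p where "ordered_word (\<Sum>B) B \<beta> p" by auto
  then interpret ordered_word "\<Sum>B" B \<beta> p .
  let ?m = "\<Sum>B"
  have aB: "a \<notin> B" using insert.hyps by auto
  have sum: "\<Sum>(insert a B) = ?m + a" using insert.hyps aB by simp
  define \<beta>' where "\<beta>' i = (if i \<in> {?m + 1..?m + a} then a else \<beta> i)" for i
  define p' where "p' = p(a := ?m)"
  have "ordered_word (?m + a) (insert a B) \<beta>' p'"
  proof
    show "finite (insert a B)" "0 \<notin> insert a B" using insert by auto
    show "\<beta>' i \<in> insert a B" if "i \<in> {1..?m + a}" for i
      using that beta_in[of i] by (auto simp: \<beta>'_def)
    show "\<beta>' i = 0" if "i \<notin> {1..?m + a}" for i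
      using that beta_out[of i] by (auto simp: \<beta>'_def)
    show "{i \<in> {1..?m + a}. \<beta>' i = c} = {p' c + 1..p' c + c}" if "c \<in> insert a B" for c
    proof (cases "c = a")
      case True
      have iff: "\<beta>' i = a \<longleftrightarrow> i \<in> {?m + 1..?m + a}" if "i \<in> {1..?m + a}" for i
      proof (cases "i \<le> ?m")
        case True
        then have "\<beta> i \<in> B" using that by (intro beta_in) auto
        then have "\<beta> i \<noteq> a" using aB by metis
        then show ?thesis using True by (simp add: \<beta>'_def)
      next
        case False
        then show ?thesis using that by (simp add: \<beta>'_def)
      qed
      have "{i \<in> {1..?m + a}. \<beta>' i = a} = {?m + 1..?m + a}"
      proof (rule Set.set_eqI)
        fix i
        show "i \<in> {i \<in> {1..?m + a}. \<beta>' i = a} \<longleftrightarrow> i \<in> {?m + 1..?m + a}"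
        proof (cases "i \<in> {1..?m + a}")
          case True
          then show ?thesis using iff[OF True] by (simp only: mem_Collect_eq simp_thms)
        qed auto
      qed
      then show ?thesis unfolding True p'_def fun_upd_same .
    next
      case False
      then have c: "c \<in> B" using that by simp
      have "{i \<in> {1..?m + a}. \<beta>' i = c} = {i \<in> {1..?m}. \<beta> i = c}"
        using False by (auto simp: \<beta>'_def)
      then show ?thesis unfolding block[OF c] using False by (simp add: p'_def)
    qed
    show "\<beta>' i \<le> \<beta>' j" if "1 \<le> i" "i \<le> j" "j \<le> ?m + a" for i j
    proof (cases "j \<le> ?m")
      case True
      then show ?thesis using that mono[of i j] by (simp add: \<beta>'_def)
    next
      case False
      then have "\<beta>' j = a" using that by (simp add: \<beta>'_def)
      moreover have "\<beta>' i \<le> a"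
        using beta_in[of i] insert.hyps(2) that by (auto simp: \<beta>'_def intro: less_imp_le)
      ultimately show ?thesis by simp
    qed
  qed
  then show ?case unfolding sum by blast
qed

section \<open>Joint central characters and interpolation\<close>

definition strict_parts :: "nat \<Rightarrow> nat set set" where
  "strict_parts n = {\<Lambda>. \<Lambda> \<subseteq> {1..n} \<and> \<Sum>\<Lambda> = n}"

lemma finite_strict_parts: "finite (strict_parts n)"
  by (rule finite_subset[of _ "Pow {1..n}"]) (auto simp: strict_parts_def)

lemma strict_parts_finite: "\<Lambda> \<in> strict_parts n \<Longrightarrow> finite \<Lambda> \<and> 0 \<notin> \<Lambda>"
  by (auto simp: strict_parts_def intro: finite_subset)

definition std_word :: "nat \<Rightarrow> nat set \<Rightarrow> nat \<Rightarrow> nat" where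
  "std_word n \<Lambda> = (SOME \<beta>. \<exists>p. ordered_word n \<Lambda> \<beta> p)"

lemma std_word:
  assumes "\<Lambda> \<in> strict_parts n"
  shows "\<exists>p. ordered_word n \<Lambda> (std_word n \<Lambda>) p"
proof -
  have "\<exists>\<beta> p. ordered_word (\<Sum>\<Lambda>) \<Lambda> \<beta> p"
    using strict_parts_finite[OF assms] by (intro ordered_word_exists) simp_all
  moreover have "\<Sum>\<Lambda> = n" using assms by (simp add: strict_parts_def)
  ultimately have "\<exists>\<beta> p. ordered_word n \<Lambda> \<beta> p" by simp
  then show ?thesis unfolding std_word_def by (rule someI_ex)
qed

definition eigen :: "nat \<Rightarrow> nat set \<Rightarrow> hecke_gen free \<Rightarrow> complex \<Rightarrow> bool" where
  "eigen n \<Lambda> q \<chi> \<longleftrightarrow> (\<forall>\<phi> I. app (feval osc (gH n) q) \<phi> (std_word n \<Lambda>, I) = \<chi> * \<phi> (std_word n \<Lambda>, I))"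

text \<open>A representative is kept together with its values in all central characters at once, so
  that sums and products are computed pointwise in \<Lambda>.\<close>

definition central_eigen :: "nat \<Rightarrow> hecke_gen free \<Rightarrow> (nat set \<Rightarrow> complex) \<Rightarrow> bool" where
  "central_eigen n q \<chi> \<longleftrightarrow> q \<in> fcar (hecke_gens n) \<and> (\<forall>r\<in>fcar (hecke_gens n). H.commutes n r q) \<and>
     (\<forall>\<Lambda>\<in>strict_parts n. eigen n \<Lambda> q (\<chi> \<Lambda>))"

lemma central_eigen_add: "central_eigen n q \<chi> \<Longrightarrow> central_eigen n r \<chi>' \<Longrightarrow> central_eigen n (q + r) (\<lambda>\<Lambda>. \<chi> \<Lambda> + \<chi>' \<Lambda>)"
  by (auto simp: central_eigen_def eigen_def osc.feval_add lop_app algebra_simps intro: H.commutes_add)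

lemma central_eigen_mult: "central_eigen n q \<chi> \<Longrightarrow> central_eigen n r \<chi>' \<Longrightarrow> central_eigen n (q * r) (\<lambda>\<Lambda>. \<chi> \<Lambda> * \<chi>' \<Lambda>)"
  by (auto simp: central_eigen_def eigen_def osc.feval_mult lop_app intro: H.commutes_mult)

lemma central_eigen_scal: "central_eigen n (scal c) (\<lambda>\<Lambda>. c)"
  by (auto simp: central_eigen_def eigen_def osc.feval_scal osc.rep_eq intro: H.commutes_scal)

lemma central_eigen_sum: "(\<And>i. i \<in> S \<Longrightarrow> central_eigen n (f i) (g i)) \<Longrightarrow> central_eigen n (sum f S) (\<lambda>\<Lambda>. \<Sum>i\<in>S. g i \<Lambda>)"
proof (induction S rule: infinite_finite_induct)
  case (insert x S)
  then show ?case using central_eigen_add[of n "f x" "g x" "sum f S"] by simp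
qed (use central_eigen_scal[of n 0] in simp_all)

lemma central_eigen_centre: "central_eigen n q \<chi> \<Longrightarrow> H.cl n q \<in> centre (hecke n)"
  unfolding hecke_def by (rule H.centre_cl) (auto simp: central_eigen_def intro: fcar_gen)

lemma central_eigen_power_free: "central_eigen n (power_free n q) (\<lambda>\<Lambda>. string_sum \<Lambda> q)"
proof -
  have "H.commutes n r (power_free n q)" if r: "r \<in> fcar (hecke_gens n)" for r
  proof -
    have "H.cl n r \<otimes>\<^bsub>hecke n\<^esub> H.cl n (power_free n q) = H.cl n (power_free n q) \<otimes>\<^bsub>hecke n\<^esub> H.cl n r"
      using power_free_centre[of n q] r by (simp add: centre_def)
    then have "H.eqv n (r * power_free n q) (power_free n q * r)"
      using r by (simp add: hecke_ops H.cl_eq_iff)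
    then show ?thesis unfolding H.commutes_def by (rule H.eqv_sym)
  qed
  moreover have "eigen n \<Lambda> (power_free n q) (string_sum \<Lambda> q)" if "\<Lambda> \<in> strict_parts n" for \<Lambda>
  proof -
    obtain p where "ordered_word n \<Lambda> (std_word n \<Lambda>) p" using std_word[OF \<open>\<Lambda> \<in> strict_parts n\<close>] by blast
    then interpret ordered_word n \<Lambda> "std_word n \<Lambda>" p .
    show ?thesis using eig_power_free[of q] unfolding eig_def eigen_def .
  qed
  ultimately show ?thesis by (simp add: central_eigen_def)
qed

text \<open>Lagrange interpolation on the finite set of strict partitions: for each other M, one
  factor that vanishes at M and is normalised to 1 at \<Lambda>.\<close>

lemma lagrange_element:
  assumes L: "\<Lambda> \<in> strict_parts n"
  shows "\<exists>q \<chi>. central_eigen n q \<chi> \<and> \<chi> \<Lambda> = 1 \<and> (\<forall>M\<in>strict_parts n - {\<Lambda>}. \<chi> M = 0)"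
proof -
  have "\<exists>q \<chi>. central_eigen n q \<chi> \<and> \<chi> \<Lambda> = 1 \<and> (\<forall>M\<in>S. \<chi> M = 0)"
    if "finite S" "S \<subseteq> strict_parts n - {\<Lambda>}" for S
    using that
  proof (induction S rule: finite_induct)
    case empty
    show ?case using central_eigen_scal[of n 1] by (intro exI[of _ "scal 1"] exI[of _ "\<lambda>\<Lambda>. 1"]) simp
  next
    case (insert M S)
    then obtain q \<chi> where q: "central_eigen n q \<chi>" "\<chi> \<Lambda> = 1" "\<forall>M\<in>S. \<chi> M = 0" by auto
    have M: "M \<in> strict_parts n" "M \<noteq> \<Lambda>" using insert.prems by auto
    obtain f where f: "string_sum \<Lambda> f \<noteq> string_sum M f"
      using string_sum_separates[of \<Lambda> M] strict_parts_finite[OF L] strict_parts_finite[OF M(1)] M(2) by blast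
    define d where "d = string_sum \<Lambda> f - string_sum M f"
    have d: "d \<noteq> 0" using f by (simp add: d_def)
    have "central_eigen n (scal (1 / d) * (power_free n f + scal (- string_sum M f)) * q)
       (\<lambda>\<Lambda>. 1 / d * (string_sum \<Lambda> f + - string_sum M f) * \<chi> \<Lambda>)"
      by (intro central_eigen_mult central_eigen_add central_eigen_scal central_eigen_power_free q(1))
    moreover have "1 / d * (string_sum \<Lambda> f + - string_sum M f) * \<chi> \<Lambda> = 1"
      using d q(2) by (simp add: d_def)
    moreover have "\<forall>N\<in>insert M S. 1 / d * (string_sum N f + - string_sum M f) * \<chi> N = 0"
      using q(3) by auto
    ultimately show ?case
      by (intro exI[of _ "scal (1 / d) * (power_free n f + scal (- string_sum M f)) * q"]
          exI[of _ "\<lambda>N. 1 / d * (string_sum N f + - string_sum M f) * \<chi> N"] conjI)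
  qed
  from this[of "strict_parts n - {\<Lambda>}"] show ?thesis using finite_strict_parts by auto
qed

text \<open>The eigenvalue is given at the standard word only. As q is central, the permutation
  operators spread it over the whole orbit, and then \<open>scalar_boundary_zero\<close> applies to
  the relation with \<zeta> f = 0.\<close>

lemma zeta_zero_eigenvalue:
  assumes rho: "diagonal_embedding n \<rho>" and zeta: "vogan_map n \<rho> \<zeta>"
    and q: "central_eigen n q \<chi>" and zero: "\<zeta> (H.cl n q) = \<zero>\<^bsub>T_alg n\<^esub>" and L: "\<Lambda> \<in> strict_parts n"
  shows "\<chi> \<Lambda> = 0"
proof -
  obtain p where "ordered_word n \<Lambda> (std_word n \<Lambda>) p" using std_word[OF L] by blast
  then interpret ordered_word n \<Lambda> "std_word n \<Lambda>" p .
  interpret HC': ring "HC n" by (rule ring_HC)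
  let ?f = "H.cl n q"
  have qc: "q \<in> fcar (hecke_gens n)" using q by (simp add: central_eigen_def)
  have f: "?f \<in> centre (hecke n)" using q by (rule central_eigen_centre)
  have fc: "?f \<in> carrier (hecke n)" using qc by simp
  have "\<rho> \<zero>\<^bsub>T_alg n\<^esub> = \<zero>\<^bsub>HC n\<^esub>"
    using rho by (intro alg_hom_zero ring_T_alg ring_HC) (simp add: diagonal_embedding_def)
  then obtain a where a: "a \<in> carrier (HC n)"
    and eq: "tensHC n ?f \<one>\<^bsub>cliff n\<^esub> = dirac n \<otimes>\<^bsub>HC n\<^esub> a \<oplus>\<^bsub>HC n\<^esub> a \<otimes>\<^bsub>HC n\<^esub> dirac n"
    using zeta_rel[OF rho zeta f] unfolding zero vogan_rel_def by auto
  have "app (opH n ?f) \<phi> x = \<chi> \<Lambda> * \<phi> x" if idx: "x \<in> idx" for \<phi> x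
  proof -
    obtain b I where b: "x = (b, I)" "b \<in> orbit" using idx unfolding idx_def by blast
    obtain v where v: "v permutes {1..n}" and "b = std_word n \<Lambda> \<circ> v"
      using b(2) unfolding orbit_def by blast
    with b have x: "x = (std_word n \<Lambda> \<circ> v, I)" by (simp only:)
    have vc: "gen (Perm v) \<in> fcar (hecke_gens n)" using v by simp
    have "H.commutes n (gen (Perm v)) q" using q vc by (simp add: central_eigen_def)
    then have eqv: "H.eqv n (gen (Perm v) * q) (q * gen (Perm v))"
      unfolding H.commutes_def by (rule H.eqv_sym)
    have "feval osc (gH n) (gen (Perm v) * q) = feval osc (gH n) (q * gen (Perm v))"
      by (rule H.feval_cong[OF osc.scalars_axioms gH_rels eqv])
    then have comm: "Wop v * feval osc (gH n) q = feval osc (gH n) q * Wop v"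
      by (simp add: osc.feval_mult feval_gH_perm)
    have W: "app (Wop v) \<psi> (std_word n \<Lambda>, I) = \<psi> (std_word n \<Lambda> \<circ> v, I)" for \<psi>
      by (simp add: Wop_def app_crossed lop_app)
    have "app (opH n ?f) \<phi> x = app (Wop v * feval osc (gH n) q) \<phi> (std_word n \<Lambda>, I)"
      using qc by (simp add: x opH_cl times_lop.rep_eq W)
    also have "\<dots> = app (feval osc (gH n) q) (app (Wop v) \<phi>) (std_word n \<Lambda>, I)"
      by (simp add: comm times_lop.rep_eq)
    also have "\<dots> = \<chi> \<Lambda> * \<phi> x"
      using q L by (simp add: central_eigen_def eigen_def W x)
    finally show ?thesis .
  qed
  then show ?thesis by (rule scalar_boundary_zero[OF fc a eq])
qed

section \<open>The even part of the centre of the twisted group algebra\<close>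

text \<open>Two lifts of one permutation to T_n can differ by a sign only, provided that their words
  are connected by Coxeter moves; \<open>coxeter_eqv_perm_eq\<close> guarantees the
  connection.\<close>

inductive coxeter_eqv :: "nat \<Rightarrow> nat list \<Rightarrow> nat list \<Rightarrow> bool" for n where
  refl: "coxeter_eqv n xs xs"
| sym: "coxeter_eqv n xs ys \<Longrightarrow> coxeter_eqv n ys xs"
| trans: "coxeter_eqv n xs ys \<Longrightarrow> coxeter_eqv n ys zs \<Longrightarrow> coxeter_eqv n xs zs"
| cong: "coxeter_eqv n xs ys \<Longrightarrow> set us \<subseteq> {1..<n} \<Longrightarrow> set vs \<subseteq> {1..<n} \<Longrightarrow> coxeter_eqv n (us @ xs @ vs) (us @ ys @ vs)"
| quad: "i \<in> {1..<n} \<Longrightarrow> coxeter_eqv n [i, i] []"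
| far: "i \<in> {1..<n} \<Longrightarrow> j \<in> {1..<n} \<Longrightarrow> Suc i < j \<Longrightarrow> coxeter_eqv n [i, j] [j, i]"
| braid: "i \<in> {1..<n} \<Longrightarrow> Suc i \<in> {1..<n} \<Longrightarrow> coxeter_eqv n [i, Suc i, i] [Suc i, i, Suc i]"

lemmas coxeter_eqv_trans [trans] = coxeter_eqv.trans

lemma coxeter_eqv_far: "i \<in> {1..<n} \<Longrightarrow> j \<in> {1..<n} \<Longrightarrow> Suc i < j \<or> Suc j < i \<Longrightarrow> coxeter_eqv n [i, j] [j, i]"
  by (auto intro: coxeter_eqv.far coxeter_eqv.sym[OF coxeter_eqv.far])

lemma coxeter_eqv_left: "coxeter_eqv n xs ys \<Longrightarrow> set us \<subseteq> {1..<n} \<Longrightarrow> coxeter_eqv n (us @ xs) (us @ ys)"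
  using coxeter_eqv.cong[of n xs ys us "[]"] by simp

lemma coxeter_eqv_right: "coxeter_eqv n xs ys \<Longrightarrow> set vs \<subseteq> {1..<n} \<Longrightarrow> coxeter_eqv n (xs @ vs) (ys @ vs)"
  using coxeter_eqv.cong[of n xs ys "[]" vs] by simp

lemma coxeter_eqv_mono: "coxeter_eqv m xs ys \<Longrightarrow> m \<le> n \<Longrightarrow> coxeter_eqv n xs ys"
proof (induction rule: coxeter_eqv.induct)
  case (cong xs ys us vs)
  then have "set us \<subseteq> {1..<n}" "set vs \<subseteq> {1..<n}" by fastforce+
  with cong show ?case by (intro coxeter_eqv.cong) auto
qed (auto intro: coxeter_eqv.refl coxeter_eqv.sym coxeter_eqv.quad coxeter_eqv.far coxeter_eqv.braid coxeter_eqv.trans)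

lemma coxeter_eqv_parity: "coxeter_eqv n xs ys \<Longrightarrow> even (length xs) = even (length ys)"
  by (induction rule: coxeter_eqv.induct) auto

lemma simple_refl_braid: "simple_refl i \<circ> (simple_refl (Suc i) \<circ> simple_refl i)
    = simple_refl (Suc i) \<circ> (simple_refl i \<circ> simple_refl (Suc i))"
  unfolding simple_refl_def by (rule ext) (simp add: transpose_def)

lemma simple_refl_far: "Suc i < j \<Longrightarrow> simple_refl i \<circ> simple_refl j = simple_refl j \<circ> simple_refl i"
  unfolding simple_refl_def by (rule ext) (simp add: transpose_def)

lemma simple_refl_square: "simple_refl i \<circ> simple_refl i = id"
  unfolding simple_refl_def by (rule ext) simp

lemma coxeter_eqv_perm_of: "coxeter_eqv n xs ys \<Longrightarrow> perm_of xs = perm_of ys"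
proof (induction rule: coxeter_eqv.induct)
  case (cong xs ys us vs)
  then show ?case by (simp only: perm_of_append)
next
  case (quad i)
  show ?case by (simp only: perm_of_Cons perm_of_Nil comp_id simple_refl_square)
next
  case (far i j)
  show ?case unfolding perm_of_Cons perm_of_Nil comp_id by (rule simple_refl_far[OF far(3)])
next
  case (braid i)
  show ?case by (simp only: perm_of_Cons perm_of_Nil comp_id simple_refl_braid)
qed simp_all

lemma coxeter_eqv_move:
  assumes "i \<in> {1..<n}" "\<And>j. j \<in> set zs \<Longrightarrow> j \<in> {1..<n} \<and> (Suc i < j \<or> Suc j < i)"
  shows "coxeter_eqv n (zs @ [i]) (i # zs)"
  using assms(2)
proof (induction zs)
  case Nil
  show ?case by (simp add: coxeter_eqv.refl)
next
  case (Cons z zs)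
  then have z: "z \<in> {1..<n}" "Suc i < z \<or> Suc z < i" and zs: "set zs \<subseteq> {1..<n}" by auto
  have "coxeter_eqv n ([z] @ (zs @ [i])) ([z] @ (i # zs))"
    using Cons z by (intro coxeter_eqv_left) auto
  also have "[z] @ (i # zs) = [z, i] @ zs" by simp
  also have "coxeter_eqv n \<dots> ([i, z] @ zs)"
    using z assms(1) zs by (intro coxeter_eqv_right coxeter_eqv_far) auto
  finally show ?case by simp
qed

text \<open>The word n-1, n-2, ..., k, whose permutation sends k to n.\<close>

definition down :: "nat \<Rightarrow> nat \<Rightarrow> nat list" where
  "down n k = rev [k..<n]"

lemma set_down: "set (down n k) = {k..<n}"
  by (simp add: down_def)

lemma down_Suc: "k < n \<Longrightarrow> down n k = down n (Suc k) @ [k]"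
  by (simp add: down_def upt_conv_Cons)

lemma down_split: "k \<le> i \<Longrightarrow> i \<le> n \<Longrightarrow> down n k = down n i @ down i k"
  using upt_add_eq_append[of k i "n - i"] by (simp add: down_def)

text \<open>
  Minimal coset representatives for the subgroup fixing \<open>n\<close>, which give the Coxeter presentation by
  induction on \<open>n\<close>.
\<close>

lemma coxeter_eqv_normal_form:
  assumes "1 \<le> n" "set xs \<subseteq> {1..<n}"
  shows "\<exists>ys k. set ys \<subseteq> {1..<n - 1} \<and> 1 \<le> k \<and> k \<le> n \<and> coxeter_eqv n xs (ys @ down n k)"
  using assms(2)
proof (induction xs rule: rev_induct)
  case Nil
  show ?case
    using assms(1) by (intro exI[of _ "[]"] exI[of _ n]) (simp add: down_def coxeter_eqv.refl)
next
  case (snoc i xs)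
  then have i: "i \<in> {1..<n}" by simp
  from snoc obtain ys k where ys: "set ys \<subseteq> {1..<n - 1}" and k: "1 \<le> k" "k \<le> n"
    and coxeter_eqv: "coxeter_eqv n xs (ys @ down n k)" by auto
  have ys': "set ys \<subseteq> {1..<n}" using ys by fastforce
  have step: "coxeter_eqv n (xs @ [i]) (ys @ (down n k @ [i]))"
    using coxeter_eqv_right[OF coxeter_eqv, of "[i]"] i by simp
  consider "Suc i = k" | "i = k" | "Suc i < k" | "k < i" by linarith
  then show ?case
  proof cases
    \<comment> \<open>The letter extends the descending run.\<close>
    case 1
    then have "down n k @ [i] = down n i" using down_Suc[of i n] i by simp
    with step ys i show ?thesis by (intro exI[of _ ys] exI[of _ i]) auto
  next
    case 2
    then have "k < n" using i by simp
    have "coxeter_eqv n (down n (Suc k) @ [k, k]) (down n (Suc k) @ [])"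
      using 2 i k by (intro coxeter_eqv_left coxeter_eqv.quad) (auto simp: set_down)
    then have "coxeter_eqv n (down n k @ [i]) (down n (Suc k))"
      using 2 down_Suc[OF \<open>k < n\<close>] by simp
    then have "coxeter_eqv n (xs @ [i]) (ys @ down n (Suc k))"
      by (rule coxeter_eqv.trans[OF step coxeter_eqv_left[OF _ ys']])
    with ys \<open>k < n\<close> show ?thesis by (intro exI[of _ ys] exI[of _ "Suc k"]) auto
  next
    case 3
    then have "coxeter_eqv n (down n k @ [i]) (i # down n k)"
      using i k by (intro coxeter_eqv_move) (auto simp: set_down)
    then have "coxeter_eqv n (xs @ [i]) (ys @ (i # down n k))"
      by (rule coxeter_eqv.trans[OF step coxeter_eqv_left[OF _ ys']])
    with ys k 3 i show ?thesis by (intro exI[of _ "ys @ [i]"] exI[of _ k]) auto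
  next
    \<comment> \<open>The letter i meets the run beyond its end. It slides left until it stands
      behind i, i-1; a braid move turns it into i-1, which slides out at the left end of the run and
      joins \<open>ys\<close>.\<close>
    case 4
    then obtain h where h: "i = Suc h" "k \<le> h" by (cases i) auto
    have in': "h \<in> {1..<n}" "Suc h \<in> {1..<n}" using h i k by auto
    have dn: "down n k = down n (Suc i) @ [i, h] @ down h k"
    proof -
      have "down n k = down n (Suc i) @ down (Suc i) k" using h i by (intro down_split) auto
      also have "down (Suc i) k = i # down i k" using h by (simp add: down_def)
      also have "down i k = h # down h k" using h by (simp add: down_def)
      finally show ?thesis by simp
    qed
    have sub: "set (down n (Suc i)) \<subseteq> {1..<n}" "set (down h k) \<subseteq> {1..<n}"
      using h i k by (auto simp: set_down)
    have "coxeter_eqv n (down h k @ [i]) (i # down h k)"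
      using h i k by (intro coxeter_eqv_move) (auto simp: set_down)
    then have "coxeter_eqv n ((down n (Suc i) @ [i, h]) @ (down h k @ [i])) ((down n (Suc i) @ [i, h]) @ (i # down h k))"
      using sub in' h by (intro coxeter_eqv_left) auto
    also have "(down n (Suc i) @ [i, h]) @ (i # down h k) = down n (Suc i) @ [Suc h, h, Suc h] @ down h k"
      using h by simp
    also have "coxeter_eqv n \<dots> (down n (Suc i) @ [h, Suc h, h] @ down h k)"
      using sub in' by (intro coxeter_eqv.cong coxeter_eqv.sym[OF coxeter_eqv.braid])
    also have "down n (Suc i) @ [h, Suc h, h] @ down h k = (down n (Suc i) @ [h]) @ ([i, h] @ down h k)"
      using h by simp
    also have "coxeter_eqv n \<dots> ((h # down n (Suc i)) @ ([i, h] @ down h k))"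
      using sub in' h by (intro coxeter_eqv_right coxeter_eqv_move) (auto simp: set_down)
    finally have "coxeter_eqv n (down n k @ [i]) (h # down n k)"
      by (simp add: dn)
    then have "coxeter_eqv n (xs @ [i]) (ys @ (h # down n k))"
      by (rule coxeter_eqv.trans[OF step coxeter_eqv_left[OF _ ys']])
    with ys k h i show ?thesis by (intro exI[of _ "ys @ [h]"] exI[of _ k]) auto
  qed
qed

lemma perm_of_down: "k \<le> n \<Longrightarrow> perm_of (down n k) k = n"
proof (induction n rule: dec_induct)
  case base
  show ?case by (simp add: down_def perm_of_Nil)
next
  case (step n)
  then have "down (Suc n) k = n # down n k" by (simp add: down_def)
  with step show ?case by (simp add: perm_of_Cons simple_refl_def)
qed

text \<open>The run sends k to m+1, which \<open>ys\<close> fixes. For the identity this forces k =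
  m+1, so the run is empty and \<open>ys\<close> is a word for the identity in fewer
  generators.\<close>

lemma coxeter_eqv_identity: "set xs \<subseteq> {1..<n} \<Longrightarrow> perm_of xs = id \<Longrightarrow> coxeter_eqv n xs []"
proof (induction n arbitrary: xs)
  case (Suc m)
  obtain ys k where ys: "set ys \<subseteq> {1..<m}" and k: "1 \<le> k" "k \<le> Suc m"
    and coxeter_eqv: "coxeter_eqv (Suc m) xs (ys @ down (Suc m) k)"
    using coxeter_eqv_normal_form[of "Suc m" xs] Suc.prems(1) by auto
  have perm: "perm_of ys \<circ> perm_of (down (Suc m) k) = id"
    using coxeter_eqv_perm_of[OF coxeter_eqv] Suc.prems(2) by (simp only: perm_of_append)
  have "perm_of ys (Suc m) = Suc m"
    by (rule permutes_not_in[OF perm_of_permutes[OF ys]]) simp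
  then have "k = Suc m"
    using fun_cong[OF perm, of k] perm_of_down[OF k(2)] by simp
  then have nil: "down (Suc m) k = []" by (simp add: down_def)
  have "perm_of ys = id" using perm unfolding nil perm_of_Nil comp_id .
  from coxeter_eqv_mono[OF Suc.IH[OF ys this]] have "coxeter_eqv (Suc m) ys []" by simp
  with coxeter_eqv[unfolded nil append_Nil2] show ?case by (rule coxeter_eqv.trans)
qed (simp add: coxeter_eqv.refl)

lemma perm_of_rev: "perm_of xs \<circ> perm_of (rev xs) = id"
proof (induction xs)
  case (Cons x xs)
  have "perm_of (x # xs) \<circ> perm_of (rev (x # xs))
     = simple_refl x \<circ> ((perm_of xs \<circ> perm_of (rev xs)) \<circ> simple_refl x)"
    by (simp only: perm_of_Cons perm_of_append rev.simps perm_of_Nil comp_id comp_assoc)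
  then show ?case by (simp only: Cons id_comp simple_refl_square)
qed (simp only: rev.simps perm_of_Nil id_comp)

lemma coxeter_eqv_perm_eq:
  assumes xs: "set xs \<subseteq> {1..<n}" and ys: "set ys \<subseteq> {1..<n}" and eq: "perm_of xs = perm_of ys"
  shows "coxeter_eqv n xs ys"
proof -
  have "perm_of (xs @ rev ys) = id" by (simp only: perm_of_append eq perm_of_rev)
  then have "coxeter_eqv n (xs @ rev ys) []" using xs ys by (intro coxeter_eqv_identity) auto
  from coxeter_eqv_right[OF this ys] have 1: "coxeter_eqv n (xs @ rev ys @ ys) ys" by simp
  have "perm_of (rev ys @ ys) = id"
    using perm_of_rev[of "rev ys"] by (simp only: perm_of_append rev_rev_ident)
  then have "coxeter_eqv n (rev ys @ ys) []" using ys by (intro coxeter_eqv_identity) auto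
  from coxeter_eqv_left[OF this xs] have "coxeter_eqv n (xs @ rev ys @ ys) xs" by simp
  from coxeter_eqv.trans[OF coxeter_eqv.sym[OF this] 1] show ?thesis .
qed

section \<open>Lifts of permutations in T_n up to sign\<close>

lemma fcar_mon_T: "set xs \<subseteq> {1..<n} \<Longrightarrow> mon xs \<in> fcar (T_gens n)"
  by (intro fcar_mon) (simp add: T_gens_def)

lemma T_square: "i \<in> {1..<n} \<Longrightarrow> T.eqv n (gen i * gen i) 1"
proof -
  assume "i \<in> {1..<n}"
  then have "gen i ^ 2 - 1 \<in> T_rels n" unfolding T_rels_def by blast
  then show ?thesis unfolding power2_eq_square by (rule T.eqv_rel)
qed

text \<open>Multiply (\<tau>_i \<tau>_j)^2 = -1 on the left by \<tau>_j \<tau>_i and cancel the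
  squares.\<close>

lemma T_anticommute:
  assumes i: "i \<in> {1..<n}" and j: "j \<in> {1..<n}" and far: "Suc i < j \<or> Suc j < i"
  shows "T.eqv n (gen i * gen j) (- (gen j * gen i))"
proof -
  let ?i = "gen i :: nat free" and ?j = "gen j :: nat free"
  have c: "?i \<in> fcar (T_gens n)" "?j \<in> fcar (T_gens n)" using i j by (auto intro: fcar_gen_T)
  have "\<bar>int i - int j\<bar> > 1" using far by auto
  from T_eqv_far[OF i j this] have sq: "T.eqv n (?i * ?j * (?i * ?j)) (- 1)" by (simp add: power2_eq_square)
  have "T.eqv n (?j * (?i * ?i) * (?j * (?i * ?j))) (?j * 1 * (?j * (?i * ?j)))"
    using c by (intro T.eqv_mult_right T.eqv_mult_left T_square i fcar_mult)
  also have "?j * 1 * (?j * (?i * ?j)) = (?j * ?j) * (?i * ?j)" by (simp add: mult.assoc)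
  also have "T.eqv n \<dots> (1 * (?i * ?j))"
    using c by (intro T.eqv_mult_right T_square j fcar_mult)
  finally have 1: "T.eqv n (?j * (?i * ?i) * (?j * (?i * ?j))) (?i * ?j)" by simp
  have "T.eqv n (?j * ?i * (?i * ?j * (?i * ?j))) (?j * ?i * (- 1))"
    using c by (intro T.eqv_mult_left sq fcar_mult)
  then have 2: "T.eqv n (?j * (?i * ?i) * (?j * (?i * ?j))) (- (?j * ?i))"
    by (simp add: mult.assoc)
  from T.eqv_trans[OF T.eqv_sym[OF 1] 2] show ?thesis .
qed

text \<open>Multiply (\<tau>_i \<tau>_j)^3 = 1, with j = i+1, on the right by \<tau>_j \<tau>_i
  \<tau>_j and cancel the squares.\<close>

lemma T_braid:
  assumes i: "i \<in> {1..<n}" and j: "Suc i \<in> {1..<n}"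
  shows "T.eqv n (gen i * gen (Suc i) * gen i) (gen (Suc i) * gen i * gen (Suc i))"
proof -
  let ?i = "gen i :: nat free" and ?j = "gen (Suc i) :: nat free"
  have c: "?i \<in> fcar (T_gens n)" "?j \<in> fcar (T_gens n)" using i j by (auto intro: fcar_gen_T)
  have "(?i * ?j) ^ 3 - 1 \<in> T_rels n" using i j unfolding T_rels_def by blast
  then have cube: "T.eqv n (?i * ?j * (?i * ?j * (?i * ?j))) 1"
    unfolding power3_eq_cube mult.assoc by (rule T.eqv_rel)
  have 1: "T.eqv n (?i * ?j * (?i * ?j * (?i * ?j)) * (?j * ?i * ?j)) (1 * (?j * ?i * ?j))"
    using c by (intro T.eqv_mult_right cube fcar_mult)
  have "T.eqv n (?i * ?j * (?i * ?j * (?i * ?j)) * (?j * ?i * ?j)) (?i * ?j * ?i)"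
  proof -
    have "?i * ?j * (?i * ?j * (?i * ?j)) * (?j * ?i * ?j) = ?i * ?j * ?i * ?j * ?i * (?j * ?j) * (?i * ?j)"
      by (simp add: mult.assoc)
    also have "T.eqv n \<dots> (?i * ?j * ?i * ?j * ?i * 1 * (?i * ?j))"
      using c by (intro T.eqv_mult_right T.eqv_mult_left T_square j fcar_mult)
    also have "?i * ?j * ?i * ?j * ?i * 1 * (?i * ?j) = ?i * ?j * ?i * ?j * (?i * ?i) * ?j"
      by (simp add: mult.assoc)
    also have "T.eqv n \<dots> (?i * ?j * ?i * ?j * 1 * ?j)"
      using c by (intro T.eqv_mult_right T.eqv_mult_left T_square i fcar_mult)
    also have "?i * ?j * ?i * ?j * 1 * ?j = ?i * ?j * ?i * (?j * ?j)"
      by (simp add: mult.assoc)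
    also have "T.eqv n \<dots> (?i * ?j * ?i * 1)"
      using c by (intro T.eqv_mult_left T_square j fcar_mult)
    finally show ?thesis by simp
  qed
  from T.eqv_trans[OF T.eqv_sym[OF this] 1] show ?thesis by simp
qed

definition sign_eqv :: "nat \<Rightarrow> nat free \<Rightarrow> nat free \<Rightarrow> bool" where
  "sign_eqv n p q \<longleftrightarrow> T.eqv n p q \<or> T.eqv n p (- q)"

lemma sign_eqv_refl: "sign_eqv n p p"
  by (simp add: sign_eqv_def)

lemma sign_eqv_sym: "sign_eqv n p q \<Longrightarrow> sign_eqv n q p"
  unfolding sign_eqv_def using T.eqv_sym[of n p q] T.eqv_sym[OF T.eqv_minus[of n p "- q"]] by auto

lemma sign_eqv_trans: "sign_eqv n p q \<Longrightarrow> sign_eqv n q r \<Longrightarrow> sign_eqv n p r"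
  unfolding sign_eqv_def
  using T.eqv_trans[of n p q r] T.eqv_trans[of n p q "- r"] T.eqv_trans[of n p "- q" "- r"]
    T.eqv_trans[of n p "- q" r] T.eqv_minus[of n q r] T.eqv_minus[of n q "- r"] by auto

lemma sign_eqv_mult_left: "sign_eqv n p q \<Longrightarrow> r \<in> fcar (T_gens n) \<Longrightarrow> sign_eqv n (r * p) (r * q)"
  unfolding sign_eqv_def using T.eqv_mult_left[of n p q r] T.eqv_mult_left[of n p "- q" r] by auto

lemma sign_eqv_mult_right: "sign_eqv n p q \<Longrightarrow> r \<in> fcar (T_gens n) \<Longrightarrow> sign_eqv n (p * r) (q * r)"
  unfolding sign_eqv_def using T.eqv_mult_right[of n p q r] T.eqv_mult_right[of n p "- q" r] by auto

lemma coxeter_eqv_sign_eqv: "coxeter_eqv n xs ys \<Longrightarrow> sign_eqv n (mon xs) (mon ys)"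
proof (induction rule: coxeter_eqv.induct)
  case (refl xs)
  show ?case by (rule sign_eqv_refl)
next
  case (sym xs ys)
  show ?case by (rule sign_eqv_sym[OF sym.IH])
next
  case (trans xs ys zs)
  show ?case by (rule sign_eqv_trans[OF trans.IH])
next
  case (cong xs ys us vs)
  then show ?case
    unfolding mon_append by (intro sign_eqv_mult_left sign_eqv_mult_right fcar_mon_T)
next
  case (quad i)
  then show ?case using T_square[of i n] by (simp add: sign_eqv_def mon_Cons)
next
  case (far i j)
  then show ?case using T_anticommute[of i n j] by (simp add: sign_eqv_def mon_Cons)
next
  case (braid i)
  then show ?case using T_braid[of i n] by (simp add: sign_eqv_def mon_Cons mult.assoc)
qed

lemma mon_rev_right: "set xs \<subseteq> {1..<n} \<Longrightarrow> T.eqv n (mon xs * mon (rev xs)) 1"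
proof (induction xs)
  case (Cons x xs)
  then have c: "gen x \<in> fcar (T_gens n)" "x \<in> {1..<n}" by (auto intro: fcar_gen_T)
  have "mon (x # xs) * mon (rev (x # xs)) = gen x * (mon xs * mon (rev xs)) * gen x"
    by (simp add: mon_Cons mon_append mult.assoc)
  also have "T.eqv n \<dots> (gen x * 1 * gen x)"
    using Cons c by (intro T.eqv_mult_right T.eqv_mult_left) auto
  also have "gen x * 1 * gen x = gen x * gen x" by simp
  also have "T.eqv n \<dots> 1" by (rule T_square[OF c(2)])
  finally show ?case .
qed simp

lemma mon_rev_left: "set xs \<subseteq> {1..<n} \<Longrightarrow> T.eqv n (mon (rev xs) * mon xs) 1"
  using mon_rev_right[of "rev xs" n] by simp

text \<open>The reversed word is the inverse of the word, because every generator squares to 1 in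
  T_n.\<close>

definition conj_by :: "nat list \<Rightarrow> nat free \<Rightarrow> nat free" where
  "conj_by xs p = mon xs * p * mon (rev xs)"

lemma conj_by_fcar: "set xs \<subseteq> {1..<n} \<Longrightarrow> p \<in> fcar (T_gens n) \<Longrightarrow> conj_by xs p \<in> fcar (T_gens n)"
  unfolding conj_by_def by (intro fcar_mult fcar_mon_T) auto

lemma conj_by_append: "conj_by (xs @ ys) p = conj_by xs (conj_by ys p)"
  by (simp add: conj_by_def mon_append mult.assoc)

lemma conj_by_cong: "T.eqv n p q \<Longrightarrow> set xs \<subseteq> {1..<n} \<Longrightarrow> T.eqv n (conj_by xs p) (conj_by xs q)"
  unfolding conj_by_def by (intro T.eqv_mult_right T.eqv_mult_left fcar_mon_T) auto

lemma sign_eqv_cases: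
  assumes "sign_eqv n p q"
  obtains e where "e = 1 \<or> e = - 1" "T.eqv n p (scal e * q)"
proof -
  have "T.eqv n p (scal 1 * q) \<or> T.eqv n p (scal (- 1) * q)"
    using assms by (simp add: sign_eqv_def scal_minus)
  then show thesis using that by blast
qed

text \<open>The lift and its inverse change by the same sign e, and e squares to 1.\<close>

lemma conj_by_perm:
  assumes xs: "set xs \<subseteq> {1..<n}" and ys: "set ys \<subseteq> {1..<n}" and eq: "perm_of xs = perm_of ys"
    and p: "p \<in> fcar (T_gens n)"
  shows "T.eqv n (conj_by xs p) (conj_by ys p)"
proof -
  obtain e where e: "e = 1 \<or> e = - 1" and xy: "T.eqv n (mon xs) (scal e * mon ys)"
    using coxeter_eqv_sign_eqv[OF coxeter_eqv_perm_eq[OF xs ys eq]] by (rule sign_eqv_cases)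
  have ee: "scal e * (scal e * q) = q" for q :: "nat free"
    using e by (auto simp: scal_minus)
  have swap: "a * (scal e * b) = scal e * (a * b)" for a b :: "nat free"
    using e by (auto simp: scal_minus)
  have c: "mon xs \<in> fcar (T_gens n)" "mon (rev xs) \<in> fcar (T_gens n)" "mon ys \<in> fcar (T_gens n)"
    "mon (rev ys) \<in> fcar (T_gens n)"
    using xs ys by (auto intro!: fcar_mon_T)
  have "T.eqv n (scal e * mon xs) (scal e * (scal e * mon ys))"
    by (intro T.eqv_mult_left xy fcar_scal)
  then have yx: "T.eqv n (mon ys) (scal e * mon xs)" unfolding ee by (rule T.eqv_sym)
  have 1: "T.eqv n (mon (rev xs) * mon ys * mon (rev ys)) (mon (rev xs))"
    using T.eqv_mult_left[OF mon_rev_right[OF ys] c(2)] by (simp add: mult.assoc)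
  have "T.eqv n (mon (rev xs) * mon ys * mon (rev ys)) (mon (rev xs) * (scal e * mon xs) * mon (rev ys))"
    using c by (intro T.eqv_mult_right T.eqv_mult_left yx)
  also have "mon (rev xs) * (scal e * mon xs) * mon (rev ys) = scal e * (mon (rev xs) * mon xs) * mon (rev ys)"
    unfolding swap[of "mon (rev xs)"] ..
  also have "T.eqv n \<dots> (scal e * 1 * mon (rev ys))"
    using c by (intro T.eqv_mult_right T.eqv_mult_left mon_rev_left xs fcar_scal)
  finally have 2: "T.eqv n (mon (rev xs) * mon ys * mon (rev ys)) (scal e * mon (rev ys))" by simp
  have rev: "T.eqv n (mon (rev xs)) (scal e * mon (rev ys))"
    by (rule T.eqv_trans[OF T.eqv_sym[OF 1] 2])
  have "T.eqv n (mon xs * p * mon (rev xs)) (scal e * mon ys * p * mon (rev xs))"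
    using c p by (intro T.eqv_mult_right xy)
  also have "T.eqv n \<dots> (scal e * mon ys * p * (scal e * mon (rev ys)))"
    using c p by (intro T.eqv_mult_left rev fcar_mult fcar_scal)
  also have "scal e * mon ys * p * (scal e * mon (rev ys)) = scal e * (scal e * (mon ys * p * mon (rev ys)))"
    unfolding swap[of "scal e * mon ys * p"] by (simp only: mult.assoc)
  also have "\<dots> = mon ys * p * mon (rev ys)" by (rule ee)
  finally show ?thesis by (simp add: conj_by_def)
qed

section \<open>Averaging over conjugates\<close>

definition word_of :: "nat \<Rightarrow> (nat \<Rightarrow> nat) \<Rightarrow> nat list" where
  "word_of n w = (SOME xs. set xs \<subseteq> {1..<n} \<and> perm_of xs = w)"

lemma word_of: "w permutes {1..n} \<Longrightarrow> set (word_of n w) \<subseteq> {1..<n} \<and> perm_of (word_of n w) = w"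
  unfolding word_of_def by (rule someI_ex) (rule permutation_word)

text \<open>One lift is chosen for each permutation; by \<open>conj_by_perm\<close> the choice does
  not affect the class. The factor normalises the average so that it fixes central elements.\<close>

definition average :: "nat \<Rightarrow> nat free \<Rightarrow> nat free" where
  "average n p = scal (1 / fact n) * (\<Sum>w | w permutes {1..n}. conj_by (word_of n w) p)"

lemma average_fcar: "p \<in> fcar (T_gens n) \<Longrightarrow> average n p \<in> fcar (T_gens n)"
  unfolding average_def by (intro fcar_mult fcar_scal fcar_sum conj_by_fcar) (auto simp: word_of)

lemma average_cong: "T.eqv n p q \<Longrightarrow> T.eqv n (average n p) (average n q)"
  unfolding average_def by (intro T.eqv_mult_left T.eqv_sum conj_by_cong fcar_scal) (auto simp: word_of)

lemma scal_left_commute: "p * (scal c * q) = scal c * (p * q)"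
  unfolding mult.assoc[symmetric] scal_central[of c p] ..

lemma conj_by_scal: "conj_by xs (scal c * p) = scal c * conj_by xs p"
  unfolding conj_by_def scal_left_commute mult.assoc ..

lemma average_scal: "average n (scal c * p) = scal c * average n p"
  unfolding average_def conj_by_scal sum_distrib_left[symmetric] by (rule scal_left_commute)

lemma average_add: "average n (p + q) = average n p + average n q"
  by (simp add: average_def conj_by_def distrib_left distrib_right sum.distrib)

lemma average_0: "average n 0 = 0"
  by (simp add: average_def conj_by_def)

lemma average_minus: "average n (- p) = - average n p"
  using average_scal[of n "- 1" p] by (simp add: scal_minus)

lemma average_sum: "average n (sum f S) = (\<Sum>i\<in>S. average n (f i))"
  by (induction S rule: infinite_finite_induct) (simp_all add: average_0 average_add)

text \<open>The sum over permutations is reindexed by right composition with the permutation of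
  \<open>ys\<close>.\<close>

lemma average_conj_by:
  assumes ys: "set ys \<subseteq> {1..<n}" and p: "p \<in> fcar (T_gens n)"
  shows "T.eqv n (average n (conj_by ys p)) (average n p)"
proof -
  have "T.eqv n (conj_by (word_of n w) (conj_by ys p)) (conj_by (word_of n (w \<circ> perm_of ys)) p)"
    if "w \<in> {w. w permutes {1..n}}" for w
  proof -
    have w: "w permutes {1..n}" using that by simp
    have wy: "(w \<circ> perm_of ys) permutes {1..n}"
      by (rule permutes_compose[OF perm_of_permutes[OF ys] w])
    have "perm_of (word_of n w @ ys) = perm_of (word_of n (w \<circ> perm_of ys))"
      unfolding perm_of_append conjunct2[OF word_of[OF w]] conjunct2[OF word_of[OF wy]] ..
    then have "T.eqv n (conj_by (word_of n w @ ys) p) (conj_by (word_of n (w \<circ> perm_of ys)) p)"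
      using word_of[OF w] word_of[OF wy] ys p by (intro conj_by_perm) auto
    then show ?thesis unfolding conj_by_append .
  qed
  then have "T.eqv n (average n (conj_by ys p))
      (scal (1 / fact n) * (\<Sum>w | w permutes {1..n}. conj_by (word_of n (w \<circ> perm_of ys)) p))"
    unfolding average_def by (intro T.eqv_mult_left T.eqv_sum fcar_scal)
  also have "(\<Sum>w | w permutes {1..n}. conj_by (word_of n (w \<circ> perm_of ys)) p)
      = (\<Sum>w | w permutes {1..n}. conj_by (word_of n w) p)"
    by (rule sum_permutations_compose_right[OF perm_of_permutes[OF ys], symmetric])
  finally show ?thesis unfolding average_def .
qed

lemma scal_of_nat: "scal (of_nat k) = of_nat k"
  by (induction k) (simp_all add: scal_add)

lemma average_central:
  assumes z: "T.cl n p \<in> centre (T_alg n)" and p: "p \<in> fcar (T_gens n)"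
  shows "T.eqv n (average n p) p"
proof -
  have "T.eqv n (conj_by xs p) p" if xs: "set xs \<subseteq> {1..<n}" for xs
  proof -
    have c: "mon xs \<in> fcar (T_gens n)" "mon (rev xs) \<in> fcar (T_gens n)"
      using xs by (auto intro!: fcar_mon_T)
    have "T.cl n (mon xs) \<otimes>\<^bsub>T_alg n\<^esub> T.cl n p = T.cl n p \<otimes>\<^bsub>T_alg n\<^esub> T.cl n (mon xs)"
      using z c unfolding centre_def by simp
    then have "T.eqv n (mon xs * p) (p * mon xs)"
      using T.cl_eq_iff[of "mon xs * p" n "p * mon xs"] c p by (simp add: T_ops)
    then have "T.eqv n (mon xs * p * mon (rev xs)) (p * mon xs * mon (rev xs))"
      by (rule T.eqv_mult_right[OF _ c(2)])
    also have "p * mon xs * mon (rev xs) = p * (mon xs * mon (rev xs))" by (simp add: mult.assoc)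
    also have "T.eqv n \<dots> (p * 1)" by (rule T.eqv_mult_left[OF mon_rev_right[OF xs] p])
    finally show ?thesis by (simp add: conj_by_def)
  qed
  then have "T.eqv n (average n p) (scal (1 / fact n) * (\<Sum>w | w permutes {1..n}. p))"
    unfolding average_def by (intro T.eqv_mult_left T.eqv_sum fcar_scal) (auto simp: word_of)
  also have "(\<Sum>w | w permutes {1..n}. p) = scal (of_nat (fact n)) * p"
    unfolding scal_of_nat sum_constant using card_permutations[of "{1..n}" n] by simp
  also have "scal (1 / fact n) * (scal (of_nat (fact n)) * p) = p"
    by (simp add: mult.assoc[symmetric] scal_mult[symmetric])
  finally show ?thesis .
qed

lemma T_eqv_neg_zero:
  assumes p: "p \<in> fcar (T_gens n)" and neg: "T.eqv n p (- p)"
  shows "T.eqv n p 0"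
proof -
  have "T.eqv n (scal (1 / 2) * (p + p)) (scal (1 / 2) * (- p + p))"
    by (intro T.eqv_mult_left T.eqv_add neg T.eqv_refl fcar_scal)
  also have "scal (1 / 2) * (- p + p) = 0" by simp
  finally show ?thesis
    by (simp add: distrib_left distrib_right[symmetric] scal_add[symmetric])
qed

text \<open>Conjugating ab by a gives a(ab)a^-1 = -a(ba)a^-1 = -ab. The average does not see
  conjugation, so it equals its own negative.\<close>

lemma average_anticommuting:
  assumes a: "set a \<subseteq> {1..<n}" and b: "set b \<subseteq> {1..<n}"
    and anti: "T.eqv n (mon a * mon b) (- (mon b * mon a))"
  shows "T.eqv n (average n (mon (a @ b))) 0"
proof -
  have c: "mon a \<in> fcar (T_gens n)" "mon b \<in> fcar (T_gens n)" "mon (rev a) \<in> fcar (T_gens n)"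
    using a b by (auto intro!: fcar_mon_T)
  have "T.eqv n (mon a * (mon a * mon b) * mon (rev a)) (mon a * (- (mon b * mon a)) * mon (rev a))"
    using c by (intro T.eqv_mult_right T.eqv_mult_left anti)
  also have "mon a * (- (mon b * mon a)) * mon (rev a) = - (mon a * mon b * (mon a * mon (rev a)))"
    by (simp add: mult.assoc)
  also have "T.eqv n \<dots> (- (mon a * mon b * 1))"
    using c by (intro T.eqv_minus T.eqv_mult_left mon_rev_right a fcar_mult)
  finally have "T.eqv n (conj_by a (mon (a @ b))) (- mon (a @ b))"
    by (simp add: conj_by_def mon_append)
  from average_cong[OF this] have 1: "T.eqv n (average n (conj_by a (mon (a @ b)))) (- average n (mon (a @ b)))"
    unfolding average_minus .
  have ab: "mon (a @ b) \<in> fcar (T_gens n)" using c by (simp add: mon_append)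
  from T.eqv_trans[OF T.eqv_sym[OF average_conj_by[OF a ab]] 1] show ?thesis
    by (rule T_eqv_neg_zero[OF average_fcar[OF ab]])
qed

section \<open>Block words, cycle types and averages of even words\<close>

lemma mon_far_commute:
  assumes a: "set a \<subseteq> {1..<n}" and b: "set b \<subseteq> {1..<n}"
    and far: "\<And>i j. i \<in> set a \<Longrightarrow> j \<in> set b \<Longrightarrow> Suc i < j"
  shows "T.eqv n (mon a * mon b) (scal ((- 1) ^ (length a * length b)) * (mon b * mon a))"
proof -
  have one: "T.eqv n (gen i * mon b) (scal ((- 1) ^ length b) * (mon b * gen i))"
    if "i \<in> {1..<n}" "set b \<subseteq> {1..<n}" "\<And>j. j \<in> set b \<Longrightarrow> Suc i < j" for i b
    using that(2,3)
  proof (induction b)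
    case (Cons j b)
    have c: "gen i \<in> fcar (T_gens n)" "gen j \<in> fcar (T_gens n)" "mon b \<in> fcar (T_gens n)"
      using that(1) Cons.prems by (auto intro!: fcar_mon_T fcar_gen_T)
    have "gen i * mon (j # b) = gen i * gen j * mon b" by (simp add: mon_Cons mult.assoc)
    also have "T.eqv n \<dots> (- (gen j * gen i) * mon b)"
      using Cons.prems that(1) by (intro T.eqv_mult_right T_anticommute c) auto
    also have "- (gen j * gen i) * mon b = scal (- 1) * gen j * (gen i * mon b)"
      by (simp add: mult.assoc scal_minus)
    also have "T.eqv n \<dots> (scal (- 1) * gen j * (scal ((- 1) ^ length b) * (mon b * gen i)))"
      using Cons by (intro T.eqv_mult_left Cons.IH fcar_mult fcar_scal c) auto
    also have "\<dots> = scal ((- 1) ^ length (j # b)) * (mon (j # b) * gen i)"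
      unfolding scal_mult_swap by (simp add: mon_Cons mult.assoc)
    finally show ?case .
  qed simp
  have merge: "scal x * (scal y * q) = scal (x * y) * q" for x y and q :: "nat free"
    by (simp add: scal_mult mult.assoc)
  show ?thesis
    using a far
  proof (induction a)
    case (Cons i a)
    have c: "gen i \<in> fcar (T_gens n)" "mon b \<in> fcar (T_gens n)" "mon a \<in> fcar (T_gens n)"
      using b Cons.prems by (auto intro!: fcar_mon_T fcar_gen_T)
    have "mon (i # a) * mon b = gen i * (mon a * mon b)" by (simp add: mon_Cons mult.assoc)
    also have "T.eqv n \<dots> (gen i * (scal ((- 1) ^ (length a * length b)) * (mon b * mon a)))"
      using Cons by (intro T.eqv_mult_left Cons.IH c) auto
    also have "\<dots> = scal ((- 1) ^ (length a * length b)) * (gen i * mon b * mon a)"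
      unfolding scal_left_commute mult.assoc ..
    also have "T.eqv n \<dots> (scal ((- 1) ^ (length a * length b)) * (scal ((- 1) ^ length b) * (mon b * gen i) * mon a))"
      using Cons.prems b by (intro T.eqv_mult_left T.eqv_mult_right one c fcar_scal) auto
    also have "\<dots> = scal ((- 1) ^ (length (i # a) * length b)) * (mon b * mon (i # a))"
      by (simp add: mon_Cons mult.assoc merge power_add[symmetric] add.commute)
    finally show ?case .
  qed simp
qed

text \<open>The permutation of \<open>block_word 0 cs\<close> is a product of cycles of lengths \<open>cs\<close> on consecutive intervals.\<close>

fun block_word :: "nat \<Rightarrow> nat list \<Rightarrow> nat list" where
  "block_word k [] = []"
| "block_word k (c # cs) = [Suc k..<k + c] @ block_word (k + c) cs"

lemma set_block_word: "set (block_word k cs) \<subseteq> {Suc k..<k + sum_list cs}"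
proof (induction cs arbitrary: k)
  case (Cons c cs)
  have "set (block_word (k + c) cs) \<subseteq> {Suc (k + c)..<k + c + sum_list cs}" by (rule Cons)
  then show ?case by fastforce
qed simp

lemma perm_of_fixes: "set xs \<subseteq> {a..<b} \<Longrightarrow> i < a \<or> b < i \<Longrightarrow> perm_of xs i = i"
proof (induction xs)
  case (Cons x xs)
  then have "perm_of xs i = i" by simp
  then show ?case using Cons.prems by (auto simp: perm_of_Cons simple_refl_def transpose_def)
qed (simp add: perm_of_Nil)

lemma perm_of_stays_above: "set xs \<subseteq> {Suc a..} \<Longrightarrow> a < i \<Longrightarrow> a < perm_of xs i"
proof (induction xs)
  case (Cons x xs)
  then have "a < perm_of xs i" by simp
  then show ?case using Cons.prems by (auto simp: perm_of_Cons simple_refl_def transpose_def)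
qed (simp add: perm_of_Nil)

lemma perm_of_interval:
  assumes "a \<le> i" "i \<le> b"
  shows "perm_of [a..<b] i = (if i = b then a else Suc i)"
  using assms
proof (induction "b - a" arbitrary: a)
  case 0
  then show ?case by (simp add: perm_of_Nil)
next
  case (Suc d)
  then have ab: "a < b" by simp
  have eq: "perm_of [a..<b] i = simple_refl a (perm_of [Suc a..<b] i)"
    using upt_conv_Cons[OF ab] by (simp add: perm_of_Cons)
  show ?case
  proof (cases "i = a")
    case True
    have "perm_of [Suc a..<b] a = a" by (rule perm_of_fixes[of _ "Suc a" b]) auto
    with True eq ab show ?thesis by (simp add: simple_refl_def)
  next
    case False
    then have "perm_of [Suc a..<b] i = (if i = b then Suc a else Suc i)"
      using Suc by (intro Suc.hyps(1)) auto
    with eq False Suc.prems show ?thesis by (simp add: simple_refl_def transpose_def)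
  qed
qed

text \<open>The map v writes the concatenated cycles into consecutive positions. On each interval
  the block word moves every position to the next one and the last to the first, just as w moves
  along the corresponding cycle.\<close>

lemma block_word_conjugates:
  assumes "map v [Suc k..<Suc (k + sum_list (map length L))] = concat L"
    and "\<And>l. l \<in> set L \<Longrightarrow> l \<noteq> [] \<and> map w l = rotate1 l"
    and "k < i" "i \<le> k + sum_list (map length L)"
  shows "w (v i) = v (perm_of (block_word k (map length L)) i)"
  using assms
proof (induction L arbitrary: k)
  case (Cons l L)
  let ?c = "length l"
  have split: "[Suc k..<Suc (k + sum_list (map length (l # L)))]
      = [Suc k..<Suc (k + ?c)] @ [Suc (k + ?c)..<Suc (k + ?c + sum_list (map length L))]"
    using upt_add_eq_append[of "Suc k" "Suc (k + ?c)" "sum_list (map length L)"] by (simp add: add.assoc)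
  have eq: "map v [Suc k..<Suc (k + ?c)] @ map v [Suc (k + ?c)..<Suc (k + ?c + sum_list (map length L))] = l @ concat L"
    using Cons.prems(1) unfolding split by simp
  have "map v [Suc k..<Suc (k + ?c)] = l
      \<and> map v [Suc (k + ?c)..<Suc (k + ?c + sum_list (map length L))] = concat L"
    by (rule append_eq_append_conv[THEN iffD1, OF _ eq]) (simp del: upt_Suc)
  then have l: "map v [Suc k..<Suc (k + ?c)] = l"
    and L: "map v [Suc (k + ?c)..<Suc (k + ?c + sum_list (map length L))] = concat L" by blast+
  have perm: "perm_of (block_word k (map length (l # L))) i
      = perm_of [Suc k..<k + ?c] (perm_of (block_word (k + ?c) (map length L)) i)"
    by (simp add: perm_of_append)
  have set': "set (block_word (k + ?c) (map length L)) \<subseteq> {Suc (k + ?c)..<k + ?c + sum_list (map length L)}"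
    by (rule set_block_word)
  show ?case
  proof (cases "i \<le> k + ?c")
    case True
    have nth: "l ! j = v (Suc k + j)" if "j < ?c" for j
      using arg_cong[OF l, of "\<lambda>xs. xs ! j"] that by (simp del: upt_Suc)
    define j where "j = i - Suc k"
    have j: "i = Suc k + j" "j < ?c" using True Cons.prems(3) by (auto simp: j_def)
    have "perm_of (block_word (k + ?c) (map length L)) i = i"
      using True by (intro perm_of_fixes[OF set']) simp
    then have "perm_of (block_word k (map length (l # L))) i = (if i = k + ?c then Suc k else Suc i)"
      unfolding perm using True Cons.prems(3) by (simp add: perm_of_interval)
    moreover have "w (v i) = rotate1 l ! j"
      using Cons.prems(2)[of l] j nth[of j] nth_map[of j l w] by simp
    moreover have "rotate1 l ! j = l ! (Suc j mod ?c)"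
      using j(2) by (simp add: nth_rotate1)
    moreover have "Suc j mod ?c = (if i = k + ?c then 0 else Suc j)"
      using j by auto
    moreover have "l \<noteq> []" using j(2) by auto
    ultimately show ?thesis using nth[of 0] nth[of "Suc j"] j by auto
  next
    case False
    then have "k + ?c < perm_of (block_word (k + ?c) (map length L)) i"
      using set' by (intro perm_of_stays_above) auto
    then have "perm_of (block_word k (map length (l # L))) i = perm_of (block_word (k + ?c) (map length L)) i"
      unfolding perm by (intro perm_of_fixes[of _ "Suc k" "k + ?c"]) auto
    with Cons.IH[OF L] Cons.prems False show ?thesis by auto
  qed
qed simp

lemma cycle_list_exists:
  assumes "w permutes S" "finite S"
  shows "w permutes S \<and> (\<exists>L. distinct (concat L) \<and> set (concat L) = S \<and> (\<forall>l\<in>set L. l \<noteq> [] \<and> map w l = rotate1 l))"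
  using cycle_decomposition[OF assms]
proof (induction rule: cycle_decomp.induct)
  case empty
  show ?case by (rule conjI[OF permutes_id], rule exI[of _ "[]"]) simp
next
  case (comp I p cs)
  then obtain L where L: "distinct (concat L)" "set (concat L) = I"
    "\<And>l. l \<in> set L \<Longrightarrow> l \<noteq> [] \<and> map p l = rotate1 l" by auto
  have p: "p permutes I" using comp.IH by blast
  have perm: "(cycle_of_list cs \<circ> p) permutes (set cs \<union> I)"
    by (rule permutes_compose[OF permutes_subset[OF p] permutes_subset[OF cycle_permutes]]) auto
  have old: "map (cycle_of_list cs \<circ> p) l = rotate1 l" if "l \<in> set L" for l
  proof -
    have "cycle_of_list cs (p x) = p x" if "x \<in> set l" for x
    proof -
      have "x \<in> I" using L(2) that \<open>l \<in> set L\<close> by auto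
      then have "p x \<in> I" using permutes_in_image[OF p] by simp
      then show ?thesis using comp.hyps(3) by (intro id_outside_supp) auto
    qed
    then have "map (cycle_of_list cs \<circ> p) l = map p l" by simp
    with L(3)[OF that] show ?thesis by simp
  qed
  have "p x = x" if "x \<in> set cs" for x
    using that comp.hyps(3) by (intro permutes_not_in[OF p]) auto
  then have "map (cycle_of_list cs \<circ> p) cs = map (cycle_of_list cs) cs" by simp
  also have "\<dots> = rotate1 cs"
    using cyclic_rotation[OF comp.hyps(2), of 1] by (simp add: One_nat_def)
  finally have new: "map (cycle_of_list cs \<circ> p) cs = rotate1 cs" .
  define u where "u = cycle_of_list cs \<circ> p"
  note u = old[folded u_def] new[folded u_def] perm[folded u_def]
  have "u permutes (set cs \<union> I) \<and> (\<exists>L. distinct (concat L) \<and> set (concat L) = set cs \<union> I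
      \<and> (\<forall>l\<in>set L. l \<noteq> [] \<and> map u l = rotate1 l))"
  \<comment> \<open>\<open>cycle_decomp\<close> admits an empty cycle, which is dropped here.
    One-element cycles stay in the list, so that the fixed points are covered.\<close>
  proof (cases "cs = []")
    case True
    with L u show ?thesis by (intro conjI exI[of _ L]) auto
  next
    case False
    with L u comp.hyps(2,3) show ?thesis by (intro conjI exI[of _ "cs # L"]) auto
  qed
  then show ?case unfolding u_def .
qed

text \<open>Let ys be a word for the enumeration v of the cycles. Then xs @ ys and ys @ block are
  words for one permutation, so the lifts of xs and of the block word are conjugate up to sign, and
  their averages agree up to sign. Parity transfers because Coxeter moves preserve it.\<close>

lemma block_form:
  assumes xs: "set xs \<subseteq> {1..<n}" and L: "distinct (concat L)" "set (concat L) = {1..n}"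
    "\<And>l. l \<in> set L \<Longrightarrow> l \<noteq> [] \<and> map (perm_of xs) l = rotate1 l"
  shows "sum_list (map length L) = n
    \<and> sign_eqv n (average n (mon xs)) (average n (mon (block_word 0 (map length L))))
    \<and> even (length xs) = even (length (block_word 0 (map length L)))"
proof -
  let ?b = "block_word 0 (map length L)"
  define v where "v i = (if i \<in> {1..n} then concat L ! (i - 1) else i)" for i
  have len: "length (concat L) = n"
    using distinct_card[OF L(1)] L(2) by simp
  then have sum: "sum_list (map length L) = n" by (simp add: length_concat)
  have map: "map v [1..<Suc n] = concat L"
    by (rule nth_equalityI) (simp_all add: len v_def del: upt_Suc)
  have "v permutes {1..n}"
  proof (rule bij_imp_permutes)
    have "inj_on v {1..n}"
      using L(1) unfolding map[symmetric] distinct_map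
      by (simp add: atLeastLessThanSuc_atLeastAtMost del: upt_Suc)
    moreover have "v ` {1..n} = {1..n}"
      using L(2) unfolding map[symmetric] by (simp add: atLeastLessThanSuc_atLeastAtMost del: upt_Suc)
    ultimately show "bij_betw v {1..n} {1..n}" by (simp add: bij_betw_def)
  qed (auto simp: v_def)
  then obtain ys where ys: "set ys \<subseteq> {1..<n}" "perm_of ys = v"
    using permutation_word by blast
  have b: "set ?b \<subseteq> {1..<n}"
    using set_block_word[of 0 "map length L"] unfolding sum by (simp add: One_nat_def)
  have "perm_of xs (v i) = v (perm_of ?b i)" for i
  proof (cases "i \<in> {1..n}")
    case True
    show ?thesis
      by (rule block_word_conjugates[OF _ L(3)])
        (use map sum True in \<open>simp_all add: One_nat_def del: upt_Suc\<close>)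
  next
    case False
    then have "v i = i" "perm_of ?b i = i" "perm_of xs i = i"
      using permutes_not_in[OF perm_of_permutes[OF b]] permutes_not_in[OF perm_of_permutes[OF xs]]
      by (auto simp: v_def)
    then show ?thesis by simp
  qed
  then have "perm_of (xs @ ys) = perm_of (ys @ ?b)"
    unfolding perm_of_append ys(2) by (intro ext) simp
  then have coxeter_eqv: "coxeter_eqv n (xs @ ys) (ys @ ?b)"
    using xs ys(1) b by (intro coxeter_eqv_perm_eq) auto
  have c: "mon xs \<in> fcar (T_gens n)" "mon (rev ys) \<in> fcar (T_gens n)" "mon ?b \<in> fcar (T_gens n)"
    using xs ys(1) b by (auto intro!: fcar_mon_T)
  have "sign_eqv n (mon xs * (mon ys * mon (rev ys))) (mon xs * 1)"
    using mon_rev_right[OF ys(1)] by (intro sign_eqv_mult_left c) (simp add: sign_eqv_def)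
  then have 1: "sign_eqv n (mon xs) (mon (xs @ ys) * mon (rev ys))"
    using sign_eqv_sym by (simp add: mon_append mult.assoc)
  have "sign_eqv n (mon (xs @ ys) * mon (rev ys)) (mon (ys @ ?b) * mon (rev ys))"
    by (rule sign_eqv_mult_right[OF coxeter_eqv_sign_eqv[OF coxeter_eqv] c(2)])
  then have "sign_eqv n (mon (xs @ ys) * mon (rev ys)) (conj_by ys (mon ?b))"
    by (simp add: conj_by_def mon_append)
  from sign_eqv_trans[OF 1 this] have "sign_eqv n (average n (mon xs)) (average n (conj_by ys (mon ?b)))"
    unfolding sign_eqv_def using average_cong[of n "mon xs" "conj_by ys (mon ?b)"]
      average_cong[of n "mon xs" "- conj_by ys (mon ?b)"] by (auto simp: average_minus)
  moreover have "sign_eqv n (average n (conj_by ys (mon ?b))) (average n (mon ?b))"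
    using average_conj_by[OF ys(1) c(3)] by (simp add: sign_eqv_def)
  ultimately have "sign_eqv n (average n (mon xs)) (average n (mon ?b))" by (rule sign_eqv_trans)
  with sum coxeter_eqv_parity[OF coxeter_eqv] show ?thesis by auto
qed

lemma average_even_block_zero:
  assumes sum: "c + sum_list cs = n" and c: "even c" "0 < c" and even: "even (length (block_word 0 (c # cs)))"
  shows "T.eqv n (average n (mon (block_word 0 (c # cs)))) 0"
proof -
  let ?a = "[1..<c]" and ?b = "block_word c cs"
  have eq: "block_word 0 (c # cs) = ?a @ ?b" by (simp add: One_nat_def)
  have odd: "odd (length ?a)" using c by simp
  with even have "odd (length ?b)" unfolding eq by simp
  with odd have sign: "(- 1 :: complex) ^ (length ?a * length ?b) = - 1" by (simp del: length_upt)
  have a: "set ?a \<subseteq> {1..<n}" using sum by auto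
  have "set ?b \<subseteq> {Suc c..<n}" using set_block_word[of c cs] unfolding sum .
  then have b: "set ?b \<subseteq> {1..<n}" and far: "\<And>i j. i \<in> set ?a \<Longrightarrow> j \<in> set ?b \<Longrightarrow> Suc i < j"
    by fastforce+
  have "T.eqv n (mon ?a * mon ?b) (- (mon ?b * mon ?a))"
    using mon_far_commute[OF a b far] unfolding sign by (simp add: scal_minus)
  then show ?thesis unfolding eq by (rule average_anticommuting[OF a b])
qed

definition odd_parts :: "nat \<Rightarrow> nat multiset set" where
  "odd_parts n = {M. (\<forall>a\<in>#M. odd a) \<and> sum_mset M = n}"

text \<open>Sorting the parts selects one block word for each cycle type and thereby fixes the
  sign.\<close>

definition class_sum :: "nat \<Rightarrow> nat multiset \<Rightarrow> nat free" where
  "class_sum n M = average n (mon (block_word 0 (sorted_list_of_multiset M)))"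

lemma class_sum_fcar: "M \<in> odd_parts n \<Longrightarrow> class_sum n M \<in> fcar (T_gens n)"
proof -
  assume "M \<in> odd_parts n"
  then have "sum_list (sorted_list_of_multiset M) = n"
    by (simp add: odd_parts_def sum_mset_sum_list[symmetric])
  then show ?thesis
    unfolding class_sum_def using set_block_word[of 0 "sorted_list_of_multiset M"]
    by (intro average_fcar fcar_mon_T) (simp add: One_nat_def)
qed

text \<open>The list of cycles may be reordered freely: an even cycle is brought to the front for
  \<open>average_even_block_zero\<close>, otherwise the cycles are sorted by length to match
  \<open>class_sum\<close>.\<close>

lemma average_even_word:
  assumes xs: "set xs \<subseteq> {1..<n}" and even: "even (length xs)"
  shows "T.eqv n (average n (mon xs)) 0 \<or> (\<exists>M\<in>odd_parts n. sign_eqv n (average n (mon xs)) (class_sum n M))"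
proof -
  obtain L where L: "distinct (concat L)" "set (concat L) = {1..n}"
    "\<And>l. l \<in> set L \<Longrightarrow> l \<noteq> [] \<and> map (perm_of xs) l = rotate1 l"
    using cycle_list_exists[OF perm_of_permutes[OF xs] finite_atLeastAtMost] by blast
  have reorder: "distinct (concat L')" "set (concat L') = {1..n}"
    "\<And>l. l \<in> set L' \<Longrightarrow> l \<noteq> [] \<and> map (perm_of xs) l = rotate1 l" if "mset L' = mset L" for L'
  proof -
    have "mset (concat L') = mset (concat L)"
      by (simp add: mset_concat that flip: sum_mset_sum_list mset_map) (simp add: that)
    then show "distinct (concat L')" "set (concat L') = {1..n}"
      using L(1,2) mset_eq_imp_distinct_iff mset_eq_setD by metis+
    show "l \<noteq> [] \<and> map (perm_of xs) l = rotate1 l" if "l \<in> set L'" for l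
      using L(3)[of l] that mset_eq_setD[OF \<open>mset L' = mset L\<close>] by simp
  qed
  show ?thesis
  proof (cases "\<exists>l\<in>set L. even (length l)")
    case True
    then obtain l where l: "l \<in> set L" "even (length l)" by blast
    let ?L = "l # remove1 l L"
    have "mset ?L = mset L" using l(1) by simp
    note block = block_form[OF xs reorder[OF this]]
    have "T.eqv n (average n (mon (block_word 0 (map length ?L)))) 0"
      unfolding list.map by (rule average_even_block_zero) (use block l L(3)[OF l(1)] even in simp_all)
    then have "sign_eqv n (average n (mon (block_word 0 (map length ?L)))) 0"
      unfolding sign_eqv_def by (rule disjI1)
    from sign_eqv_trans[OF conjunct1[OF conjunct2[OF block]] this] have "sign_eqv n (average n (mon xs)) 0" .
    then show ?thesis by (simp add: sign_eqv_def)
  next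
    case False
    let ?L = "sort_key length L" and ?M = "mset (map length L)"
    have "mset ?L = mset L" by simp
    note block = block_form[OF xs reorder[OF this]]
    have "sorted (map length ?L)" by simp
    moreover have "mset (map length ?L) = ?M" by simp
    ultimately have "map length ?L = sorted_list_of_multiset ?M"
      by (metis sorted_list_of_multiset_mset sorted_sort_id)
    then have "sign_eqv n (average n (mon xs)) (class_sum n ?M)" using block by (simp add: class_sum_def)
    moreover have "sum_mset ?M = n" using block by (simp add: sum_mset_sum_list[symmetric])
    then have "?M \<in> odd_parts n" using False by (auto simp: odd_parts_def)
    ultimately show ?thesis by blast
  qed
qed

section \<open>Partitions and the dimension count\<close>

text \<open>Euler's map: \<open>c\<close> copies of an odd part \<open>q\<close> are merged according to the binary digits of \<open>c\<close>.\<close>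

definition binary_parts :: "nat multiset \<Rightarrow> nat set" where
  "binary_parts M = (\<lambda>(q, e). 2 ^ e * q) ` (SIGMA q:set_mset M. set_decode (count M q))"

lemma odd_times_power_eq:
  assumes "odd q" "odd r" "2 ^ e * q = 2 ^ d * (r::nat)"
  shows "e = d \<and> q = r"
  using assms(3)
proof (induction e arbitrary: d)
  case 0
  with assms(1) show ?case by (cases d) auto
next
  case (Suc e)
  with assms(2) show ?case by (cases d) auto
qed

text \<open>The odd part of a merged part identifies q, so the binary digits of the multiplicity of
  q can be read back; this makes the map injective.\<close>

lemma binary_parts_decode:
  assumes "\<forall>a\<in>#M. odd a" "odd q"
  shows "{e. 2 ^ e * q \<in> binary_parts M} = set_decode (count M q)"
proof -
  have "2 ^ e * q \<in> binary_parts M \<longleftrightarrow> e \<in> set_decode (count M q)" for e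
  proof
    assume "2 ^ e * q \<in> binary_parts M"
    then obtain r d where r: "r \<in># M" "d \<in> set_decode (count M r)" "2 ^ e * q = 2 ^ d * r"
      unfolding binary_parts_def by auto
    with odd_times_power_eq[OF assms(2) _ r(3)] assms(1) show "e \<in> set_decode (count M q)" by blast
  next
    assume e: "e \<in> set_decode (count M q)"
    then have "q \<in># M" by (metis not_in_iff set_decode_zero empty_iff)
    with e show "2 ^ e * q \<in> binary_parts M" unfolding binary_parts_def by force
  qed
  then show ?thesis by blast
qed

lemma inj_binary_parts: "inj_on binary_parts (odd_parts n)"
proof (rule inj_onI)
  fix M N assume M: "M \<in> odd_parts n" and N: "N \<in> odd_parts n" and eq: "binary_parts M = binary_parts N"
  have "count M q = count N q" for q
  proof (cases "odd q")
    case True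
    have "set_decode (count M q) = set_decode (count N q)"
      using binary_parts_decode[OF _ True, of M] binary_parts_decode[OF _ True, of N] M N
      by (simp add: odd_parts_def eq)
    then show ?thesis by (metis set_decode_inverse)
  next
    case False
    then have "q \<notin># M" "q \<notin># N" using M N by (auto simp: odd_parts_def)
    then show ?thesis by (simp add: not_in_iff)
  qed
  then show "M = N" by (rule multiset_eqI)
qed

lemma sum_mset_count:
  "finite A \<Longrightarrow> set_mset M \<subseteq> A \<Longrightarrow> sum_mset M = (\<Sum>q\<in>A. count M q * q)" for M :: "nat multiset"
proof (induction M)
  case (add x M)
  have "(\<Sum>q\<in>A. count (add_mset x M) q * q) = (\<Sum>q\<in>A. (if q = x then q else 0) + count M q * q)"
    by (rule sum.cong) auto
  also have "\<dots> = x + sum_mset M"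
    using add by (simp add: sum.distrib)
  finally show ?case by simp
qed simp

lemma binary_parts_strict:
  assumes M: "M \<in> odd_parts n"
  shows "binary_parts M \<in> strict_parts n"
proof -
  let ?S = "SIGMA q:set_mset M. set_decode (count M q)"
  have odd: "odd q" if "q \<in># M" for q using M that by (simp add: odd_parts_def)
  have inj: "inj_on (\<lambda>(q, e). 2 ^ e * q) ?S"
  proof (rule inj_onI)
    fix x y assume xy: "x \<in> ?S" "y \<in> ?S" "(\<lambda>(q, e). 2 ^ e * q) x = (\<lambda>(q, e). 2 ^ e * q) y"
    obtain q e r d where eq: "x = (q, e)" "y = (r, d)" by (cases x, cases y)
    have "odd q" "odd r" "2 ^ e * q = 2 ^ d * r" using xy odd unfolding eq by simp_all
    from odd_times_power_eq[OF this] show "x = y" unfolding eq by simp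
  qed
  have "\<Sum>(binary_parts M) = (\<Sum>(q, e)\<in>?S. 2 ^ e * q)"
    unfolding binary_parts_def sum.reindex[OF inj] by (simp add: case_prod_unfold)
  also have "\<dots> = (\<Sum>q\<in>set_mset M. \<Sum>e\<in>set_decode (count M q). 2 ^ e * q)"
    by (rule sum.Sigma[symmetric]) auto
  also have "\<dots> = (\<Sum>q\<in>set_mset M. set_encode (set_decode (count M q)) * q)"
    unfolding set_encode_def sum_distrib_right ..
  also have "\<dots> = sum_mset M" using sum_mset_count[of "set_mset M" M] by simp
  also have "\<dots> = n" using M by (simp add: odd_parts_def)
  finally have sum: "\<Sum>(binary_parts M) = n" .
  have fin: "finite (binary_parts M)" unfolding binary_parts_def
    by (rule finite_imageI, rule finite_SigmaI) simp_all
  have "x \<in> {1..n}" if x: "x \<in> binary_parts M" for x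
  proof -
    have "x \<le> n" using member_le_sum[OF x, of "\<lambda>x. x"] fin sum by simp
    moreover obtain q e where "q \<in># M" "x = 2 ^ e * q" using x unfolding binary_parts_def by auto
    with odd[of q] have "0 < x" by (cases "q = 0") auto
    ultimately show ?thesis by simp
  qed
  with sum show ?thesis unfolding strict_parts_def by blast
qed

lemma finite_odd_parts: "finite (odd_parts n)"
  and card_odd_parts: "card (odd_parts n) \<le> card (strict_parts n)"
  using inj_on_finite[OF inj_binary_parts _ finite_strict_parts[of n]]
    card_inj_on_le[OF inj_binary_parts _ finite_strict_parts[of n]] binary_parts_strict by blast+

lemma scal_sum: "scal (sum f S) = (\<Sum>i\<in>S. scal (f i))"
  by (induction S rule: infinite_finite_induct) (simp_all add: scal_add)

text \<open>A central element equals its average, and averaging a combination of even words word by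
  word gives class sums and zeros.\<close>

lemma even_central_span:
  assumes z: "z \<in> centre (T_alg n)" "z \<in> T_even n"
  shows "\<exists>t. z = T.cl n (\<Sum>M\<in>odd_parts n. scal (t M) * class_sum n M)"
proof -
  let ?comb = "\<lambda>t. \<Sum>M\<in>odd_parts n. scal (t M) * class_sum n M"
  obtain p where p: "p \<in> fcar (T_gens n)" "\<forall>w\<in>Poly_Mapping.keys p. even (length (letters w))" "z = T.cl n p"
    using z(2) unfolding T_even_def free_alg_simps T.cl_def unfolding T_gens_def by blast
  have word: "\<exists>t. T.eqv n (average n (mon xs)) (?comb t)"
    if xs: "set xs \<subseteq> {1..<n}" "even (length xs)" for xs
  proof -
    have single: "?comb (\<lambda>N. if N = M then e else 0) = scal e * class_sum n M" if "M \<in> odd_parts n" for M e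
    proof -
      have "?comb (\<lambda>N. if N = M then e else 0) = (\<Sum>N\<in>odd_parts n. if N = M then scal e * class_sum n N else 0)"
        by (rule sum.cong) auto
      then show ?thesis using that by (simp add: finite_odd_parts)
    qed
    from average_even_word[OF xs] show ?thesis
    proof
      assume "T.eqv n (average n (mon xs)) 0"
      then show ?thesis by (intro exI[of _ "\<lambda>M. 0"]) simp
    next
      assume "\<exists>M\<in>odd_parts n. sign_eqv n (average n (mon xs)) (class_sum n M)"
      then obtain M e where "M \<in> odd_parts n" "T.eqv n (average n (mon xs)) (scal e * class_sum n M)"
        by (blast elim: sign_eqv_cases)
      then show ?thesis using single[of M e] by (intro exI[of _ "\<lambda>N. if N = M then e else 0"]) simp
    qed
  qed
  have "\<forall>w\<in>Poly_Mapping.keys p. \<exists>t. T.eqv n (average n (mon (letters w))) (?comb t)"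
    using p(1,2) by (intro ballI word) (auto simp: fcar_def T_gens_def)
  then obtain t where t: "\<And>w. w \<in> Poly_Mapping.keys p \<Longrightarrow> T.eqv n (average n (mon (letters w))) (?comb (t w))"
    by metis
  let ?c = "Poly_Mapping.lookup p" and ?u = "\<lambda>M. \<Sum>w\<in>Poly_Mapping.keys p. Poly_Mapping.lookup p w * t w M"
  have "average n p = (\<Sum>w\<in>Poly_Mapping.keys p. scal (?c w) * average n (mon (letters w)))"
    by (subst free_expand[of p]) (simp only: average_sum average_scal)
  also have "T.eqv n \<dots> (\<Sum>w\<in>Poly_Mapping.keys p. scal (?c w) * ?comb (t w))"
    by (intro T.eqv_sum T.eqv_mult_left t fcar_scal)
  also have "\<dots> = (\<Sum>M\<in>odd_parts n. \<Sum>w\<in>Poly_Mapping.keys p. scal (?c w) * (scal (t w M) * class_sum n M))"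
    unfolding sum_distrib_left by (rule sum.swap)
  also have "\<dots> = ?comb ?u"
    by (simp only: scal_sum sum_distrib_right scal_mult mult.assoc)
  finally have average: "T.eqv n (average n p) (?comb ?u)" .
  have "T.eqv n p (?comb ?u)"
    by (rule T.eqv_trans[OF T.eqv_sym[OF average_central[OF z(1)[unfolded p(3)] p(1)]] average])
  moreover have "?comb ?u \<in> fcar (T_gens n)"
    by (intro fcar_sum fcar_mult fcar_scal class_sum_fcar)
  ultimately have "T.cl n p = T.cl n (?comb ?u)" using T.cl_eq_iff p(1) by blast
  then show ?thesis unfolding p(3) by (intro exI[of _ ?u])
qed

section \<open>Linear algebra and the comparison of dimensions\<close>

lemma homogeneous_system:
  fixes t :: "'s \<Rightarrow> 'o \<Rightarrow> complex"
  assumes "finite Q" "finite S" "card Q < card S"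
  shows "\<exists>c. (\<exists>s\<in>S. c s \<noteq> 0) \<and> (\<forall>x\<in>Q. (\<Sum>s\<in>S. c s * t s x) = 0)"
  using assms
proof (induction Q arbitrary: S t rule: finite_induct)
  case empty
  then have "S \<noteq> {}" by auto
  then show ?case by (intro exI[of _ "\<lambda>s. 1"]) auto
next
  case (insert y Q)
  show ?case
  proof (cases "\<forall>s\<in>S. t s y = 0")
    case True
    have "card Q < card S" using insert by simp
    then obtain c where "\<exists>s\<in>S. c s \<noteq> 0" "\<forall>x\<in>Q. (\<Sum>s\<in>S. c s * t s x) = 0"
      using insert.IH[OF insert.prems(1), of t] by blast
    with True show ?thesis by (intro exI[of _ c]) auto
  next
    case False
    then obtain r where r: "r \<in> S" "t r y \<noteq> 0" by blast
    define S' where "S' = S - {r}"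
    have S': "finite S'" "card Q < card S'" "S = insert r S'" "r \<notin> S'"
      using insert r(1) by (auto simp: S'_def)
    obtain c where c: "\<exists>s\<in>S'. c s \<noteq> 0" "\<forall>x\<in>Q. (\<Sum>s\<in>S'. c s * (t s x - t s y / t r y * t r x)) = 0"
      using insert.IH[OF S'(1,2), of "\<lambda>s x. t s x - t s y / t r y * t r x"] by blast
    \<comment> \<open>Elimination with pivot r: the equation of y is solved for the unknown r, and
      the induction hypothesis was applied to the system obtained by substituting it.\<close>
    define d where "d s = (if s = r then - (\<Sum>s\<in>S'. c s * t s y) / t r y else c s)" for s
    have sum: "(\<Sum>s\<in>S. d s * t s x) = (\<Sum>s\<in>S'. c s * (t s x - t s y / t r y * t r x))" for x
    proof -
      have "(\<Sum>s\<in>S'. d s * t s x) = (\<Sum>s\<in>S'. c s * t s x)"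
        using S'(4) by (intro sum.cong) (auto simp: d_def)
      then have "(\<Sum>s\<in>S. d s * t s x) = - (\<Sum>s\<in>S'. c s * t s y) / t r y * t r x + (\<Sum>s\<in>S'. c s * t s x)"
        using S' by (simp add: d_def)
      also have "\<dots> = (\<Sum>s\<in>S'. c s * (t s x - t s y / t r y * t r x))"
        by (simp add: right_diff_distrib sum_subtractf sum_distrib_right sum_divide_distrib mult.assoc)
      finally show ?thesis .
    qed
    have "(\<Sum>s\<in>S. d s * t s y) = 0" unfolding sum using r(2) by simp
    with sum c S'(3,4) show ?thesis by (intro exI[of _ d]) (auto simp: d_def)
  qed
qed

text \<open>The target u is adjoined as a further vector, indexed by \<open>None\<close>, which
  makes more vectors than coordinates. In a nontrivial relation the coefficient of u is either zero,
  leaving a dependence, or can be divided out.\<close>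

lemma dependent_or_spanned:
  fixes t :: "'s \<Rightarrow> 'o \<Rightarrow> complex"
  assumes Q: "finite Q" and S: "finite S" and card: "card Q \<le> card S"
  shows "(\<exists>c. (\<exists>s\<in>S. c s \<noteq> 0) \<and> (\<forall>x\<in>Q. (\<Sum>s\<in>S. c s * t s x) = 0))
    \<or> (\<exists>c. \<forall>x\<in>Q. (\<Sum>s\<in>S. c s * t s x) = u x)"
proof -
  let ?S = "insert None (Some ` S)"
  have "card ?S = Suc (card S)" using S by (simp add: card_image)
  then obtain c where c: "\<exists>s\<in>?S. c s \<noteq> 0" "\<forall>x\<in>Q. (\<Sum>s\<in>?S. c s * (case s of None \<Rightarrow> u x | Some s \<Rightarrow> t s x)) = 0"
    using homogeneous_system[OF Q, of ?S "\<lambda>s x. case s of None \<Rightarrow> u x | Some s \<Rightarrow> t s x"] S card by auto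
  have sum: "c None * u x + (\<Sum>s\<in>S. c (Some s) * t s x) = 0" if "x \<in> Q" for x
    using c(2) that S by (simp add: sum.reindex)
  show ?thesis
  proof (cases "c None = 0")
    case True
    with c(1) sum show ?thesis by (intro disjI1 exI[of _ "\<lambda>s. c (Some s)"]) auto
  next
    case False
    have solution: "(\<Sum>s\<in>S. - c (Some s) / c None * t s x) = u x" if "x \<in> Q" for x
    proof -
      have "(\<Sum>s\<in>S. c (Some s) * t s x) = - (c None * u x)"
        by (rule minus_unique[OF sum[OF that], symmetric])
      moreover have "(\<Sum>s\<in>S. - c (Some s) / c None * t s x) = (- 1 / c None) * (\<Sum>s\<in>S. c (Some s) * t s x)"
        unfolding sum_distrib_left by (rule sum.cong) simp_all
      ultimately show ?thesis using False by simp
    qed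
    show ?thesis
      by (intro disjI2 exI[of _ "\<lambda>s. - c (Some s) / c None"] ballI solution)
  qed
qed

lemma zeta_linear:
  assumes rho: "diagonal_embedding n \<rho>" and zeta: "vogan_map n \<rho> \<zeta>"
    and S: "finite S" and q: "\<And>s. s \<in> S \<Longrightarrow> central_eigen n (q s) (\<chi> s)"
    and p: "\<And>s. s \<in> S \<Longrightarrow> p s \<in> fcar (T_gens n)" "\<And>s. s \<in> S \<Longrightarrow> \<zeta> (H.cl n (q s)) = T.cl n (p s)"
  shows "\<zeta> (H.cl n (\<Sum>s\<in>S. scal (c s) * q s)) = T.cl n (\<Sum>s\<in>S. scal (c s) * p s)"
proof -
  note hom = zeta_hom[OF rho zeta]
  have add: "\<zeta> (x \<oplus>\<^bsub>hecke n\<^esub> y) = \<zeta> x \<oplus>\<^bsub>T_alg n\<^esub> \<zeta> y"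
    if "x \<in> centre (hecke n)" "y \<in> centre (hecke n)" for x y
    using alg_hom_add[OF hom, of x y] that by (simp add: centre_alg_def)
  have smult: "\<zeta> (a \<odot>\<^bsub>hecke n\<^esub> x) = a \<odot>\<^bsub>T_alg n\<^esub> \<zeta> x" if "x \<in> centre (hecke n)" for a x
    using alg_hom_smult[OF hom, of x a] that by (simp add: centre_alg_def)
  have central_eigen: "central_eigen n (scal a * r) (\<lambda>L. a * \<psi> L)" if "central_eigen n r \<psi>" for a r \<psi>
    by (rule central_eigen_mult[OF central_eigen_scal that])
  have single: "\<zeta> (H.cl n (scal a * r)) = T.cl n (scal a * t)"
    if "central_eigen n r \<psi>" "t \<in> fcar (T_gens n)" "\<zeta> (H.cl n r) = T.cl n t" for a r \<psi> t
  proof -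
    have r: "r \<in> fcar (hecke_gens n)" using that(1) by (simp add: central_eigen_def)
    show ?thesis
      using smult[OF central_eigen_centre[OF that(1)], of a] that(2,3) r by (simp add: hecke_ops T_ops)
  qed
  show ?thesis
    using S q p
  proof (induction S rule: finite_induct)
    \<comment> \<open>The value at 0 follows from homogeneity with the scalar 0.\<close>
    case empty
    have 0: "central_eigen n 0 (\<lambda>L. 0)" using central_eigen_scal[of n 0] by simp
    have "\<zeta> (H.cl n 0) \<in> carrier (T_alg n)"
      using zeta_centre[OF rho zeta central_eigen_centre[OF 0]] by (simp add: centre_def)
    then obtain t where t: "t \<in> fcar (T_gens n)" "\<zeta> (H.cl n 0) = T.cl n t" by (rule T_cases)
    from single[OF 0 t, of 0] show ?case by simp
  next
    case (insert s S)
    let ?r = "\<Sum>s\<in>S. scal (c s) * q s" and ?t = "\<Sum>s\<in>S. scal (c s) * p s"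
    have r: "central_eigen n ?r (\<lambda>L. \<Sum>s\<in>S. c s * \<chi> s L)"
      using insert.prems(1) by (intro central_eigen_sum central_eigen) simp
    have qs: "central_eigen n (scal (c s) * q s) (\<lambda>L. c s * \<chi> s L)"
      using insert.prems(1) by (intro central_eigen) simp
    have c: "?r \<in> fcar (hecke_gens n)" "scal (c s) * q s \<in> fcar (hecke_gens n)"
      using r qs by (simp_all add: central_eigen_def)
    have t: "?t \<in> fcar (T_gens n)" "scal (c s) * p s \<in> fcar (T_gens n)"
      using insert.prems(2) by (auto intro!: fcar_sum)
    have "\<zeta> (H.cl n (scal (c s) * q s + ?r)) = \<zeta> (H.cl n (scal (c s) * q s)) \<oplus>\<^bsub>T_alg n\<^esub> \<zeta> (H.cl n ?r)"
      using add[OF central_eigen_centre[OF qs] central_eigen_centre[OF r]] c by (simp add: hecke_ops)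
    also have "\<zeta> (H.cl n (scal (c s) * q s)) = T.cl n (scal (c s) * p s)"
      using insert.prems by (intro single[of _ "\<chi> s"]) simp_all
    also have "\<zeta> (H.cl n ?r) = T.cl n ?t"
      using insert.prems by (intro insert.IH) simp_all
    also have "T.cl n (scal (c s) * p s) \<oplus>\<^bsub>T_alg n\<^esub> T.cl n ?t = T.cl n (scal (c s) * p s + ?t)"
      using t by (simp add: T_ops)
    finally show ?case using insert.hyps by simp
  qed
qed

text \<open>The interpolating elements \<open>q L\<close> are sent to combinations of class sums. A
  dependence with coefficients c among them gives an element killed by \<zeta> whose eigenvalue at
  each L is \<open>c L\<close>, so all of them vanish. Hence the coefficient vectors, being at least
  as many as the class sums, span and reach z.\<close>

lemma zeta_surjective:
  assumes rho: "diagonal_embedding n \<rho>" and zeta: "vogan_map n \<rho> \<zeta>"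
    and z: "z \<in> centre (T_alg n)" "z \<in> T_even n"
  shows "z \<in> \<zeta> ` centre (hecke n)"
proof -
  let ?S = "strict_parts n" and ?Q = "odd_parts n"
  have "\<forall>L\<in>?S. \<exists>q \<chi>. central_eigen n q \<chi> \<and> \<chi> L = 1 \<and> (\<forall>M\<in>?S - {L}. \<chi> M = 0)"
    using lagrange_element by blast
  then obtain q \<chi> where q: "\<And>L. L \<in> ?S \<Longrightarrow> central_eigen n (q L) (\<chi> L)"
    and \<chi>: "\<And>L. L \<in> ?S \<Longrightarrow> \<chi> L L = 1" "\<And>L M. L \<in> ?S \<Longrightarrow> M \<in> ?S - {L} \<Longrightarrow> \<chi> L M = 0"
    by metis
  have "\<exists>t. \<zeta> (H.cl n (q L)) = T.cl n (\<Sum>M\<in>?Q. scal (t M) * class_sum n M)" if "L \<in> ?S" for L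
    using central_eigen_centre[OF q[OF that]]
    by (intro even_central_span zeta_centre[OF rho zeta] zeta_even[OF rho zeta])
  then obtain t where t: "\<And>L. L \<in> ?S \<Longrightarrow> \<zeta> (H.cl n (q L)) = T.cl n (\<Sum>M\<in>?Q. scal (t L M) * class_sum n M)"
    by metis
  obtain u where u: "z = T.cl n (\<Sum>M\<in>?Q. scal (u M) * class_sum n M)"
    using even_central_span[OF z] by blast
  have image: "\<zeta> (H.cl n (\<Sum>L\<in>?S. scal (c L) * q L)) = T.cl n (\<Sum>M\<in>?Q. scal (\<Sum>L\<in>?S. c L * t L M) * class_sum n M)" for c
  proof -
    have "\<zeta> (H.cl n (\<Sum>L\<in>?S. scal (c L) * q L))
        = T.cl n (\<Sum>L\<in>?S. scal (c L) * (\<Sum>M\<in>?Q. scal (t L M) * class_sum n M))"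
      by (rule zeta_linear[OF rho zeta finite_strict_parts q _ t])
        (auto intro!: fcar_sum fcar_mult fcar_scal class_sum_fcar)
    also have "(\<Sum>L\<in>?S. scal (c L) * (\<Sum>M\<in>?Q. scal (t L M) * class_sum n M))
        = (\<Sum>M\<in>?Q. \<Sum>L\<in>?S. scal (c L) * (scal (t L M) * class_sum n M))"
      unfolding sum_distrib_left by (rule sum.swap)
    also have "\<dots> = (\<Sum>M\<in>?Q. scal (\<Sum>L\<in>?S. c L * t L M) * class_sum n M)"
      by (simp only: scal_sum sum_distrib_right scal_mult mult.assoc)
    finally show ?thesis .
  qed
  have comb: "central_eigen n (\<Sum>L\<in>?S. scal (c L) * q L) (\<lambda>M. \<Sum>L\<in>?S. c L * \<chi> L M)" for c
    by (intro central_eigen_sum central_eigen_mult central_eigen_scal q)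
  have eigen: "(\<Sum>L\<in>?S. c L * \<chi> L M) = c M" if M: "M \<in> ?S" for c M
  proof -
    have "(\<Sum>L\<in>?S. c L * \<chi> L M) = (\<Sum>L\<in>?S. if L = M then c L else 0)"
      using \<chi> M by (intro sum.cong) auto
    then show ?thesis using M by (simp add: finite_strict_parts)
  qed
  from dependent_or_spanned[OF finite_odd_parts finite_strict_parts card_odd_parts, of n t u]
  show ?thesis
  proof (elim disjE exE conjE)
    fix c assume c: "\<exists>L\<in>?S. c L \<noteq> 0" "\<forall>M\<in>?Q. (\<Sum>L\<in>?S. c L * t L M) = 0"
    then have "\<zeta> (H.cl n (\<Sum>L\<in>?S. scal (c L) * q L)) = \<zero>\<^bsub>T_alg n\<^esub>"
      unfolding image by (simp add: T_ops)
    from zeta_zero_eigenvalue[OF rho zeta comb this] c(1) show ?thesis using eigen by auto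
  next
    fix c assume "\<forall>M\<in>?Q. (\<Sum>L\<in>?S. c L * t L M) = u M"
    then have "\<zeta> (H.cl n (\<Sum>L\<in>?S. scal (c L) * q L)) = z" unfolding image u by simp
    then show ?thesis using central_eigen_centre[OF comb] by blast
  qed
qed

theorem theorem3:
  fixes n :: nat
    and \<rho> :: "nat free set \<Rightarrow> hecke_cliff"
    and \<zeta> :: "hecke_gen free set \<Rightarrow> nat free set"
  assumes "n \<ge> 1"
    and "diagonal_embedding n \<rho>"
    and "vogan_map n \<rho> \<zeta>"
  shows "\<zeta> ` centre (hecke n) = centre (T_alg n) \<inter> T_even n \<and>
    (\<forall>f\<in>polys n. symmetric_poly n f \<and> odd_poly n f \<longrightarrow> \<zeta> (hecke_poly n f) = \<zero>\<^bsub>T_alg n\<^esub>)"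
proof (intro conjI ballI impI)
  show "\<zeta> ` centre (hecke n) = centre (T_alg n) \<inter> T_even n"
  proof (intro equalityI subsetI)
    fix z assume "z \<in> \<zeta> ` centre (hecke n)"
    then show "z \<in> centre (T_alg n) \<inter> T_even n"
      using zeta_centre[OF assms(2,3)] zeta_even[OF assms(2,3)] by blast
  next
    fix z assume "z \<in> centre (T_alg n) \<inter> T_even n"
    then show "z \<in> \<zeta> ` centre (hecke n)" using zeta_surjective[OF assms(2,3), of z] by blast
  qed
next
  fix f assume "f \<in> polys n" and f: "symmetric_poly n f \<and> odd_poly n f"
  show "\<zeta> (hecke_poly n f) = \<zero>\<^bsub>T_alg n\<^esub>"
    by (rule zeta_theta_odd[OF assms(2,3) hecke_poly_centre hecke_theta_odd_poly]) (use f in blast)+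
qed

end
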